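(* Let $S$ be a closed oriented surface of genus $g\ge 2$ and let $\mu=(m_1,\dots,m_k)$ be a tuple of positive integers. Then $\mathrm{hol}\big(\mathcal{RP}^2(\mu)\big)$ is an open subset of $\mathfrak X_3(S)$.
   Context: $\mathrm{PSL}(3,\mathbb R)$ acts on $\mathbb{RP}^2$ by projective transformations. A branched real projective chart on $S$ is a pair $(U,\varphi)$ with $U\subseteq S$ open and $\varphi\colon U\to\varphi(U)\subseteq\mathbb{RP}^2$ a finite degree branched covering map, i.e. near each $p$, in suitable disc coordinates (polar coordinates $(r,\theta)$) centred at $p$ and at $\varphi(p)$, $\varphi$ is up to isotopy the map $(r,\theta)\mapsto(r^{m+1},(m+1)\theta)$ for some integer $m\ge 0$; $p$ is then a branch point of order $m$ (order $0$ means regular point). A branched real projective structure $\sigma$ on $S$ consists of a discrete (possibly empty) set $\mathcal B\subset S$, a maximal atlas of $\mathbb{RP}^2$-valued charts (homeomorphisms onto open sets) on $S\setminus\mathcal B$, and a maximal collection of branched charts centred at the points of $\mathcal B$, such that any two overlapping charts differ, on overlaps, by post-composition with an element of $\mathrm{PSL}(3,\mathbb R)$. Such a structure has a developing map $\mathrm{dev}_\sigma\colon\widetilde S\to\mathbb{RP}^2$, obtained by continuation of charts, unique up to post-composition with an element of $\mathrm{PSL}(3,\mathbb R)$, and equivariant with respect to a representation $\rho\colon\pi_1(S)\to\mathrm{PSL}(3,\mathbb R)$, its holonomy. $\mathcal{RP}^2(\mu)$ is the set of marked branched real projective structures on $S$ (up to isotopy and projective isomorphism) having exactly $k$ branch points,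 of orders $m_1,\dots,m_k$. $\mathfrak X_3(S)=\mathrm{Hom}^+(\pi_1(S),\mathrm{PSL}(3,\mathbb R))/\mathrm{PSL}(3,\mathbb R)$ is the character variety with the quotient topology, where $\mathrm{Hom}^+$ denotes the completely reducible representations and $\mathrm{PSL}(3,\mathbb R)$ acts by conjugation. The holonomy map $\mathrm{hol}$ sends a structure to the conjugacy class of its holonomy; $\mathrm{hol}(\mathcal{RP}^2(\mu))\subseteq\mathfrak X_3(S)$ is the set of classes $[\rho]\in\mathfrak X_3(S)$ such that $\rho$ is the holonomy of some structure in $\mathcal{RP}^2(\mu)$. *)

theory Defs
  imports "HOL-Analysis.Analysis" "HOL-Homology.Homology"
begin

typedef rp2 = "{L :: (real^3) set. \<exists>v. v \<noteq> 0 \<and> L = span {v}}"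
proof -
  have "axis 1 1 \<noteq> (0 :: real^3)" by (simp add: axis_eq_0_iff)
  then show ?thesis by blast
qed

definition line_through :: "real^3 \<Rightarrow> rp2" where
  "line_through v = Abs_rp2 (span {v})"

text \<open>The topology of \<^typ>\<open>rp2\<close> is the quotient topology along \<^const>\<open>line_through\<close>, restricted
  to the open set of nonzero vectors.\<close>

instantiation rp2 :: topological_space
begin

definition open_rp2 :: "rp2 set \<Rightarrow> bool" where
  "open_rp2 U \<longleftrightarrow> open {v. v \<noteq> 0 \<and> line_through v \<in> U}"

instance
proof
  have "{v :: real^3. v \<noteq> 0 \<and> line_through v \<in> UNIV} = - {0}" by auto
  then show "open (UNIV :: rp2 set)" by (simp add: open_rp2_def open_Compl)
next
  fix U V :: "rp2 set"
  assume "open U" "open V"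
  moreover have "{v. v \<noteq> 0 \<and> line_through v \<in> U \<inter> V} =
      {v. v \<noteq> 0 \<and> line_through v \<in> U} \<inter> {v. v \<noteq> 0 \<and> line_through v \<in> V}" by auto
  ultimately show "open (U \<inter> V)" by (simp add: open_rp2_def open_Int)
next
  fix K :: "rp2 set set"
  assume "\<forall>U\<in>K. open U"
  moreover have "{v. v \<noteq> 0 \<and> line_through v \<in> \<Union>K} = (\<Union>U\<in>K. {v. v \<noteq> 0 \<and> line_through v \<in> U})"
    by auto
  ultimately show "open (\<Union>K)" by (simp add: open_rp2_def open_UN)
qed

end

text \<open>As -1 is not a cube root of unity and 1 is the only real one, the centre of SL(3,R) is trivial
  (lemma \<open>centre_PSL3\<close>), so PSL(3,R) is the matrix group SL(3,R).\<close>

definition PSL3 :: "(real^3^3) set" where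
  "PSL3 = {A. det A = 1}"

definition PSL3_group :: "(real^3^3) monoid" where
  "PSL3_group = \<lparr>carrier = PSL3, mult = (**), one = mat 1\<rparr>"

definition proj_act :: "real^3^3 \<Rightarrow> rp2 \<Rightarrow> rp2" where
  "proj_act A L = Abs_rp2 ((\<lambda>v. A *v v) ` Rep_rp2 L)"

lemma centre_PSL3: "{A \<in> PSL3. \<forall>B\<in>PSL3. A ** B = B ** A} = {mat 1}"
proof (intro equalityI subsetI)
  fix A :: "real^3^3"
  assume "A \<in> {A \<in> PSL3. \<forall>B\<in>PSL3. A ** B = B ** A}"
  then have detA: "det A = 1" and comm: "\<And>B. det B = 1 \<Longrightarrow> A ** B = B ** A"
    by (auto simp: PSL3_def)
  have E: "A ** (\<chi> i j. if i = j then 1 else if i = a \<and> j = b then 1 else 0)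
         = (\<chi> i j. if i = j then 1 else if i = a \<and> j = b then 1 else 0) ** A" for a b :: 3
  proof (rule comm)
    show "det (\<chi> i j. if i = j then 1 else if i = a \<and> j = b then 1 else 0 :: real^3^3) = 1"
      using exhaust_3[of a] exhaust_3[of b] by (auto simp: det_3)
  qed
  have eqs: "A$1$2 = 0" "A$1$3 = 0" "A$2$1 = 0" "A$2$3 = 0" "A$3$1 = 0" "A$3$2 = 0"
            "A$1$1 = A$2$2" "A$2$2 = A$3$3"
    using E[of 1 2] E[of 2 1] E[of 2 3] E[of 3 2] E[of 1 3] E[of 3 1]
    by (auto simp: matrix_matrix_mult_def vec_eq_iff forall_3 sum_3)
  with detA have "A$3$3 ^ 3 = 1" by (simp add: det_3 power3_eq_cube)
  then have "A$3$3 = 1"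
    by (metis power_eq_1_iff odd_numeral odd_real_root_power_cancel real_root_one zero_less_numeral
        real_root_pos_unique)
  with eqs show "A \<in> {mat 1}" by (simp add: mat_def vec_eq_iff forall_3)
qed (auto simp: PSL3_def)

definition closed_surface :: "'a::t2_space set \<Rightarrow> bool" where
  "closed_surface S \<longleftrightarrow> S \<noteq> {} \<and> compact S \<and> connected S \<and>
     (\<forall>x\<in>S. \<exists>U. openin (top_of_set S) U \<and> x \<in> U \<and> U homeomorphic (ball 0 1 :: (real^2) set))"

text \<open>An orientation is given by a fundamental class: a class in the second homology group that
  restricts to a generator of the local homology group at every point.\<close>

definition orientation_class :: "'a::t2_space set \<Rightarrow> 'a chain set \<Rightarrow> bool" where
  "orientation_class S c \<longleftrightarrow> c \<in> carrier (homology_group 2 (top_of_set S)) \<and>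
     (\<forall>x\<in>S. let H = relative_homology_group 2 (top_of_set S) (S - {x}) in
        carrier (subgroup_generated H
          {hom_induced 2 (top_of_set S) {} (top_of_set S) (S - {x}) id c}) = carrier H)"

definition has_genus :: "'a::t2_space set \<Rightarrow> nat \<Rightarrow> bool" where
  "has_genus S g \<longleftrightarrow> homology_group 1 (top_of_set S) \<cong> free_Abelian_group {..<2 * g}"

text \<open>A chart is stored as a function on the whole type which is \<^const>\<open>undefined\<close> outside the
  domain of the chart.\<close>

type_synonym 'a chart = "'a set \<times> ('a \<Rightarrow> rp2)"

definition regular_chart :: "'a::topological_space set \<Rightarrow> 'a set \<Rightarrow> 'a chart \<Rightarrow> bool" where
  "regular_chart S B = (\<lambda>(U, \<phi>). openin (top_of_set S) U \<and> U \<subseteq> S - B \<and> \<phi> \<in> extensional U \<and>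
     open (\<phi> ` U) \<and> (\<exists>\<psi>. homeomorphism U (\<phi> ` U) \<phi> \<psi>))"

text \<open>The local model is the power map of exponent \<open>m + 1\<close> on the unit disc of the complex plane,
  that is, \<open>(r, \<theta>) \<mapsto> (r^(m+1), (m+1)\<theta>)\<close>. The disc coordinates \<open>h\<close> and \<open>k\<close> are arbitrary
  homeomorphisms, so an isotopy of the model can be absorbed into them.\<close>

definition has_branch_order :: "'a::topological_space set \<Rightarrow> ('a \<Rightarrow> rp2) \<Rightarrow> 'a \<Rightarrow> nat \<Rightarrow> bool" where
  "has_branch_order U \<phi> p m \<longleftrightarrow>
     (\<exists>W h h' k k'. openin (top_of_set U) W \<and> p \<in> W \<and> open (\<phi> ` W) \<and>
        homeomorphism W (ball (0::complex) 1) h h' \<and> h p = 0 \<and>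
        homeomorphism (\<phi> ` W) (ball (0::complex) 1) k k' \<and> k (\<phi> p) = 0 \<and>
        (\<forall>x\<in>W. k (\<phi> x) = h x ^ (m + 1)))"

text \<open>The degree \<open>d\<close> is the number of points in a fibre, counted with multiplicity.\<close>

definition finite_branched_covering :: "'a::topological_space set \<Rightarrow> ('a \<Rightarrow> rp2) \<Rightarrow> bool" where
  "finite_branched_covering U \<phi> \<longleftrightarrow>
     (\<exists>ord d. (\<forall>p\<in>U. has_branch_order U \<phi> p (ord p)) \<and>
        (\<forall>y\<in>\<phi> ` U. finite {p\<in>U. \<phi> p = y} \<and> (\<Sum>p | p \<in> U \<and> \<phi> p = y. ord p + 1) = d))"

definition branched_chart :: "'a::topological_space set \<Rightarrow> 'a set \<Rightarrow> 'a chart \<Rightarrow> bool" where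
  "branched_chart S B = (\<lambda>(U, \<phi>). openin (top_of_set S) U \<and> \<phi> \<in> extensional U \<and>
     finite_branched_covering U \<phi> \<and>
     (\<exists>p m. U \<inter> B = {p} \<and> 0 < m \<and> has_branch_order U \<phi> p m))"

text \<open>As usual for a geometric structure, the transition element may depend on the connected
  component of the overlap.\<close>

definition compatible :: "'a::topological_space chart \<Rightarrow> 'a chart \<Rightarrow> bool" where
  "compatible = (\<lambda>(U, \<phi>) (V, \<psi>). \<forall>C \<in> components (U \<inter> V). \<exists>A\<in>PSL3. \<forall>x\<in>C. \<phi> x = proj_act A (\<psi> x))"

record 'a branched_structure =
  branch_points :: "'a set"
  regular_charts :: "'a chart set"
  branched_charts :: "'a chart set"

definition all_charts :: "'a branched_structure \<Rightarrow> 'a chart set" where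
  "all_charts \<sigma> = regular_charts \<sigma> \<union> branched_charts \<sigma>"

definition branched_projective_structure ::
    "'a::topological_space set \<Rightarrow> 'a branched_structure \<Rightarrow> bool" where
  "branched_projective_structure S \<sigma> \<longleftrightarrow>
     branch_points \<sigma> \<subseteq> S \<and> discrete (branch_points \<sigma>) \<and>
     (\<forall>c\<in>regular_charts \<sigma>. regular_chart S (branch_points \<sigma>) c) \<and>
     (\<forall>c\<in>branched_charts \<sigma>. branched_chart S (branch_points \<sigma>) c) \<and>
     (\<Union>c\<in>regular_charts \<sigma>. fst c) = S - branch_points \<sigma> \<and>
     branch_points \<sigma> \<subseteq> (\<Union>c\<in>branched_charts \<sigma>. fst c) \<and>
     (\<forall>c\<in>all_charts \<sigma>. \<forall>d\<in>all_charts \<sigma>. compatible c d) \<and>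
     (\<forall>c. regular_chart S (branch_points \<sigma>) c \<and> (\<forall>d\<in>regular_charts \<sigma>. compatible c d)
        \<longrightarrow> c \<in> regular_charts \<sigma>) \<and>
     (\<forall>c. branched_chart S (branch_points \<sigma>) c \<and> (\<forall>d\<in>all_charts \<sigma>. compatible c d)
        \<longrightarrow> c \<in> branched_charts \<sigma>)"

definition branch_point_of_order ::
    "'a::topological_space branched_structure \<Rightarrow> 'a \<Rightarrow> nat \<Rightarrow> bool" where
  "branch_point_of_order \<sigma> p m \<longleftrightarrow>
     p \<in> branch_points \<sigma> \<and> (\<exists>(U, \<phi>)\<in>branched_charts \<sigma>. p \<in> U \<and> has_branch_order U \<phi> p m)"

definition has_branch_data :: "'a::topological_space branched_structure \<Rightarrow> nat list \<Rightarrow> bool" where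
  "has_branch_data \<sigma> \<mu> \<longleftrightarrow>
     (\<exists>ps. distinct ps \<and> set ps = branch_points \<sigma> \<and> length ps = length \<mu> \<and>
        (\<forall>i<length \<mu>. branch_point_of_order \<sigma> (ps ! i) (\<mu> ! i)))"

definition isotopic_to_id :: "'a::topological_space set \<Rightarrow> ('a \<Rightarrow> 'a) \<Rightarrow> bool" where
  "isotopic_to_id S f \<longleftrightarrow>
     (\<exists>H :: real \<times> 'a \<Rightarrow> 'a. continuous_on ({0..1} \<times> S) H \<and>
        (\<forall>t\<in>{0..1}. \<exists>K. homeomorphism S S (\<lambda>x. H (t, x)) K) \<and>
        (\<forall>x\<in>S. H (0, x) = x \<and> H (1, x) = f x))"

text \<open>In \<open>push_chart f g\<close>, the map \<open>g\<close> is the inverse of \<open>f\<close>.\<close>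

definition push_chart :: "('a \<Rightarrow> 'a) \<Rightarrow> ('a \<Rightarrow> 'a) \<Rightarrow> 'a chart \<Rightarrow> 'a chart" where
  "push_chart f g = (\<lambda>(U, \<phi>). (f ` U, restrict (\<phi> \<circ> g) (f ` U)))"

text \<open>All structures live on the surface itself, which is thereby its own marking; two of them are
  identified if some projective isomorphism between them is isotopic to the identity.\<close>

definition structures_isotopic ::
    "'a::topological_space set \<Rightarrow> 'a branched_structure \<Rightarrow> 'a branched_structure \<Rightarrow> bool" where
  "structures_isotopic S \<sigma> \<tau> \<longleftrightarrow>
     (\<exists>f g. homeomorphism S S f g \<and> isotopic_to_id S f \<and>
        branch_points \<tau> = f ` branch_points \<sigma> \<and>
        regular_charts \<tau> = push_chart f g ` regular_charts \<sigma> \<and>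
        branched_charts \<tau> = push_chart f g ` branched_charts \<sigma>)"

definition structures_with_data ::
    "'a::topological_space set \<Rightarrow> nat list \<Rightarrow> 'a branched_structure set" where
  "structures_with_data S \<mu> = {\<sigma>. branched_projective_structure S \<sigma> \<and> has_branch_data \<sigma> \<mu>}"

definition RP2_moduli ::
    "'a::topological_space set \<Rightarrow> nat list \<Rightarrow> 'a branched_structure set set" where
  "RP2_moduli S \<mu> = structures_with_data S \<mu> //
     {(\<sigma>, \<tau>). \<sigma> \<in> structures_with_data S \<mu> \<and> \<tau> \<in> structures_with_data S \<mu> \<and>
        structures_isotopic S \<sigma> \<tau>}"

definition loops_at :: "'a::topological_space set \<Rightarrow> 'a \<Rightarrow> (real \<Rightarrow> 'a) set" where
  "loops_at S x = {p. path p \<and> path_image p \<subseteq> S \<and> pathstart p = x \<and> pathfinish p = x}"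

definition path_class :: "'a::topological_space set \<Rightarrow> (real \<Rightarrow> 'a) \<Rightarrow> (real \<Rightarrow> 'a) set" where
  "path_class S p = {q. homotopic_paths S p q}"

definition fundamental_group :: "'a::topological_space set \<Rightarrow> 'a \<Rightarrow> (real \<Rightarrow> 'a) set monoid" where
  "fundamental_group S x =
     \<lparr>carrier = path_class S ` loops_at S x,
      mult = (\<lambda>P Q. \<Union>p\<in>P. \<Union>q\<in>Q. path_class S (p +++ q)),
      one = path_class S (\<lambda>_. x)\<rparr>"

type_synonym 'a representation = "(real \<Rightarrow> 'a) set \<Rightarrow> real^3^3"

definition completely_reducible :: "'a::topological_space set \<Rightarrow> 'a \<Rightarrow> 'a representation \<Rightarrow> bool" where
  "completely_reducible S x \<rho> \<longleftrightarrow>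
     (let invariant = (\<lambda>V. subspace V \<and>
            (\<forall>\<gamma>\<in>carrier (fundamental_group S x). \<forall>v\<in>V. \<rho> \<gamma> *v v \<in> V))
      in \<forall>V. invariant V \<longrightarrow>
           (\<exists>W. invariant W \<and> V \<inter> W = {0} \<and> {v + w |v w. v \<in> V \<and> w \<in> W} = UNIV))"

definition Hom_plus :: "'a::topological_space set \<Rightarrow> 'a \<Rightarrow> 'a representation set" where
  "Hom_plus S x = {\<rho> \<in> hom (fundamental_group S x) PSL3_group.
     \<rho> \<in> extensional (carrier (fundamental_group S x)) \<and> completely_reducible S x \<rho>}"

text \<open>Representations carry the topology of pointwise convergence; for a finitely generated group
  this is the subspace topology given by the values on a finite generating set.\<close>

definition Hom_plus_topology :: "'a::topological_space set \<Rightarrow> 'a \<Rightarrow> 'a representation topology" where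
  "Hom_plus_topology S x =
     subtopology (product_topology (\<lambda>_. top_of_set PSL3) (carrier (fundamental_group S x)))
       (Hom_plus S x)"

definition conjugacy_class ::
    "'a::topological_space set \<Rightarrow> 'a \<Rightarrow> 'a representation \<Rightarrow> 'a representation set" where
  "conjugacy_class S x \<rho> =
     {\<lambda>\<gamma>\<in>carrier (fundamental_group S x). A ** \<rho> \<gamma> ** matrix_inv A |A. A \<in> PSL3}"

definition quotient_topology :: "'a topology \<Rightarrow> ('a \<Rightarrow> 'b) \<Rightarrow> 'b topology" where
  "quotient_topology X f =
     topology (\<lambda>U. U \<subseteq> f ` topspace X \<and> openin X {x \<in> topspace X. f x \<in> U})"

lemma openin_quotient_topology:
  "openin (quotient_topology X f) U \<longleftrightarrow>
     U \<subseteq> f ` topspace X \<and> openin X {x \<in> topspace X. f x \<in> U}"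
proof -
  have "istopology (\<lambda>U. U \<subseteq> f ` topspace X \<and> openin X {x \<in> topspace X. f x \<in> U})"
    unfolding istopology_def
  proof (intro conjI allI impI)
    fix U V
    assume "U \<subseteq> f ` topspace X \<and> openin X {x \<in> topspace X. f x \<in> U}"
      and "V \<subseteq> f ` topspace X \<and> openin X {x \<in> topspace X. f x \<in> V}"
    moreover have "{x \<in> topspace X. f x \<in> U \<inter> V} =
        {x \<in> topspace X. f x \<in> U} \<inter> {x \<in> topspace X. f x \<in> V}" by auto
    ultimately show "U \<inter> V \<subseteq> f ` topspace X" "openin X {x \<in> topspace X. f x \<in> U \<inter> V}"
      by auto
  next
    fix K
    assume K: "\<forall>U\<in>K. U \<subseteq> f ` topspace X \<and> openin X {x \<in> topspace X. f x \<in> U}"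
    then show "\<Union>K \<subseteq> f ` topspace X" by blast
    have "{x \<in> topspace X. f x \<in> \<Union>K} = (\<Union>U\<in>K. {x \<in> topspace X. f x \<in> U})" by auto
    with K show "openin X {x \<in> topspace X. f x \<in> \<Union>K}" by auto
  qed
  then show ?thesis by (simp add: quotient_topology_def topology_inverse')
qed

definition character_variety ::
    "'a::topological_space set \<Rightarrow> 'a \<Rightarrow> 'a representation set topology" where
  "character_variety S x = quotient_topology (Hom_plus_topology S x) (conjugacy_class S x)"

text \<open>Throughout, \<open>\<pi> : E \<rightarrow> S\<close> is the universal covering and \<open>e\<close> is a base point of \<open>E\<close>.\<close>

definition developing_map ::
    "'b::topological_space set \<Rightarrow> ('b \<Rightarrow> 'a::topological_space) \<Rightarrow> 'a branched_structure \<Rightarrow>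
     ('b \<Rightarrow> rp2) \<Rightarrow> bool" where
  "developing_map E \<pi> \<sigma> dev \<longleftrightarrow>
     (\<forall>y\<in>E. \<forall>(U, \<phi>)\<in>all_charts \<sigma>. \<pi> y \<in> U \<longrightarrow>
        (\<exists>W. openin (top_of_set E) W \<and> y \<in> W \<and> \<pi> ` W \<subseteq> U \<and>
           (\<exists>A\<in>PSL3. \<forall>z\<in>W. dev z = proj_act A (\<phi> (\<pi> z)))))"

text \<open>\<open>T\<close> is the deck transformation by which the class \<open>\<gamma>\<close> of a loop at \<open>\<pi> e\<close> acts on \<open>E\<close>: it sends
  \<open>e\<close> to the endpoint of the lift of the loop starting at \<open>e\<close>.\<close>

definition deck_transformation_of ::
    "'b::topological_space set \<Rightarrow> ('b \<Rightarrow> 'a::topological_space) \<Rightarrow> 'b \<Rightarrow> (real \<Rightarrow> 'a) set \<Rightarrow>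
     ('b \<Rightarrow> 'b) \<Rightarrow> bool" where
  "deck_transformation_of E \<pi> e \<gamma> T \<longleftrightarrow>
     (\<exists>T'. homeomorphism E E T T') \<and> (\<forall>y\<in>E. \<pi> (T y) = \<pi> y) \<and>
     (\<exists>q. path q \<and> path_image q \<subseteq> E \<and> pathstart q = e \<and> pathfinish q = T e \<and> \<pi> \<circ> q \<in> \<gamma>)"

definition is_holonomy ::
    "'a::topological_space set \<Rightarrow> 'b::topological_space set \<Rightarrow> ('b \<Rightarrow> 'a) \<Rightarrow> 'b \<Rightarrow>
     'a branched_structure \<Rightarrow> 'a representation \<Rightarrow> bool" where
  "is_holonomy S E \<pi> e \<sigma> \<rho> \<longleftrightarrow>
     \<rho> \<in> hom (fundamental_group S (\<pi> e)) PSL3_group \<and>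
     (\<exists>dev. developing_map E \<pi> \<sigma> dev \<and>
        (\<forall>\<gamma>\<in>carrier (fundamental_group S (\<pi> e)). \<exists>T. deck_transformation_of E \<pi> e \<gamma> T \<and>
           (\<forall>y\<in>E. dev (T y) = proj_act (\<rho> \<gamma>) (dev y))))"

definition hol_image ::
    "'a::topological_space set \<Rightarrow> 'b::topological_space set \<Rightarrow> ('b \<Rightarrow> 'a) \<Rightarrow> 'b \<Rightarrow> nat list \<Rightarrow>
     'a representation set set" where
  "hol_image S E \<pi> e \<mu> =
     {conjugacy_class S (\<pi> e) \<rho> |\<rho>. \<rho> \<in> Hom_plus S (\<pi> e) \<and>
        (\<exists>c\<in>RP2_moduli S \<mu>. \<exists>\<sigma>\<in>c. is_holonomy S E \<pi> e \<sigma> \<rho>)}"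

end

theory Submission
  imports Defs
begin

text \<open>If \<open>dev\<close> is a developing map with holonomy \<open>\<rho>\<^sub>0\<close> and \<open>\<rho>\<close> is close to \<open>\<rho>\<^sub>0\<close>, a developing
  map for \<open>\<rho>\<close> is \<open>y \<mapsto> M(y) dev(y)\<close>, where \<open>M(y)\<close> is the average, with respect to a partition of unity
  on \<open>S\<close> pulled back to the universal covering, of the matrices \<open>\<rho>(\<gamma>) \<rho>\<^sub>0(\<gamma>)\<^sup>-\<^sup>1\<close>; here \<open>\<gamma>\<close> is the deck
  transformation that takes the chosen lift of a patch to the lift containing \<open>y\<close>. The bump functions
  are composed of charts and locally Lipschitz functions on the projective plane, so that near each
  point the new map is \<open>\<Phi> \<circ> dev\<close>, even at branch points, where \<open>\<Phi>\<close> is a Lipschitz perturbation of the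
  identity and hence a local homeomorphism. So the branch orders do not change, and the structure is
  recovered from its equivariant branched developing map.\<close>

section \<open>The real projective plane\<close>

text \<open>The obstacle is that \<open>dev\<close> is not injective near a branch point: a small
  perturbation of \<open>z ^ (m + 1)\<close> can split the branch point into several of lower order.
  Changing \<open>dev\<close> only by homeomorphisms of the target excludes this, since they can be
  absorbed into the target coordinate of the local model. Charts of the surface are merely
  topological, so the regularity that makes \<open>\<Phi>\<close> injective has to come from the
  projective plane. Continuity of the weights would not suffice there: closeness of the matrices to
  the identity has to be played off against the variation of the weights between nearby lines. The
  matrix \<open>M(y)\<close> is a linear average and need not have determinant 1; invertibility is
  enough, because it acts only through \<open>proj_act\<close>. Compactness of the surface enters
  twice: it gives finitely many patches, and it leaves finitely many group elements at which the two
  representations have to be close, which is an open condition for pointwise convergence.\<close>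

lemma matrix_inv_right: "invertible A \<Longrightarrow> A ** matrix_inv A = mat 1"
  and matrix_inv_left: "invertible A \<Longrightarrow> matrix_inv A ** A = mat 1"
  unfolding invertible_def matrix_inv_def by (metis (mono_tags, lifting) someI_ex)+

lemma det_matrix_inv_nonzero:
  fixes A :: "real^'n^'n"
  assumes "det A \<noteq> 0"
  shows "det (matrix_inv A) \<noteq> 0"
proof -
  have "det A * det (matrix_inv A) = 1"
    using matrix_inv_right[of A] assms by (simp add: invertible_det_nz flip: det_mul)
  then show ?thesis by auto
qed

lemma Rep_line_through: "v \<noteq> 0 \<Longrightarrow> Rep_rp2 (line_through v) = span {v}"
  unfolding line_through_def by (rule Abs_rp2_inverse) blast

lemma line_through_surj:
  obtains v where "v \<noteq> 0" "(L::rp2) = line_through v"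
  using Rep_rp2[of L] unfolding line_through_def
  by (smt (verit, best) Rep_rp2_inverse mem_Collect_eq)

lemma line_through_eq_iff:
  assumes "v \<noteq> 0" "w \<noteq> 0"
  shows "line_through v = line_through w \<longleftrightarrow> (\<exists>c. c \<noteq> 0 \<and> w = c *\<^sub>R v)"
proof
  assume "line_through v = line_through w"
  then have "span {v} = span {w}" using assms Rep_line_through by metis
  then have "w \<in> span {v}" by (simp add: span_base)
  then obtain c where "w = c *\<^sub>R v" by (auto simp: span_singleton)
  with assms show "\<exists>c. c \<noteq> 0 \<and> w = c *\<^sub>R v" by auto
next
  assume "\<exists>c. c \<noteq> 0 \<and> w = c *\<^sub>R v"
  then obtain c where c: "c \<noteq> 0" "w = c *\<^sub>R v" by blast
  have "span {w} = span {v}"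
  proof
    show "span {w} \<subseteq> span {v}" using c by (auto simp: span_singleton)
    have "v = (1 / c) *\<^sub>R w" using c by simp
    then show "span {v} \<subseteq> span {w}" by (auto simp: span_singleton)
  qed
  then show "line_through v = line_through w" by (simp add: line_through_def)
qed

lemma line_through_scaleR [simp]:
  assumes "c \<noteq> 0"
  shows "line_through (c *\<^sub>R v) = line_through v"
  using assms line_through_eq_iff[of v "c *\<^sub>R v"] by (cases "v = 0") auto

lemma proj_act_line_through:
  assumes "v \<noteq> 0"
  shows "proj_act A (line_through v) = line_through (A *v v)"
proof -
  have "(\<lambda>x. A *v x) ` span {v} = span {A *v v}"
    using linear_span_image[OF matrix_vector_mul_linear[of A], of "{v}"] by simp
  then show ?thesis using assms by (simp add: proj_act_def Rep_line_through) (simp add: line_through_def)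
qed

lemma matrix_vector_mult_nonzero:
  fixes A :: "real^'n^'n"
  assumes "det A \<noteq> 0" "v \<noteq> 0"
  shows "A *v v \<noteq> 0"
proof
  assume "A *v v = 0"
  then have "(matrix_inv A ** A) *v v = 0" by (simp flip: matrix_vector_mul_assoc)
  then show False using assms by (simp add: matrix_inv_left invertible_det_nz)
qed

lemma proj_act_mult:
  assumes "det B \<noteq> 0"
  shows "proj_act (A ** B) L = proj_act A (proj_act B L)"
  using assms
  by (cases L rule: line_through_surj)
    (simp add: proj_act_line_through matrix_vector_mult_nonzero matrix_vector_mul_assoc)

lemma proj_act_mat_1 [simp]: "proj_act (mat 1) L = L"
  by (cases L rule: line_through_surj) (simp add: proj_act_line_through)

lemma proj_act_matrix_inv [simp]:
  assumes "det A \<noteq> 0"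
  shows "proj_act (matrix_inv A) (proj_act A L) = L" "proj_act A (proj_act (matrix_inv A) L) = L"
proof -
  have i: "invertible A" using assms by (simp add: invertible_det_nz)
  have "det (matrix_inv A) \<noteq> 0" using assms by (rule det_matrix_inv_nonzero)
  then show "proj_act (matrix_inv A) (proj_act A L) = L" "proj_act A (proj_act (matrix_inv A) L) = L"
    using i assms by (simp_all add: matrix_inv_left matrix_inv_right flip: proj_act_mult)
qed

lemma PSL3_det: "A \<in> PSL3 \<Longrightarrow> det A \<noteq> 0" "A \<in> PSL3 \<Longrightarrow> invertible A"
  by (simp_all add: PSL3_def invertible_det_nz)

lemma PSL3_mult: "A \<in> PSL3 \<Longrightarrow> B \<in> PSL3 \<Longrightarrow> A ** B \<in> PSL3"
  by (simp add: PSL3_def det_mul)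

lemma PSL3_mat_1: "mat 1 \<in> PSL3"
  by (simp add: PSL3_def det_I)

lemma PSL3_matrix_inv:
  assumes "A \<in> PSL3" shows "matrix_inv A \<in> PSL3"
proof -
  have "det A * det (matrix_inv A) = 1"
    using PSL3_det(2)[OF assms] by (metis det_I det_mul matrix_inv_right)
  then show ?thesis using assms by (simp add: PSL3_def)
qed

section \<open>Topology of the projective plane\<close>

text \<open>The set of all nonzero vectors over the image is the union of the nonzero multiples of
  \<open>V\<close>, so \<open>line_through\<close> is an open map.\<close>

lemma open_line_through_image:
  assumes "open V" "0 \<notin> V"
  shows "open (line_through ` V)"
proof -
  have "{v. v \<noteq> 0 \<and> line_through v \<in> line_through ` V} = (\<Union>c\<in>-{0}. (\<lambda>x. c *\<^sub>R x) ` V)"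
  proof (intro equalityI subsetI)
    fix v assume "v \<in> {v. v \<noteq> 0 \<and> line_through v \<in> line_through ` V}"
    then obtain w where "v \<noteq> 0" "w \<in> V" "line_through w = line_through v" by auto
    moreover have "w \<noteq> 0" using \<open>w \<in> V\<close> assms by auto
    ultimately obtain c where "c \<noteq> 0" "v = c *\<^sub>R w" using line_through_eq_iff[of w v] by auto
    with \<open>w \<in> V\<close> show "v \<in> (\<Union>c\<in>-{0}. (\<lambda>x. c *\<^sub>R x) ` V)" by auto
  qed (use assms in auto)
  moreover have "open (\<Union>c\<in>-{0}. (\<lambda>x. c *\<^sub>R x) ` V)"
    using assms by (intro open_UN ballI open_scaling) auto
  ultimately show ?thesis by (simp add: open_rp2_def)
qed

lemma open_vimage_line_through:
  "open U \<Longrightarrow> open {v. v \<noteq> 0 \<and> line_through v \<in> U}"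
  by (simp add: open_rp2_def)

lemma continuous_on_line_through: "continuous_on (- {0}) line_through"
  unfolding continuous_on_open_vimage[OF open_Compl[OF closed_singleton]]
proof (intro allI impI)
  fix B :: "rp2 set" assume "open B"
  have "line_through -` B \<inter> - {0} = {v. v \<noteq> 0 \<and> line_through v \<in> B}" by auto
  then show "open (line_through -` B \<inter> - {0})" using \<open>open B\<close> by (simp add: open_vimage_line_through)
qed

text \<open>Since \<open>line_through\<close> is open, continuity of a map on lines can be tested on
  the representing vectors.\<close>

lemma continuous_on_rp2I:
  fixes f :: "rp2 \<Rightarrow> 'b::topological_space"
  assumes V: "open V" "0 \<notin> V" and f: "continuous_on V (\<lambda>v. f (line_through v))"
  shows "continuous_on (line_through ` V) f"
  unfolding continuous_on_open_vimage[OF open_line_through_image[OF V]]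
proof (intro allI impI)
  fix B :: "'b set" assume "open B"
  then have "open ((\<lambda>v. f (line_through v)) -` B \<inter> V)"
    using f V continuous_on_open_vimage by blast
  then have "open (line_through ` ((\<lambda>v. f (line_through v)) -` B \<inter> V))"
    using V by (intro open_line_through_image) auto
  moreover have "line_through ` ((\<lambda>v. f (line_through v)) -` B \<inter> V) = f -` B \<inter> line_through ` V"
    by auto
  ultimately show "open (f -` B \<inter> line_through ` V)" by simp
qed

lemma line_through_image_UNIV: "line_through ` (- {0}) = UNIV"
  by (metis ComplI UNIV_eq_I image_eqI line_through_surj singletonD)

lemma homeomorphism_proj_act:
  assumes "det A \<noteq> 0"
  shows "homeomorphism UNIV UNIV (proj_act A) (proj_act (matrix_inv A))"
proof -
  have cont: "continuous_on UNIV (proj_act B)" if "det B \<noteq> 0" for B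
  proof -
    have "continuous_on (- {0}) (\<lambda>v. line_through (B *v v))"
    proof (rule continuous_on_compose2[OF continuous_on_line_through])
      show "continuous_on (- {0}) ((*v) B)" by (simp add: linear_continuous_on linear_linear)
      show "(*v) B ` (- {0}) \<subseteq> - {0}" 
      proof
        fix y assume "y \<in> (*v) B ` (- {0})"
        then obtain v where "y = B *v v" "v \<noteq> 0" by blast
        then show "y \<in> - {0}" using matrix_vector_mult_nonzero[OF that, of v] by simp
      qed
    qed
    then have "continuous_on (- {0}) (\<lambda>v. proj_act B (line_through v))"
      by (rule continuous_on_eq) (simp add: proj_act_line_through)
    from continuous_on_rp2I[OF _ _ this] show ?thesis
      by (simp add: line_through_image_UNIV open_Compl)
  qed
  have "det (matrix_inv A) \<noteq> 0"
    using assms by (rule det_matrix_inv_nonzero)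
  then show ?thesis using assms
    by (intro homeomorphismI cont) simp_all
qed

section \<open>Faithfulness of the projective action on open sets\<close>

text \<open>For \<open>w\<close> independent of \<open>v\<close>, eigenvectors at three points of
  the line through \<open>v\<close> in direction \<open>w\<close> force a common eigenvalue, so
  \<open>w\<close> has the eigenvalue of \<open>v\<close>.\<close>

lemma scalar_matrix_if_open_eigenvectors:
  fixes C :: "real^3^3"
  assumes "open V" "0 \<notin> V" "V \<noteq> {}" and V: "\<And>v. v \<in> V \<Longrightarrow> \<exists>c. C *v v = c *\<^sub>R v"
  shows "\<exists>c. C = c *\<^sub>R mat 1"
proof -
  obtain v where v: "v \<in> V" using assms by auto
  obtain l where l: "C *v v = l *\<^sub>R v" using V v by blast
  obtain e where e: "e > 0" "ball v e \<subseteq> V" using assms v openE by blast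
  have "\<exists>t0>0. \<forall>t. \<bar>t\<bar> < t0 \<longrightarrow> v + t *\<^sub>R w \<in> V" for w
  proof (intro exI conjI allI impI)
    show "e / (norm w + 1) > 0" using e by (simp add: add_nonneg_pos)
    fix t assume "\<bar>t\<bar> < e / (norm w + 1)"
    then have "\<bar>t\<bar> * (norm w + 1) < e" using pos_less_divide_eq[of "norm w + 1"] by (simp add: add_nonneg_pos)
    moreover have "\<bar>t\<bar> * norm w \<le> \<bar>t\<bar> * (norm w + 1)" by (simp add: mult_left_mono)
    ultimately have "v + t *\<^sub>R w \<in> ball v e" by (simp add: dist_norm)
    then show "v + t *\<^sub>R w \<in> V" using e by blast
  qed
  then have *: "\<exists>t0>0. \<forall>t. \<bar>t\<bar> < t0 \<longrightarrow> (\<exists>m. C *v (v + t *\<^sub>R w) = m *\<^sub>R (v + t *\<^sub>R w))" for w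
    using V by meson
  have "C *v w = l *\<^sub>R w" for w
  proof (cases "\<exists>a. w = a *\<^sub>R v")
    case True
    then show ?thesis using l by (auto simp: matrix_vector_mult_scaleR)
  next
    case False
    obtain t0 where t0: "t0 > 0"
      "\<And>t. \<bar>t\<bar> < t0 \<Longrightarrow> \<exists>m. C *v (v + t *\<^sub>R w) = m *\<^sub>R (v + t *\<^sub>R w)"
      using *[of w] by auto
    \<comment> \<open>Any two distinct nonzero parameters below \<open>t0\<close> would do:
      eliminating \<open>C *v w\<close> between them leaves a relation between the independent
      vectors \<open>v\<close> and \<open>w\<close>.\<close>
    define s where "s = t0 / 2"
    define t where "t = t0 / 3"
    have st: "s \<noteq> 0" "t \<noteq> 0" "s \<noteq> t" "\<bar>s\<bar> < t0" "\<bar>t\<bar> < t0"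
      using t0(1) by (auto simp: s_def t_def)
    obtain m where "C *v (v + s *\<^sub>R w) = m *\<^sub>R (v + s *\<^sub>R w)" using t0(2) st by blast
    then have m: "s *\<^sub>R (C *v w) = (m * s) *\<^sub>R w + (m - l) *\<^sub>R v"
      by (simp add: matrix_vector_right_distrib matrix_vector_mult_scaleR l algebra_simps)
    obtain n where "C *v (v + t *\<^sub>R w) = n *\<^sub>R (v + t *\<^sub>R w)" using t0(2) st by blast
    then have n: "t *\<^sub>R (C *v w) = (n * t) *\<^sub>R w + (n - l) *\<^sub>R v"
      by (simp add: matrix_vector_right_distrib matrix_vector_mult_scaleR l algebra_simps)
    have "t *\<^sub>R (s *\<^sub>R (C *v w)) = s *\<^sub>R (t *\<^sub>R (C *v w))" by (simp add: mult.commute)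
    then have "(t * s * (m - n)) *\<^sub>R w = (s * (n - l) - t * (m - l)) *\<^sub>R v"
      unfolding m n by (simp add: algebra_simps)
    moreover have "t * s * (m - n) = 0"
    proof (rule ccontr)
      assume "t * s * (m - n) \<noteq> 0"
      then have "w = (inverse (t * s * (m - n)) * (s * (n - l) - t * (m - l))) *\<^sub>R v"
        using calculation by (metis (no_types) scaleR_scaleR left_inverse scaleR_one)
      with False show False by blast
    qed
    ultimately have "m = n" "(s * (n - l) - t * (m - l)) *\<^sub>R v = 0" using st by auto
    moreover have "v \<noteq> 0" using v assms(2) by blast
    ultimately have "(s - t) * (m - l) = 0" by (simp only: scaleR_eq_0_iff) (simp add: algebra_simps)
    then have "m = l" using st by simp
    then have "s *\<^sub>R (C *v w) = s *\<^sub>R (l *\<^sub>R w)" using m by simp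
    then show ?thesis using st scaleR_left_imp_eq by blast
  qed
  then have "C = l *\<^sub>R mat 1" by (simp add: matrix_eq scaleR_matrix_vector_assoc[symmetric])
  then show ?thesis by blast
qed

text \<open>The quotient \<open>C\<close> of the two matrices fixes an open set of lines, hence is a
  scalar \<open>c\<close>, and \<open>c ^ 3 = 1\<close> has the only real solution 1. Transition
  elements between charts are therefore unique.\<close>

lemma PSL3_eqI:
  assumes A: "A \<in> PSL3" and B: "B \<in> PSL3" and U: "open U" "U \<noteq> {}"
    and eq: "\<And>L. L \<in> U \<Longrightarrow> proj_act A L = proj_act B L"
  shows "A = B"
proof -
  define C where "C = matrix_inv B ** A"
  have "det C = 1" using A B PSL3_mult PSL3_matrix_inv by (auto simp: C_def PSL3_def)
  define V where "V = {v. v \<noteq> 0 \<and> line_through v \<in> U}"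
  have "V \<noteq> {}" using U line_through_surj by (metis (mono_tags, lifting) V_def empty_iff equals0I mem_Collect_eq)
  moreover have "\<exists>c. C *v v = c *\<^sub>R v" if "v \<in> V" for v
  proof -
    have v: "v \<noteq> 0" "line_through v \<in> U" using that by (auto simp: V_def)
    have "proj_act C (line_through v) = line_through v"
      using eq[OF v(2)] A B by (simp add: C_def proj_act_mult PSL3_det)
    then have "line_through v = line_through (C *v v)" by (simp add: proj_act_line_through v)
    moreover have "C *v v \<noteq> 0" using \<open>det C = 1\<close> v by (intro matrix_vector_mult_nonzero) auto
    ultimately show ?thesis using line_through_eq_iff v by blast
  qed
  ultimately obtain c where c: "C = c *\<^sub>R mat 1"
    using scalar_matrix_if_open_eigenvectors[of V C] open_vimage_line_through[OF U(1)] by (auto simp: V_def)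
  then have "c ^ 3 = 1" using \<open>det C = 1\<close> by (simp add: det_3 mat_def power3_eq_cube)
  then have "c = 1" using odd_real_root_power_cancel[of 3 c] by simp
  then have "B ** C = B" using c by simp
  then show ?thesis
    using PSL3_det(2)[OF B] by (simp add: C_def matrix_mul_assoc matrix_inv_right)
qed

text \<open>The affine chart centred at a given line is the gnomonic projection, after a rotation moving that line to
  the third axis.\<close>

lemma rp2_disc_neighbourhood:
  fixes L :: rp2
  assumes "open O'" "L \<in> O'"
  obtains D k k' where "open D" "L \<in> D" "D \<subseteq> O'"
    "homeomorphism D (ball (0::complex) 1) k k'" "k L = 0"
proof -
  obtain u0 where u0: "u0 \<noteq> 0" "L = line_through u0" using line_through_surj[of L] by blast
  define u where "u = (1 / norm u0) *\<^sub>R u0"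
  have u: "norm u = 1" "L = line_through u" using u0 by (simp_all add: u_def)
  have "norm u = norm (axis 3 1 :: real^3)" using u by simp
  then obtain f where f: "orthogonal_transformation f" "f u = (axis 3 1 :: real^3)"
    using orthogonal_transformation_exists by blast
  have lf: "linear f" using f(1) by (rule orthogonal_transformation_linear)
  obtain h where h: "linear h" "\<And>x. h (f x) = x" "\<And>x. f (h x) = x"
    using linear_injective_isomorphism[OF lf orthogonal_transformation_inj[OF f(1)]] by blast
  have cf: "continuous_on X f" "continuous_on X h" for X
    using lf h(1) by (simp_all add: linear_continuous_on linear_linear)
  define p where "p = (\<lambda>z::complex. h (Re z *\<^sub>R axis 1 1 + Im z *\<^sub>R axis 2 1 + axis 3 1))"
  have fp: "f (p z) = Re z *\<^sub>R axis 1 1 + Im z *\<^sub>R axis 2 1 + axis 3 1" for z by (simp add: p_def h)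
  have p0: "p z \<noteq> 0" for z
  proof
    assume "p z = 0"
    then have "f (p z) $ 3 = 0" using linear_0[OF lf] by simp
    then show False by (simp add: fp axis_def)
  qed
  have "h (axis 3 1) = u" using h(2)[of u] f by simp
  then have pu: "p 0 = u" by (simp add: p_def)
  have cp: "continuous_on UNIV p"
    unfolding p_def by (intro continuous_on_compose2[OF cf(2)[of UNIV]] continuous_intros) auto
  have "continuous_on UNIV (\<lambda>z. line_through (p z))"
    by (rule continuous_on_compose2[OF continuous_on_line_through cp]) (use p0 in auto)
  then have "open ((\<lambda>z. line_through (p z)) -` O')"
    using assms(1) by (simp add: continuous_on_open_vimage)
  moreover have "0 \<in> (\<lambda>z. line_through (p z)) -` O'" using assms(2) u pu by simp
  ultimately obtain e where e: "e > 0" "ball 0 e \<subseteq> (\<lambda>z. line_through (p z)) -` O'"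
    by (meson openE)
  define q where "q = (\<lambda>z. p (e *\<^sub>R z))"
  \<comment> \<open>Gnomonic coordinates, divided by \<open>e\<close> so that the disc of radius
    \<open>e\<close>, whose image lies in \<open>O'\<close>, becomes the unit disc.\<close>
  define \<kappa> where "\<kappa> = (\<lambda>v. Complex (f v $ 1 / f v $ 3) (f v $ 2 / f v $ 3) /\<^sub>R e)"
  define V where "V = {v. f v $ 3 \<noteq> 0 \<and> norm (\<kappa> v) < 1}"
  have V0: "0 \<notin> V" using linear_0[OF lf] by (simp add: V_def)
  have \<kappa>q: "\<kappa> (q z) = z" for z
    using e(1) by (simp add: \<kappa>_def q_def fp complex_eq_iff axis_def)
  have q\<kappa>: "q (\<kappa> v) = (1 / f v $ 3) *\<^sub>R v" if "f v $ 3 \<noteq> 0" for v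
  proof -
    have "f (q (\<kappa> v)) = f ((1 / f v $ 3) *\<^sub>R v)"
      using e(1) that by (simp add: q_def fp \<kappa>_def linear_scale[OF lf] vec_eq_iff forall_3 axis_def)
    then show ?thesis by (metis h(2))
  qed
  have \<kappa>_scale: "\<kappa> (c *\<^sub>R v) = \<kappa> v" if "c \<noteq> 0" for c v
    using that by (simp add: \<kappa>_def linear_scale[OF lf])
  \<comment> \<open>The chosen representative does not matter because \<open>\<kappa>\<close> is
    invariant under scaling.\<close>
  define k where "k = (\<lambda>L. \<kappa> (SOME v. v \<noteq> 0 \<and> L = line_through v))"
  have k: "k (line_through v) = \<kappa> v" if "v \<noteq> 0" for v
  proof -
    have "\<exists>w. w \<noteq> 0 \<and> line_through v = line_through w" using that by blast
    from someI_ex[OF this] obtain w where "w \<noteq> 0" "line_through v = line_through w" "k (line_through v) = \<kappa> w"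
      unfolding k_def by blast
    then show ?thesis using that line_through_eq_iff \<kappa>_scale by metis
  qed
  have c\<kappa>: "continuous_on {v. f v $ 3 \<noteq> 0} \<kappa>"
    unfolding \<kappa>_def Complex_eq by (intro continuous_intros cf) auto
  have o: "open {v. f v $ 3 \<noteq> 0}"
    by (intro open_Collect_neq continuous_intros cf)
  have "open (\<kappa> -` ball 0 1 \<inter> {v. f v $ 3 \<noteq> 0})"
    using c\<kappa> o continuous_on_open_vimage by blast
  moreover have "\<kappa> -` ball 0 1 \<inter> {v. f v $ 3 \<noteq> 0} = V" by (auto simp: V_def)
  ultimately have oV: "open V" by simp
  have Vn0: "v \<noteq> 0" if "v \<in> V" for v using that V0 by blast
  have kV: "k ` line_through ` V \<subseteq> ball 0 1" using Vn0 k by (auto simp: V_def)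
  have qV: "q z \<in> V" if "z \<in> ball 0 1" for z
    using that by (simp add: V_def \<kappa>q) (simp add: q_def fp axis_def)
  show ?thesis
  proof (rule that[of "line_through ` V" k "\<lambda>z. line_through (q z)"])
    show "open (line_through ` V)" using oV V0 by (rule open_line_through_image)
    have "q 0 \<in> V" by (simp add: qV)
    then show "L \<in> line_through ` V" using u pu by (auto simp: q_def)
    show "line_through ` V \<subseteq> O'"
    proof clarify
      fix v assume v: "v \<in> V"
      then have "norm (e *\<^sub>R \<kappa> v) < e" using e(1) by (simp add: V_def)
      then have "e *\<^sub>R \<kappa> v \<in> ball 0 e" by (simp only: mem_ball_0)
      then have "line_through (q (\<kappa> v)) \<in> O'" using e(2) by (auto simp only: q_def)
      then show "line_through v \<in> O'" using v by (simp add: q\<kappa> V_def)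
    qed
    show "homeomorphism (line_through ` V) (ball 0 1) k (\<lambda>z. line_through (q z))"
    proof (rule homeomorphismI)
      show "continuous_on (line_through ` V) k"
      proof (rule continuous_on_rp2I[OF oV V0])
        have "continuous_on V \<kappa>" using c\<kappa> by (rule continuous_on_subset) (auto simp: V_def)
        then show "continuous_on V (\<lambda>v. k (line_through v))"
          by (rule continuous_on_eq) (simp add: k Vn0)
      qed
      show "continuous_on (ball 0 1) (\<lambda>z. line_through (q z))"
      proof (rule continuous_on_compose2[OF continuous_on_line_through])
        show "continuous_on (ball 0 1) q"
          unfolding q_def by (intro continuous_on_compose2[OF cp] continuous_intros) auto
      qed (use p0 in \<open>auto simp: q_def\<close>)
      show "line_through (q (k L)) = L" if "L \<in> line_through ` V" for L
        using that Vn0 k q\<kappa> by (auto simp: V_def)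
      show "k (line_through (q z)) = z" for z
        using k[of "q z"] \<kappa>q[of z] p0 by (simp add: q_def)
    qed (use kV qV in auto)
    have "q 0 = u" using pu by (simp add: q_def)
    then have "\<kappa> u = 0" using \<kappa>q[of 0] by simp
    moreover have "u \<noteq> 0" using u(1) by auto
    ultimately show "k L = 0" using k[of u] u(2) by simp
  qed
qed

section \<open>Lipschitz perturbations of the identity\<close>

text \<open>Radius and constant may depend on the point, since products and reciprocals of Lipschitz
  functions are in general only locally Lipschitz.\<close>

definition locally_lipschitz_at :: "('a::metric_space \<Rightarrow> 'b::metric_space) \<Rightarrow> 'a \<Rightarrow> bool" where
  "locally_lipschitz_at f a \<longleftrightarrow> (\<exists>r>0. \<exists>K. K-lipschitz_on (ball a r) f)"

lemma locally_lipschitz_at_cong: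
  assumes "locally_lipschitz_at f a" "open U" "a \<in> U" "\<And>x. x \<in> U \<Longrightarrow> f x = g x"
  shows "locally_lipschitz_at g a"
proof -
  obtain r K where r: "r > 0" "K-lipschitz_on (ball a r) f"
    using assms(1) unfolding locally_lipschitz_at_def by blast
  obtain e where e: "e > 0" "ball a e \<subseteq> U" using assms(2,3) openE by blast
  have "K-lipschitz_on (ball a (min r e)) g"
  proof (rule lipschitz_onI)
    fix x y assume xy: "x \<in> ball a (min r e)" "y \<in> ball a (min r e)"
    then have "f x = g x" "f y = g y" using e(2) assms(4) by (simp_all add: subset_iff)
    moreover have "dist (f x) (f y) \<le> K * dist x y"
      using xy by (intro lipschitz_onD[OF r(2)]) simp_all
    ultimately show "dist (g x) (g y) \<le> K * dist x y" by simp
  qed (use lipschitz_on_nonneg[OF r(2)] in simp)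
  then show ?thesis unfolding locally_lipschitz_at_def using r(1) e(1) by (metis min_less_iff_conj)
qed

lemma locally_lipschitz_at_const [simp]: "locally_lipschitz_at (\<lambda>x. c) a"
  unfolding locally_lipschitz_at_def by (intro exI[of _ 1] conjI exI[of _ 0] lipschitz_onI) auto

lemma locally_lipschitz_at_compose:
  assumes f: "locally_lipschitz_at f a" and g: "locally_lipschitz_at g (f a)"
  shows "locally_lipschitz_at (\<lambda>x. g (f x)) a"
proof -
  obtain r K where r: "r > 0" "K-lipschitz_on (ball a r) f"
    using f unfolding locally_lipschitz_at_def by blast
  obtain s M where s: "s > 0" "M-lipschitz_on (ball (f a) s) g"
    using g unfolding locally_lipschitz_at_def by blast
  have K: "K \<ge> 0" and M: "M \<ge> 0" using r s lipschitz_on_nonneg by blast+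
  \<comment> \<open>Within radius \<open>s / (K + 1)\<close> the values of \<open>f\<close> stay in
    the ball on which \<open>g\<close> is Lipschitz; the \<open>+ 1\<close> covers
    \<open>K = 0\<close>.\<close>
  define t where "t = min r (s / (K + 1))"
  have t: "t > 0" using r s K by (simp add: t_def)
  have b: "f x \<in> ball (f a) s" if "x \<in> ball a t" for x
  proof -
    have x: "dist a x < r" "dist a x < s / (K + 1)" using that by (auto simp: t_def)
    have "dist (f a) (f x) \<le> K * dist a x" using x r(1) by (intro lipschitz_onD[OF r(2)]) simp_all
    also have "\<dots> \<le> (K + 1) * dist a x" by (simp add: mult_right_mono)
    also have "\<dots> < s" using x(2) K by (simp add: pos_less_divide_eq mult.commute)
    finally show ?thesis by simp
  qed
  have "(M * K)-lipschitz_on (ball a t) (\<lambda>x. g (f x))"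
  proof (rule lipschitz_onI)
    fix x y assume xy: "x \<in> ball a t" "y \<in> ball a t"
    have "dist (g (f x)) (g (f y)) \<le> M * dist (f x) (f y)"
      using b xy by (intro lipschitz_onD[OF s(2)]) simp_all
    also have "dist (f x) (f y) \<le> K * dist x y"
      using xy by (intro lipschitz_onD[OF r(2)]) (simp_all add: t_def)
    finally show "dist (g (f x)) (g (f y)) \<le> M * K * dist x y"
      using M by (simp add: mult_left_mono mult.assoc)
  qed (use K M in simp)
  then show ?thesis unfolding locally_lipschitz_at_def using t by blast
qed

lemma locally_lipschitz_at_bounded_linear:
  assumes "bounded_linear f"
  shows "locally_lipschitz_at f a"
proof -
  obtain B where B: "B \<ge> 0" "\<And>x. norm (f x) \<le> norm x * B"
    using bounded_linear.nonneg_bounded[OF assms] by blast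
  then have "B-lipschitz_on (ball a 1) f"
    by (intro lipschitz_onI)
      (simp_all add: dist_norm mult.commute flip: linear_diff[OF bounded_linear.linear[OF assms]])
  then show ?thesis unfolding locally_lipschitz_at_def by (meson zero_less_one)
qed

lemma locally_lipschitz_at_common:
  assumes "finite I" "\<And>i. i \<in> I \<Longrightarrow> locally_lipschitz_at (f i) a"
  shows "\<exists>r>0. \<exists>K. \<forall>i\<in>I. K-lipschitz_on (ball a r) (f i)"
  using assms
proof (induction I rule: finite_induct)
  case empty
  then show ?case by (auto intro: exI[of _ 1])
next
  case (insert j I)
  then obtain r K where r: "r > 0" "\<forall>i\<in>I. K-lipschitz_on (ball a r) (f i)" by auto
  obtain s M where s: "s > 0" "M-lipschitz_on (ball a s) (f j)"
    using insert.prems unfolding locally_lipschitz_at_def by blast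
  have sub: "ball a (min r s) \<subseteq> ball a r" "ball a (min r s) \<subseteq> ball a s" by auto
  have "(max K M)-lipschitz_on (ball a (min r s)) (f i)" if "i \<in> insert j I" for i
  proof (cases "i = j")
    case True
    then show ?thesis using lipschitz_on_mono[OF s(2) sub(2), of "max K M"] by simp
  next
    case False
    then have "K-lipschitz_on (ball a r) (f i)" using r(2) that by blast
    then show ?thesis using lipschitz_on_mono[OF _ sub(1), of K "f i" "max K M"] by simp
  qed
  then show ?case using r(1) s(1) by (intro exI[of _ "min r s"]) auto
qed

lemma locally_lipschitz_at_sum:
  fixes f :: "'i \<Rightarrow> 'a::metric_space \<Rightarrow> 'b::real_normed_vector"
  assumes "finite I" "\<And>i. i \<in> I \<Longrightarrow> locally_lipschitz_at (f i) a"
  shows "locally_lipschitz_at (\<lambda>x. \<Sum>i\<in>I. f i x) a"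
proof -
  obtain r K where r: "r > 0" "\<And>i. i \<in> I \<Longrightarrow> K-lipschitz_on (ball a r) (f i)"
    using locally_lipschitz_at_common[OF assms(1), of f a] assms(2) by blast
  have "(real (card I) * \<bar>K\<bar>)-lipschitz_on (ball a r) (\<lambda>x. \<Sum>i\<in>I. f i x)"
  proof (rule lipschitz_onI)
    fix x y assume xy: "x \<in> ball a r" "y \<in> ball a r"
    have "norm ((\<Sum>i\<in>I. f i x) - (\<Sum>i\<in>I. f i y)) \<le> (\<Sum>i\<in>I. norm (f i x - f i y))"
      by (simp add: norm_sum flip: sum_subtractf)
    also have "\<dots> \<le> (\<Sum>i\<in>I. \<bar>K\<bar> * dist x y)"
    proof (rule sum_mono)
      fix i assume "i \<in> I"
      have "norm (f i x - f i y) \<le> K * dist x y"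
        using lipschitz_onD[OF r(2)[OF \<open>i \<in> I\<close>] xy] by (simp add: dist_norm)
      also have "\<dots> \<le> \<bar>K\<bar> * dist x y" by (simp add: mult_right_mono)
      finally show "norm (f i x - f i y) \<le> \<bar>K\<bar> * dist x y" .
    qed
    finally show "dist (\<Sum>i\<in>I. f i x) (\<Sum>i\<in>I. f i y) \<le> real (card I) * \<bar>K\<bar> * dist x y"
      by (simp add: dist_norm mult.assoc)
  qed simp
  then show ?thesis unfolding locally_lipschitz_at_def using r(1) by blast
qed

lemma locally_lipschitz_at_mult:
  fixes f g :: "'a::metric_space \<Rightarrow> real"
  assumes "locally_lipschitz_at f a" "locally_lipschitz_at g a"
  shows "locally_lipschitz_at (\<lambda>x. f x * g x) a"
proof -
  \<comment> \<open>The two functions are indexed by the booleans to obtain a common ball and a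
    common constant.\<close>
  have "\<exists>r>0. \<exists>K. \<forall>i\<in>UNIV. K-lipschitz_on (ball a r) (if i then f else g)"
    by (rule locally_lipschitz_at_common) (use assms in auto)
  then obtain r K where r: "r > 0" and fg: "K-lipschitz_on (ball a r) f" "K-lipschitz_on (ball a r) g"
    by (metis (full_types) iso_tuple_UNIV_I)
  have K: "K \<ge> 0" using fg lipschitz_on_nonneg by blast
  define M where "M = \<bar>f a\<bar> + \<bar>g a\<bar> + K * r"
  have M: "\<bar>f x\<bar> \<le> M" "\<bar>g x\<bar> \<le> M" if "x \<in> ball a r" for x
  proof -
    have "dist (f a) (f x) \<le> K * dist a x" "dist (g a) (g x) \<le> K * dist a x"
      using that r by (auto intro!: lipschitz_onD[OF fg(1)] lipschitz_onD[OF fg(2)])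
    moreover have "K * dist a x \<le> K * r" using that K by (simp add: mult_left_mono)
    ultimately show "\<bar>f x\<bar> \<le> M" "\<bar>g x\<bar> \<le> M" by (auto simp: M_def dist_real_def)
  qed
  have "M \<ge> 0" using M(1)[of a] r by simp
  have "(2 * M * K)-lipschitz_on (ball a r) (\<lambda>x. f x * g x)"
  proof (rule lipschitz_onI)
    fix x y assume xy: "x \<in> ball a r" "y \<in> ball a r"
    have "\<bar>f x * g x - f y * g y\<bar> = \<bar>f x * (g x - g y) + g y * (f x - f y)\<bar>" by (simp add: algebra_simps)
    also have "\<dots> \<le> \<bar>f x\<bar> * \<bar>g x - g y\<bar> + \<bar>g y\<bar> * \<bar>f x - f y\<bar>"
      by (metis abs_mult abs_triangle_ineq)
    also have "\<dots> \<le> M * (K * dist x y) + M * (K * dist x y)"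
      using lipschitz_onD[OF fg(1) xy] lipschitz_onD[OF fg(2) xy] M xy \<open>M \<ge> 0\<close>
      by (intro add_mono mult_mono) (auto simp: dist_real_def)
    finally show "dist (f x * g x) (f y * g y) \<le> 2 * M * K * dist x y" by (simp add: dist_real_def mult_ac)
  qed (use K \<open>M \<ge> 0\<close> in simp)
  then show ?thesis unfolding locally_lipschitz_at_def using r(1) by blast
qed

lemma locally_lipschitz_at_inverse:
  fixes f :: "'a::metric_space \<Rightarrow> real"
  assumes "locally_lipschitz_at f a" "f a \<noteq> 0"
  shows "locally_lipschitz_at (\<lambda>x. inverse (f x)) a"
proof (rule locally_lipschitz_at_compose[OF assms(1)])
  define c where "c = \<bar>f a\<bar> / 2"
  have c: "c > 0" using assms by (simp add: c_def)
  have b: "\<bar>x\<bar> \<ge> c" if "x \<in> ball (f a) c" for x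
    using that abs_triangle_ineq[of "f a - x" x] by (simp add: c_def dist_real_def)
  have "(1 / (c * c))-lipschitz_on (ball (f a) c) inverse"
  proof (rule lipschitz_onI)
    fix x y assume xy: "x \<in> ball (f a) c" "y \<in> ball (f a) c"
    then have nz: "x \<noteq> 0" "y \<noteq> 0" using b c by fastforce+
    have "\<bar>inverse x - inverse y\<bar> = \<bar>x - y\<bar> / (\<bar>x\<bar> * \<bar>y\<bar>)"
      using nz by (simp add: inverse_diff_inverse abs_mult divide_inverse mult_ac)
    also have "\<dots> \<le> \<bar>x - y\<bar> / (c * c)"
      using b xy c nz by (intro divide_left_mono mult_mono) (auto simp: zero_less_mult_iff)
    finally show "dist (inverse x) (inverse y) \<le> 1 / (c * c) * dist x y" by (simp add: dist_real_def)
  qed (use c in simp)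
  then show "locally_lipschitz_at inverse (f a)" unfolding locally_lipschitz_at_def using c by blast
qed

lemma locally_lipschitz_at_pos_part:
  fixes f :: "'a::metric_space \<Rightarrow> real"
  assumes "locally_lipschitz_at f a"
  shows "locally_lipschitz_at (\<lambda>x. max 0 (f x)) a"
proof (rule locally_lipschitz_at_compose[OF assms])
  have "1-lipschitz_on (ball (f a) 1) (max 0)"
    by (rule lipschitz_onI) (auto simp: dist_real_def)
  then show "locally_lipschitz_at (max 0) (f a)" unfolding locally_lipschitz_at_def by (meson zero_less_one)
qed

section \<open>Averages of matrices close to the identity\<close>

text \<open>The norm on matrices is the Euclidean norm of the entries; by Cauchy-Schwarz in each row
  it dominates the operator norm.\<close>

lemma norm_matrix_vector_mult_le:
  fixes B :: "real^'n^'m"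
  shows "norm (B *v x) \<le> norm B * norm x"
proof -
  have "norm (B *v x) = L2_set (\<lambda>i. norm ((B *v x) $ i)) UNIV" by (simp add: norm_vec_def)
  also have "\<dots> \<le> L2_set (\<lambda>i. norm (B $ i) * norm x) UNIV"
  proof (rule L2_set_mono)
    fix i
    have "(B *v x) $ i = B $ i \<bullet> x" by (simp add: matrix_vector_mult_def inner_vec_def)
    then show "norm ((B *v x) $ i) \<le> norm (B $ i) * norm x" using Cauchy_Schwarz_ineq2[of "B $ i" x] by simp
  qed simp
  also have "\<dots> = norm B * norm x"
    by (simp add: norm_vec_def L2_set_left_distrib[symmetric])
  finally show ?thesis .
qed

lemma matrix_vector_mult_sum_left:
  fixes A :: "'i \<Rightarrow> real^'n^'m"
  shows "(\<Sum>i\<in>I. A i) *v x = (\<Sum>i\<in>I. A i *v x)"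
  by (induction I rule: infinite_finite_induct) (auto simp: matrix_vector_mult_add_rdistrib)

text \<open>Lifted to the nonzero vectors, the map is a Lipschitz perturbation of the identity with small
  constant, hence injective, and open by invariance of domain.\<close>

lemma perturbed_identity_local_homeomorphism:
  fixes I :: "'i set" and b :: "'i \<Rightarrow> rp2 \<Rightarrow> real"
  defines "\<Phi> \<equiv> \<lambda>A L. proj_act (\<Sum>i\<in>I. b i L *\<^sub>R A i) L"
  assumes fin: "finite I" and v0: "v0 \<noteq> 0"
    and lip: "\<And>i. i \<in> I \<Longrightarrow> locally_lipschitz_at (\<lambda>v. b i (line_through v)) v0"
    and nonneg: "\<And>i L. i \<in> I \<Longrightarrow> b i L \<ge> 0"
    and U: "open U" "line_through v0 \<in> U" and one: "\<And>L. L \<in> U \<Longrightarrow> (\<Sum>i\<in>I. b i L) = 1"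
  obtains \<delta> N where "\<delta> > 0" "open N" "line_through v0 \<in> N"
    "\<And>A. (\<And>i v. i \<in> I \<Longrightarrow> norm (A i *v v - v) \<le> \<delta> * norm v) \<Longrightarrow>
      (\<exists>\<Phi>'. homeomorphism N (\<Phi> A ` N) (\<Phi> A) \<Phi>') \<and> open (\<Phi> A ` N)"
proof -
  obtain r1 K where r1: "r1 > 0"
    and K: "\<And>i. i \<in> I \<Longrightarrow> K-lipschitz_on (ball v0 r1) (\<lambda>v. b i (line_through v))"
    using locally_lipschitz_at_common[OF fin, of "\<lambda>i v. b i (line_through v)" v0] lip by blast
  obtain r2 where r2: "r2 > 0" "ball v0 r2 \<subseteq> {v. v \<noteq> 0 \<and> line_through v \<in> U}"
    using open_vimage_line_through[OF U(1)] U(2) v0 by (metis (mono_tags, lifting) mem_Collect_eq openE)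
  define R where "R = norm v0"
  \<comment> \<open>On the ball of this radius the weights are \<open>K\<close>-Lipschitz and have
    sum 1, and \<open>r \<le> R / 2\<close> bounds the norms by \<open>2 * R\<close>.\<close>
  define r where "r = min (min r1 r2) (R / 2)"
  have R: "R > 0" using v0 by (simp add: R_def)
  have r: "r > 0" "r \<le> r1" "r \<le> r2" "r \<le> R / 2" using r1 r2 R by (auto simp: r_def)
  \<comment> \<open>The deviation of the lifted map from the identity will have Lipschitz constant
    at most \<open>real (card I) * (2 * R * \<bar>K\<bar> + 1) * \<delta>\<close>; the denominator
    makes both this and \<open>\<delta>\<close> at most 1/8.\<close>
  define \<delta> where "\<delta> = (1 / 8) / (real (card I) * (2 * R * \<bar>K\<bar> + 1) + 1)"
  have den: "real (card I) * (2 * R * \<bar>K\<bar> + 1) \<ge> 0" using R by simp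
  then have \<delta>: "\<delta> > 0" "\<delta> \<le> 1 / 8" "real (card I) * (2 * R * \<bar>K\<bar> + 1) * \<delta> \<le> 1 / 8"
    by (auto simp: \<delta>_def divide_simps)
  \<comment> \<open>The factor 20 leaves room for rescaling: the injectivity proof produces a
    multiple of a vector of the small ball that lies within \<open>6 * s\<close> of
    \<open>v0\<close> and has to stay in the large ball.\<close>
  define s where "s = r / 20"
  define N where "N = line_through ` ball v0 s"
  have s: "s > 0" "20 * s = r" using r by (auto simp: s_def)
  have "ball v0 r \<subseteq> ball v0 r2" using r(3) by (rule subset_ball)
  then have nz: "v \<noteq> 0" and inU: "line_through v \<in> U" if "v \<in> ball v0 r" for v
    using that r2(2) by blast+
  have normv: "norm v \<le> 2 * R" if "v \<in> ball v0 r" for v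
    using that r(4) R norm_triangle_ineq2[of v v0]
    unfolding R_def dist_norm mem_ball norm_minus_commute[of v v0] by linarith
  have 0: "0 \<notin> ball v0 s" using nz[of 0] s by auto
  show ?thesis
  proof (rule that[of \<delta> N])
    show "open N" unfolding N_def using 0 by (intro open_line_through_image) auto
    show "line_through v0 \<in> N" using s by (auto simp: N_def)
    show "(\<exists>\<Phi>'. homeomorphism N (\<Phi> A ` N) (\<Phi> A) \<Phi>') \<and> open (\<Phi> A ` N)"
      if A: "\<And>i v. i \<in> I \<Longrightarrow> norm (A i *v v - v) \<le> \<delta> * norm v" for A
    proof -
      define a where "a = (\<lambda>i v. b i (line_through v))"
      \<comment> \<open>\<open>\<Psi>\<close> lifts \<open>\<Phi> A\<close> to vectors and is
        homogeneous, because the weights depend only on the line. On the large ball, where the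
        weights have sum 1, \<open>P\<close> is its deviation from the identity.\<close>
      define \<Psi> where "\<Psi> = (\<lambda>v. \<Sum>i\<in>I. a i v *\<^sub>R (A i *v v))"
      define P where "P = (\<lambda>v. \<Sum>i\<in>I. a i v *\<^sub>R (A i *v v - v))"
      have a1: "(\<Sum>i\<in>I. a i v) = 1" if "v \<in> ball v0 r" for v
        using one[OF inU[OF that]] by (simp add: a_def)
      have a0: "a i v \<ge> 0" if "i \<in> I" for i v using nonneg that by (simp add: a_def)
      have ale1: "a i v \<le> 1" if "i \<in> I" "v \<in> ball v0 r" for i v
        using member_le_sum[OF that(1), of "\<lambda>i. a i v"] a0 a1 that fin by auto
      have \<Psi>P: "\<Psi> v = v + P v" if "v \<in> ball v0 r" for v
        using a1[OF that]
        by (simp add: \<Psi>_def P_def scaleR_right_diff_distrib sum_subtractf flip: scaleR_left.sum)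
      have Psmall: "norm (P v) \<le> norm v / 8" if "v \<in> ball v0 r" for v
      proof -
        have "norm (P v) \<le> (\<Sum>i\<in>I. a i v * (\<delta> * norm v))"
          unfolding P_def using A a0 by (intro sum_norm_le) (simp add: mult_left_mono)
        also have "\<dots> = \<delta> * norm v" using a1[OF that] by (simp flip: sum_distrib_right)
        also have "\<dots> \<le> norm v / 8" using \<delta>(2) mult_right_mono[of \<delta> "1/8" "norm v"] by simp
        finally show ?thesis .
      qed
      have Plip: "norm (P v - P w) \<le> norm (v - w) / 8" if vw: "v \<in> ball v0 r" "w \<in> ball v0 r" for v w
      proof -
        have "norm (P v - P w) \<le> (\<Sum>i\<in>I. (2 * R * \<bar>K\<bar> + 1) * \<delta> * norm (v - w))"
          unfolding P_def sum_subtractf[symmetric]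
        proof (rule sum_norm_le)
          fix i assume i: "i \<in> I"
          \<comment> \<open>The change of the weight is multiplied by a vector of size at most
            \<open>\<delta> * norm v\<close>, and the change of the vector, of size at most
            \<open>\<delta> * norm (v - w)\<close>, by a weight at most 1; so both parts are small
            with \<open>\<delta>\<close>.\<close>
          have "a i v *\<^sub>R (A i *v v - v) - a i w *\<^sub>R (A i *v w - w)
              = (a i v - a i w) *\<^sub>R (A i *v v - v) + a i w *\<^sub>R (A i *v (v - w) - (v - w))"
            by (simp add: matrix_vector_mult_diff_distrib algebra_simps)
          also have "norm \<dots> \<le> \<bar>a i v - a i w\<bar> * norm (A i *v v - v)
              + \<bar>a i w\<bar> * norm (A i *v (v - w) - (v - w))"
            by (metis norm_scaleR norm_triangle_ineq)
          also have "\<dots> \<le> (\<bar>K\<bar> * norm (v - w)) * (\<delta> * (2 * R)) + 1 * (\<delta> * norm (v - w))"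
          proof (intro add_mono mult_mono)
            have "dist (a i v) (a i w) \<le> K * dist v w"
              unfolding a_def using vw r(2) by (intro lipschitz_onD[OF K[OF i]]) auto
            also have "\<dots> \<le> \<bar>K\<bar> * dist v w" by (simp add: mult_right_mono)
            finally show "\<bar>a i v - a i w\<bar> \<le> \<bar>K\<bar> * norm (v - w)" by (simp add: dist_real_def dist_norm)
            have "norm (A i *v v - v) \<le> \<delta> * norm v" by (rule A[OF i])
            also have "\<dots> \<le> \<delta> * (2 * R)" using normv[OF vw(1)] \<delta>(1) by (simp add: mult_left_mono)
            finally show "norm (A i *v v - v) \<le> \<delta> * (2 * R)" .
            show "\<bar>a i w\<bar> \<le> 1" using a0 ale1 i vw by simp
            show "norm (A i *v (v - w) - (v - w)) \<le> \<delta> * norm (v - w)" by (rule A[OF i])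
          qed simp_all
          also have "\<dots> = (2 * R * \<bar>K\<bar> + 1) * \<delta> * norm (v - w)" by (simp add: algebra_simps)
          finally show "norm (a i v *\<^sub>R (A i *v v - v) - a i w *\<^sub>R (A i *v w - w))
              \<le> (2 * R * \<bar>K\<bar> + 1) * \<delta> * norm (v - w)" .
        qed
        also have "\<dots> = (real (card I) * (2 * R * \<bar>K\<bar> + 1) * \<delta>) * norm (v - w)" by simp
        also have "\<dots> \<le> 1 / 8 * norm (v - w)" by (rule mult_right_mono[OF \<delta>(3)]) simp
        finally show ?thesis by simp
      qed
      have \<Psi>lower: "7 / 8 * norm (v - w) \<le> norm (\<Psi> v - \<Psi> w)"
        and \<Psi>upper: "norm (\<Psi> v - \<Psi> w) \<le> 9 / 8 * norm (v - w)"
        if vw: "v \<in> ball v0 r" "w \<in> ball v0 r" for v w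
      proof -
        have e: "\<Psi> v - \<Psi> w = (v - w) + (P v - P w)" using vw by (simp add: \<Psi>P)
        show "7 / 8 * norm (v - w) \<le> norm (\<Psi> v - \<Psi> w)"
          unfolding e using Plip[OF vw] norm_diff_ineq[of "v - w" "P v - P w"] by linarith
        show "norm (\<Psi> v - \<Psi> w) \<le> 9 / 8 * norm (v - w)"
          unfolding e using Plip[OF vw] norm_triangle_ineq[of "v - w" "P v - P w"] by linarith
      qed
      have \<Psi>norm: "7 / 8 * norm v \<le> norm (\<Psi> v)" if "v \<in> ball v0 r" for v
        using Psmall[OF that] norm_diff_ineq[of v "P v"] by (simp add: \<Psi>P[OF that])
      have \<Psi>nz: "\<Psi> v \<noteq> 0" if "v \<in> ball v0 r" for v using \<Psi>norm[OF that] nz[OF that] by auto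
      have inj: "inj_on \<Psi> (ball v0 r)"
      proof (rule inj_onI)
        fix v w assume "v \<in> ball v0 r" "w \<in> ball v0 r" "\<Psi> v = \<Psi> w"
        then show "v = w" using \<Psi>lower[of v w] by simp
      qed
      have "(9 / 8)-lipschitz_on (ball v0 r) \<Psi>"
        using \<Psi>upper by (intro lipschitz_onI) (auto simp: dist_norm)
      then have cont: "continuous_on (ball v0 r) \<Psi>" by (rule lipschitz_on_continuous_on)
      have \<Phi>\<Psi>: "\<Phi> A (line_through v) = line_through (\<Psi> v)" if "v \<in> ball v0 r" for v
        using nz[OF that]
        by (simp add: \<Phi>_def proj_act_line_through matrix_vector_mult_sum_left \<Psi>_def a_def
            scaleR_matrix_vector_assoc[symmetric])
      have scale: "\<Psi> (c *\<^sub>R v) = c *\<^sub>R \<Psi> v" if "c \<noteq> 0" for c v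
        using that by (simp add: \<Psi>_def a_def matrix_vector_mult_scaleR scaleR_sum_right mult.commute)
      have sub: "ball v0 s \<subseteq> ball v0 r" using s by auto
      have injN: "inj_on (\<Phi> A) N"
        unfolding N_def
      proof (intro inj_onI, clarify)
        fix v w assume v: "v \<in> ball v0 s" and w: "w \<in> ball v0 s"
          and eq: "\<Phi> A (line_through v) = \<Phi> A (line_through w)"
        have v': "v \<in> ball v0 r" and w': "w \<in> ball v0 r" using v w sub by auto
        then have "line_through (\<Psi> w) = line_through (\<Psi> v)" using eq by (simp add: \<Phi>\<Psi>)
        \<comment> \<open>Equality of the lines determines the vectors only up to a factor
          \<open>c\<close>. By homogeneity it can be moved inside \<open>\<Psi>\<close>, and
          injectivity of \<open>\<Psi>\<close> applies once \<open>c\<close> is so close to 1 that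
          \<open>c *\<^sub>R w\<close> stays in the large ball.\<close>
        then obtain c where c: "c \<noteq> 0" "\<Psi> v = c *\<^sub>R \<Psi> w" using line_through_eq_iff \<Psi>nz v' w' by blast
        have ineq: "norm (v - w) < 2 * s"
          using v w norm_triangle_ineq4[of "v - v0" "w - v0"] by (simp add: dist_norm norm_minus_commute)
        have w0: "norm (w - v0) < s" using w by (simp add: dist_norm norm_minus_commute)
        have wn: "norm w \<ge> 39 / 40 * R" "norm w \<le> 41 / 40 * R"
          using w0 norm_triangle_ineq2[of v0 w] norm_triangle_ineq2[of w v0] s r(4)
          by (auto simp: R_def norm_minus_commute)
        have "\<bar>c - 1\<bar> * (R / 2) \<le> \<bar>c - 1\<bar> * norm (\<Psi> w)"
          using \<Psi>norm[OF w'] wn R by (intro mult_left_mono) auto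
        also have "\<dots> = norm (\<Psi> v - \<Psi> w)"
          by (simp add: c(2) flip: norm_scaleR) (simp add: scaleR_left_diff_distrib)
        also have "\<dots> \<le> 9 / 4 * s" using \<Psi>upper[OF v' w'] ineq by linarith
        finally have "\<bar>c - 1\<bar> * R \<le> 9 / 2 * s" by (simp add: mult_ac)
        then have "\<bar>c - 1\<bar> * (41 / 40 * R) \<le> 5 * s" using s by simp
        moreover have "\<bar>c - 1\<bar> * norm w \<le> \<bar>c - 1\<bar> * (41 / 40 * R)"
          using wn by (intro mult_left_mono) auto
        ultimately have "norm (c *\<^sub>R w - w) \<le> 5 * s"
          by (metis (no_types) norm_scaleR order_trans scaleR_left_diff_distrib scaleR_one)
        then have "norm (c *\<^sub>R w - v0) < r"
          using w0 norm_triangle_ineq[of "c *\<^sub>R w - w" "w - v0"] s by simp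
        then have "c *\<^sub>R w \<in> ball v0 r" by (simp add: dist_norm norm_minus_commute)
        moreover have "\<Psi> (c *\<^sub>R w) = \<Psi> v" using c scale by simp
        ultimately have "c *\<^sub>R w = v" using inj v' by (meson inj_onD)
        then show "line_through v = line_through w" using c(1) by auto
      qed
      have contN: "continuous_on N (\<Phi> A)"
        unfolding N_def
      proof (rule continuous_on_rp2I)
        have "continuous_on (ball v0 s) (\<lambda>v. line_through (\<Psi> v))"
          using \<Psi>nz sub
          by (intro continuous_on_compose2[OF continuous_on_line_through continuous_on_subset[OF cont sub]]) auto
        then show "continuous_on (ball v0 s) (\<lambda>v. \<Phi> A (line_through v))"
          by (rule continuous_on_eq) (metis \<Phi>\<Psi> sub subsetD)
      qed (use 0 in auto)
      have openN: "open (\<Phi> A ` W)" if W: "open W" "W \<subseteq> N" for W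
      proof -
        \<comment> \<open>The cone over \<open>W\<close> is cut down to a ball on which
          \<open>\<Psi>\<close> is continuous and injective, so that invariance of domain
          applies.\<close>
        define V where "V = {v. v \<noteq> 0 \<and> line_through v \<in> W} \<inter> ball v0 s"
        have V: "open V" "V \<subseteq> ball v0 r"
          using sub open_vimage_line_through[OF W(1)] by (auto simp: V_def)
        have "W \<subseteq> line_through ` V"
        proof
          fix L assume "L \<in> W"
          then obtain v where v: "v \<in> ball v0 s" "L = line_through v" using W(2) by (auto simp: N_def)
          then have "v \<noteq> 0" using 0 by blast
          then show "L \<in> line_through ` V" using v \<open>L \<in> W\<close> by (auto simp: V_def)
        qed
        then have "W = line_through ` V" by (auto simp: V_def)
        then have "\<Phi> A ` W = line_through ` \<Psi> ` V"
          using V(2) \<Phi>\<Psi> by (force simp: image_image subset_iff)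
        moreover have "open (\<Psi> ` V)"
          using V inj cont by (intro invariance_of_domain) (auto intro: continuous_on_subset inj_on_subset)
        moreover have "0 \<notin> \<Psi> ` V" using \<Psi>nz V(2) by (metis image_iff subsetD)
        ultimately show ?thesis by (simp add: open_line_through_image)
      qed
      have "open N" unfolding N_def using 0 by (intro open_line_through_image) auto
      have "\<exists>g. homeomorphism N (\<Phi> A ` N) (\<Phi> A) g"
      proof (rule homeomorphism_injective_open_map[OF contN refl injN])
        fix W assume "openin (top_of_set N) W"
        then have "open W" "W \<subseteq> N" using \<open>open N\<close> openin_open_eq by auto
        then show "openin (top_of_set (\<Phi> A ` N)) (\<Phi> A ` W)"
          using openN by (simp add: image_mono openN \<open>open N\<close> openin_open_eq)
      qed blast
      then show ?thesis using openN[OF \<open>open N\<close>] by blast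
    qed
  qed (use \<delta> in auto)
qed

section \<open>Branch points\<close>

text \<open>The neighbourhood of the local model is made an argument, so that it can be shrunk,
  transported and used as the domain of a chart.\<close>

definition branch_disc :: "('a::topological_space \<Rightarrow> rp2) \<Rightarrow> 'a \<Rightarrow> nat \<Rightarrow> 'a set \<Rightarrow> bool" where
  "branch_disc \<phi> p m W \<longleftrightarrow> p \<in> W \<and> open (\<phi> ` W) \<and>
     (\<exists>h h' k k'. homeomorphism W (ball (0::complex) 1) h h' \<and> h p = 0 \<and>
        homeomorphism (\<phi> ` W) (ball (0::complex) 1) k k' \<and> k (\<phi> p) = 0 \<and>
        (\<forall>x\<in>W. k (\<phi> x) = h x ^ (m + 1)))"

lemma has_branch_order_iff_branch_disc:
  "has_branch_order U \<phi> p m \<longleftrightarrow> (\<exists>W. openin (top_of_set U) W \<and> branch_disc \<phi> p m W)"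
  unfolding has_branch_order_def branch_disc_def by blast

lemma norm_power_Suc_less_one: "norm (z::complex) < 1 \<Longrightarrow> norm (z ^ (m + 1)) < 1"
  by (simp only: norm_power power_less_one_iff[OF norm_ge_zero]) simp

lemma homeomorphism_restrict:
  assumes "homeomorphism S T f g" "S' \<subseteq> S"
  shows "homeomorphism S' (f ` S') f g"
  using homeomorphism_of_subsets[OF assms, of "{}"] by simp

lemma homeomorphism_eq_on:
  assumes "homeomorphism S T f g" "\<And>x. x \<in> S \<Longrightarrow> f' x = f x"
  shows "homeomorphism S T f' g"
  using homeomorphism_cong[OF assms(1) refl refl assms(2)] by simp

text \<open>On \<open>W\<close> the map equals \<open>k'\<close> after the power map after
  \<open>h\<close>.\<close>

lemma branch_disc_continuous_on:
  assumes "branch_disc \<phi> p m W"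
  shows "continuous_on W \<phi>"
proof -
  obtain h h' k k' where h: "homeomorphism W (ball (0::complex) 1) h h'"
    and k: "homeomorphism (\<phi> ` W) (ball (0::complex) 1) k k'"
    and hk: "\<And>x. x \<in> W \<Longrightarrow> k (\<phi> x) = h x ^ (m + 1)"
    using assms unfolding branch_disc_def by blast
  have hb: "norm (h x ^ (m + 1)) < 1" if "x \<in> W" for x
  proof -
    have "h x \<in> ball 0 1" using h that by (metis homeomorphism_image1 imageI)
    then show ?thesis by (intro norm_power_Suc_less_one) simp
  qed
  have "continuous_on W (\<lambda>x. k' (h x ^ (m + 1)))"
    by (rule continuous_on_compose2[OF homeomorphism_cont2[OF k]])
      (use hb in \<open>auto intro!: continuous_intros homeomorphism_cont1[OF h]\<close>)
  then show ?thesis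
    by (rule continuous_on_eq) (metis hk homeomorphism_apply1[OF k] imageI)
qed

lemma branch_disc_connected:
  assumes "branch_disc \<phi> p m W"
  shows "connected W"
proof -
  obtain h h' where "homeomorphism W (ball (0::complex) 1) h h'"
    using assms unfolding branch_disc_def by blast
  then have "h' ` ball 0 1 = W" "continuous_on (ball 0 1) h'"
    by (auto simp: homeomorphism_def)
  then show ?thesis by (metis connected_continuous_image connected_ball)
qed

text \<open>Serves both coordinates of a branch disc, with radius \<open>s\<close> in the source and
  \<open>s ^ (m + 1)\<close> in the target.\<close>

lemma homeomorphism_scaled_subdisc:
  assumes h: "homeomorphism W (ball (0::complex) 1) h h'" and s: "0 < s" "s \<le> 1"
  shows "homeomorphism {x \<in> W. norm (h x) < s} (ball 0 1) (\<lambda>x. h x / of_real s) (\<lambda>z. h' (of_real s * z))"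
proof (rule homeomorphismI)
  have sz: "of_real s * z \<in> ball (0::complex) 1" if "norm z < 1" for z
    using mult_strict_mono'[of "norm z" 1 s 1] that s
    by (smt (verit) mem_ball_0 mult_le_cancel_left2 mult_less_cancel_left2 norm_ge_zero norm_mult norm_of_real)
  have h'W: "h' (of_real s * z) \<in> W" "h (h' (of_real s * z)) = of_real s * z" if "norm z < 1" for z
    using sz[OF that] h by (metis homeomorphism_image2 imageI, metis homeomorphism_apply2)
  show "continuous_on {x \<in> W. norm (h x) < s} (\<lambda>x. h x / of_real s)"
    using s by (intro continuous_intros continuous_on_subset[OF homeomorphism_cont1[OF h]]) auto
  show "continuous_on (ball 0 1) (\<lambda>z. h' (of_real s * z))"
    by (rule continuous_on_compose2[OF homeomorphism_cont2[OF h]])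
      (use sz in \<open>auto intro!: continuous_intros\<close>)
  show "(\<lambda>x. h x / of_real s) ` {x \<in> W. norm (h x) < s} \<subseteq> ball 0 1"
    using s by (auto simp: norm_divide)
  show "(\<lambda>z. h' (of_real s * z)) ` ball 0 1 \<subseteq> {x \<in> W. norm (h x) < s}"
    using h'W s by (auto simp: norm_mult)
  show "h' (of_real s * (h x / of_real s)) = x" if "x \<in> {x \<in> W. norm (h x) < s}" for x
    using that s homeomorphism_apply1[OF h] by simp
  show "h (h' (of_real s * z)) / of_real s = z" if "z \<in> ball 0 1" for z
    using that s h'W by simp
qed

text \<open>The power map takes the disc of radius \<open>s\<close> onto the disc of radius
  \<open>s ^ (m + 1)\<close>; after rescaling both to radius 1 the local model is the same.\<close>

lemma branch_disc_shrink:
  assumes "branch_disc \<phi> p m W" "openin (top_of_set W) Q" "p \<in> Q"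
  obtains W' where "W' \<subseteq> Q" "openin (top_of_set W) W'" "branch_disc \<phi> p m W'"
proof -
  obtain h h' k k' where h: "homeomorphism W (ball (0::complex) 1) h h'" "h p = 0"
    and k: "homeomorphism (\<phi> ` W) (ball (0::complex) 1) k k'" "k (\<phi> p) = 0"
    and hk: "\<And>x. x \<in> W \<Longrightarrow> k (\<phi> x) = h x ^ (m + 1)" and op: "open (\<phi> ` W)" and p: "p \<in> W"
    using assms(1) unfolding branch_disc_def by blast
  have "openin (top_of_set (ball 0 1)) (h ` Q)"
    using homeomorphism_imp_open_map[OF h(1) assms(2)] .
  then have "open (h ` Q)" using openin_open_eq open_ball by blast
  moreover have "0 \<in> h ` Q" using assms(3) h(2) by force
  ultimately obtain e where e: "e > 0" "ball 0 e \<subseteq> h ` Q" by (meson openE)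
  define s where "s = min e 1"
  have s: "0 < s" "s \<le> 1" "ball 0 s \<subseteq> h ` Q" using e by (auto simp: s_def)
  have sm: "0 < s ^ (m + 1)" "s ^ (m + 1) \<le> 1" using s by (simp_all add: power_le_one del: power_Suc)
  define W' where "W' = {x \<in> W. norm (h x) < s}"
  have im: "\<phi> ` W' = {y \<in> \<phi> ` W. norm (k y) < s ^ (m + 1)}"
  proof (intro equalityI subsetI)
    fix y assume "y \<in> \<phi> ` W'"
    then show "y \<in> {y \<in> \<phi> ` W. norm (k y) < s ^ (m + 1)}"
      using hk power_strict_mono[of _ s "m + 1"] s by (auto simp: W'_def norm_power simp del: power_Suc)
  next
    fix y assume "y \<in> {y \<in> \<phi> ` W. norm (k y) < s ^ (m + 1)}"
    then obtain x where x: "x \<in> W" "y = \<phi> x" "norm (h x) ^ (m + 1) < s ^ (m + 1)"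
      using hk by (auto simp: norm_power simp del: power_Suc)
    then have "norm (h x) < s" using s power_less_imp_less_base[of "norm (h x)" "m + 1" s] by linarith
    then show "y \<in> \<phi> ` W'" using x by (auto simp: W'_def)
  qed
  have opW: "openin (top_of_set W) W'"
  proof -
    have "W' = W \<inter> h -` ball 0 s" by (auto simp: W'_def)
    then show ?thesis by (metis continuous_openin_preimage_gen homeomorphism_cont1[OF h(1)] open_ball)
  qed
  have opi: "open (\<phi> ` W')"
  proof -
    have "\<phi> ` W' = k -` ball 0 (s ^ (m + 1)) \<inter> \<phi> ` W" unfolding im by auto
    then show ?thesis
      using homeomorphism_cont1[OF k(1)] op by (metis continuous_on_open_vimage open_ball)
  qed
  show ?thesis
  proof (rule that[of W'])
    show "W' \<subseteq> Q"
    proof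
      fix x assume "x \<in> W'"
      then have "x \<in> W" "h x \<in> h ` Q" using s by (auto simp: W'_def)
      moreover have "Q \<subseteq> W" using assms(2) openin_imp_subset by blast
      ultimately show "x \<in> Q" using homeomorphism_apply1[OF h(1)] by (metis imageE subsetD)
    qed
    show "branch_disc \<phi> p m W'"
      unfolding branch_disc_def
    proof (intro conjI exI ballI)
      show "homeomorphism W' (ball 0 1) (\<lambda>x. h x / of_real s) (\<lambda>z. h' (of_real s * z))"
        unfolding W'_def using h(1) s by (intro homeomorphism_scaled_subdisc)
      show "homeomorphism (\<phi> ` W') (ball 0 1) (\<lambda>x. k x / of_real (s ^ (m + 1)))
          (\<lambda>z. k' (of_real (s ^ (m + 1)) * z))"
        unfolding im using k(1) sm by (intro homeomorphism_scaled_subdisc)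
      show "k (\<phi> x) / of_real (s ^ (m + 1)) = (h x / of_real s) ^ (m + 1)" if "x \<in> W'" for x
        using that hk by (simp add: W'_def power_divide)
    qed (use p h k s opi in \<open>auto simp: W'_def\<close>)
  qed (rule opW)
qed

lemma has_branch_order_disc:
  assumes "has_branch_order U \<phi> p m" "openin (top_of_set U) Q" "p \<in> Q"
  obtains W where "W \<subseteq> Q" "openin (top_of_set U) W" "branch_disc \<phi> p m W"
proof -
  obtain W where W: "openin (top_of_set U) W" "branch_disc \<phi> p m W"
    using assms(1) has_branch_order_iff_branch_disc by blast
  have "openin (top_of_set W) (W \<inter> Q)"
    using W(1) assms(2) by (metis inf_le1 openin_Int openin_imp_subset openin_subset_trans)
  moreover have "p \<in> W \<inter> Q" using W(2) assms(3) by (simp add: branch_disc_def)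
  ultimately obtain W' where "W' \<subseteq> W \<inter> Q" "openin (top_of_set W) W'" "branch_disc \<phi> p m W'"
    using branch_disc_shrink[OF W(2)] by blast
  then show ?thesis using that W(1) by (meson le_inf_iff openin_trans)
qed

lemma has_branch_order_open_image:
  assumes "has_branch_order U \<phi> p m" "openin (top_of_set U) Q" "p \<in> Q"
  obtains V where "open V" "\<phi> p \<in> V" "V \<subseteq> \<phi> ` Q"
proof -
  obtain W where "W \<subseteq> Q" "branch_disc \<phi> p m W" using has_branch_order_disc[OF assms] by blast
  then show ?thesis by (intro that[of "\<phi> ` W"]) (auto simp: branch_disc_def)
qed

text \<open>A disc coordinate \<open>k\<close> at the image point pulls back to the source
  coordinate \<open>k \<circ> \<phi>\<close>, and the power map of exponent 1 is the
  identity.\<close>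

lemma has_branch_order_0I:
  assumes hom: "homeomorphism W (\<phi> ` W) \<phi> \<psi>" and W: "openin (top_of_set U) W" "p \<in> W" "open (\<phi> ` W)"
  shows "has_branch_order U \<phi> p 0"
proof -
  obtain D k k' where D: "open D" "\<phi> p \<in> D" "D \<subseteq> \<phi> ` W" "homeomorphism D (ball (0::complex) 1) k k'" "k (\<phi> p) = 0"
    using rp2_disc_neighbourhood[OF W(3), of "\<phi> p"] W(2) by blast
  define W' where "W' = W \<inter> \<phi> -` D"
  have "openin (top_of_set W) W'"
    unfolding W'_def using homeomorphism_cont1[OF hom] D(1) by (rule continuous_openin_preimage_gen)
  then have op: "openin (top_of_set U) W'" using W(1) openin_trans by blast
  have im: "\<phi> ` W' = D" using D(3) by (auto simp: W'_def)
  have "homeomorphism W' D \<phi> \<psi>"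
    using homeomorphism_restrict[OF hom, of W'] im by (auto simp: W'_def)
  then have "homeomorphism W' (ball 0 1) (k \<circ> \<phi>) (\<psi> \<circ> k')" using D(4) by (rule homeomorphism_compose)
  then have "branch_disc \<phi> p 0 W'"
    unfolding branch_disc_def im using D W(2) by (auto simp: W'_def intro!: exI)
  then show ?thesis using op has_branch_order_iff_branch_disc by blast
qed

lemma branch_disc_0_homeomorphism:
  assumes "branch_disc \<phi> p 0 W"
  obtains \<psi> where "homeomorphism W (\<phi> ` W) \<phi> \<psi>"
proof -
  obtain h h' k k' where h: "homeomorphism W (ball (0::complex) 1) h h'"
    and k: "homeomorphism (\<phi> ` W) (ball (0::complex) 1) k k'"
    and hk: "\<And>x. x \<in> W \<Longrightarrow> k (\<phi> x) = h x"
    using assms unfolding branch_disc_def by auto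
  have "homeomorphism (ball 0 1) (\<phi> ` W) k' k" using k homeomorphism_symD by blast
  with h have "homeomorphism W (\<phi> ` W) (k' \<circ> h) (h' \<circ> k)" by (rule homeomorphism_compose)
  then have "homeomorphism W (\<phi> ` W) \<phi> (h' \<circ> k)"
    by (rule homeomorphism_eq_on) (metis hk homeomorphism_apply1[OF k] comp_apply imageI)
  then show ?thesis by (rule that)
qed

text \<open>Away from the origin the power map is a covering of the punctured plane, hence a local
  homeomorphism.\<close>

lemma branch_disc_regular_nearby:
  assumes "branch_disc \<phi> p m W" "q \<in> W" "q \<noteq> p"
  obtains V \<psi> where "openin (top_of_set W) V" "q \<in> V" "homeomorphism V (\<phi> ` V) \<phi> \<psi>" "open (\<phi> ` V)"
proof -
  obtain h h' k k' where h: "homeomorphism W (ball (0::complex) 1) h h'" "h p = 0"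
    and k: "homeomorphism (\<phi> ` W) (ball (0::complex) 1) k k'"
    and hk: "\<And>x. x \<in> W \<Longrightarrow> k (\<phi> x) = h x ^ (m + 1)" and op: "open (\<phi> ` W)" and p: "p \<in> W"
    using assms(1) unfolding branch_disc_def by blast
  have "h q \<noteq> 0" using assms(2,3) h p by (metis homeomorphism_apply1)
  then obtain T u g where T: "h q \<in> T" "openin (top_of_set (- {0})) T" "openin (top_of_set (- {0})) u"
    and g: "homeomorphism T u (\<lambda>z::complex. z ^ (m + 1)) g"
    using covering_space_local_homeomorphism[OF covering_space_power_punctured_plane[of "m + 1"], of "h q"]
    by (metis ComplI add_gr_0 less_one singletonD)
  have oT: "open T" "open u" using T(2,3) openin_open_eq[of "- {0::complex}"] by (simp_all add: open_Compl)
  define T' where "T' = T \<inter> ball 0 1"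
  define u' where "u' = (\<lambda>z. z ^ (m + 1)) ` T'"
  have hT': "homeomorphism T' u' (\<lambda>z. z ^ (m + 1)) g"
    unfolding u'_def by (rule homeomorphism_restrict[OF g]) (simp add: T'_def)
  have "openin (top_of_set T) T'" using oT(1) by (simp add: T'_def openin_open_Int)
  then have "openin (top_of_set u) u'" unfolding u'_def by (rule homeomorphism_imp_open_map[OF g])
  then have ou': "open u'" using oT(2) openin_open_eq by blast
  have u'b: "u' \<subseteq> ball 0 1"
    using norm_power_Suc_less_one by (auto simp: u'_def T'_def simp del: power_Suc)
  define V where "V = W \<inter> h -` T'"
  have hV: "h ` V = T'"
  proof -
    have "T' \<subseteq> h ` W" using homeomorphism_image1[OF h(1)] by (auto simp: T'_def)
    then show ?thesis by (auto simp: V_def)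
  qed
  have c1: "homeomorphism V T' h h'"
    using homeomorphism_restrict[OF h(1), of V] hV by (simp add: V_def)
  have kk: "homeomorphism (ball 0 1) (\<phi> ` W) k' k" using k homeomorphism_symD by blast
  have c3: "homeomorphism u' (k' ` u') k' k"
    by (rule homeomorphism_restrict[OF kk u'b])
  have "homeomorphism V (k' ` u') (k' \<circ> ((\<lambda>z. z ^ (m + 1)) \<circ> h)) ((h' \<circ> g) \<circ> k)"
    by (rule homeomorphism_compose[OF homeomorphism_compose[OF c1 hT'] c3])
  moreover have "\<phi> x = (k' \<circ> ((\<lambda>z. z ^ (m + 1)) \<circ> h)) x" if "x \<in> V" for x
    using that hk homeomorphism_apply1[OF k] by (metis (no_types, lifting) IntD1 V_def comp_apply imageI)
  ultimately have hom: "homeomorphism V (k' ` u') \<phi> ((h' \<circ> g) \<circ> k)"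
    by (rule homeomorphism_eq_on)
  have im: "\<phi> ` V = k' ` u'" using homeomorphism_image1[OF hom] .
  have "openin (top_of_set (\<phi> ` W)) (k' ` u')"
    using ou' u'b by (intro homeomorphism_imp_open_map[OF kk]) (simp add: openin_open_eq)
  then have "open (\<phi> ` V)" using op openin_open_eq unfolding im by blast
  moreover have "openin (top_of_set W) V"
    unfolding V_def T'_def using oT(1) homeomorphism_cont1[OF h(1)]
    by (intro continuous_openin_preimage_gen) auto
  moreover have "q \<in> V"
    using assms(2) T(1) homeomorphism_image1[OF h(1)] by (auto simp: V_def T'_def)
  moreover have "homeomorphism V (\<phi> ` V) \<phi> ((h' \<circ> g) \<circ> k)" unfolding im by (rule hom)
  ultimately show ?thesis by (intro that)
qed

text \<open>In the coordinate \<open>h\<close> a fibre is a set of roots of order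
  \<open>m + 1\<close>: either \<open>m + 1\<close> simple ones or the origin alone, which counts
  \<open>m + 1\<close> times.\<close>

lemma branch_disc_fibre_sum:
  assumes W: "branch_disc \<phi> p m W" and y: "y \<in> \<phi> ` W"
  shows "finite {q \<in> W. \<phi> q = y}" "(\<Sum>q | q \<in> W \<and> \<phi> q = y. (if q = p then m else 0) + 1) = m + 1"
proof -
  obtain h h' k k' where h: "homeomorphism W (ball (0::complex) 1) h h'" "h p = 0"
    and k: "homeomorphism (\<phi> ` W) (ball (0::complex) 1) k k'" "k (\<phi> p) = 0"
    and hk: "\<And>x. x \<in> W \<Longrightarrow> k (\<phi> x) = h x ^ (m + 1)" and p: "p \<in> W"
    using W unfolding branch_disc_def by blast
  define Z where "Z = {z. z ^ (m + 1) = k y}"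
  have kinj: "k y1 = k y2 \<Longrightarrow> y1 = y2" if "y1 \<in> \<phi> ` W" "y2 \<in> \<phi> ` W" for y1 y2
    using that homeomorphism_apply1[OF k(1)] by metis
  have hinj: "inj_on h W" using homeomorphism_apply1[OF h(1)] by (metis inj_onI)
  have im: "h ` {q \<in> W. \<phi> q = y} = Z"
  proof (intro equalityI subsetI)
    fix z assume "z \<in> h ` {q \<in> W. \<phi> q = y}"
    then show "z \<in> Z" using hk by (auto simp: Z_def)
  next
    fix z assume z: "z \<in> Z"
    \<comment> \<open>All roots of a number of modulus less than 1 lie in the unit disc, so
      \<open>W\<close> misses none of them.\<close>
    have "k y \<in> ball 0 1" using y homeomorphism_image1[OF k(1)] by blast
    then have "norm z ^ (m + 1) < 1 ^ (m + 1)" using z by (simp add: Z_def norm_power[symmetric] del: power_Suc)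
    then have "norm z < 1" using power_less_imp_less_base zero_le_one by blast
    then have "z \<in> ball 0 1" by simp
    then obtain q where q: "q \<in> W" "z = h q" using homeomorphism_image1[OF h(1)] by blast
    then have "k (\<phi> q) = k y" using z hk by (simp add: Z_def)
    then have "\<phi> q = y" using kinj y q(1) by blast
    then show "z \<in> h ` {q \<in> W. \<phi> q = y}" using q by blast
  qed
  have injF: "inj_on h {q \<in> W. \<phi> q = y}" using hinj by (rule inj_on_subset) auto
  have finZ: "finite Z" unfolding Z_def by (rule finite_nth_roots) simp
  then show fin: "finite {q \<in> W. \<phi> q = y}" using im injF by (metis finite_imageD)
  have card: "card {q \<in> W. \<phi> q = y} = card Z" using im injF by (metis card_image)
  show "(\<Sum>q | q \<in> W \<and> \<phi> q = y. (if q = p then m else 0) + 1) = m + 1"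
  proof (cases "y = \<phi> p")
    case True
    then have "Z = {0}" using k(2) by (auto simp: Z_def)
    then have "{q \<in> W. \<phi> q = y} = {p}"
      using True p card by (metis (mono_tags, lifting) card_1_singletonE is_singletonI is_singleton_altdef mem_Collect_eq singletonD)
    then show ?thesis by simp
  next
    case False
    then have "k y \<noteq> 0" using kinj[OF y, of "\<phi> p"] k(2) p by auto
    then have "card Z = m + 1" unfolding Z_def by (intro card_nth_roots) auto
    moreover have "(\<Sum>q | q \<in> W \<and> \<phi> q = y. (if q = p then m else 0) + 1) = (\<Sum>q | q \<in> W \<and> \<phi> q = y. 1)"
      using False by (intro sum.cong) auto
    ultimately show ?thesis using card by simp
  qed
qed

text \<open>The order is \<open>m\<close> at the centre and 0 elsewhere, so a branch disc can itself
  be the domain of a branched chart.\<close>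

lemma branch_disc_finite_branched_covering:
  assumes "branch_disc \<phi> p m W"
  shows "finite_branched_covering W \<phi>"
  unfolding finite_branched_covering_def
proof (intro exI conjI ballI)
  fix q assume "q \<in> W"
  show "has_branch_order W \<phi> q (if q = p then m else 0)"
  proof (cases "q = p")
    case True
    then show ?thesis using assms by (auto simp: has_branch_order_iff_branch_disc)
  next
    case False
    then obtain V \<psi> where "openin (top_of_set W) V" "q \<in> V" "homeomorphism V (\<phi> ` V) \<phi> \<psi>" "open (\<phi> ` V)"
      using branch_disc_regular_nearby[OF assms \<open>q \<in> W\<close>] by blast
    then show ?thesis using False has_branch_order_0I by simp
  qed
qed (use branch_disc_fibre_sum[OF assms] in auto)

text \<open>The homeomorphism is absorbed into the target coordinate, which becomes
  \<open>k \<circ> \<Phi>'\<close>; source coordinate and exponent stay the same.\<close>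

lemma has_branch_order_postcompose:
  assumes ord: "has_branch_order U \<phi> p m" and \<Phi>: "homeomorphism N M \<Phi> \<Phi>'" "open N" "open M"
    and Q: "openin (top_of_set U) Q" "p \<in> Q"
    and eq: "\<And>x. x \<in> Q \<Longrightarrow> \<phi> x \<in> N" "\<And>x. x \<in> Q \<Longrightarrow> \<psi> x = \<Phi> (\<phi> x)"
  shows "has_branch_order U \<psi> p m"
proof -
  obtain W where W: "W \<subseteq> Q" "openin (top_of_set U) W" "branch_disc \<phi> p m W"
    using has_branch_order_disc[OF ord Q] by blast
  obtain h h' k k' where h: "homeomorphism W (ball (0::complex) 1) h h'" "h p = 0"
    and k: "homeomorphism (\<phi> ` W) (ball (0::complex) 1) k k'" "k (\<phi> p) = 0"
    and hk: "\<And>x. x \<in> W \<Longrightarrow> k (\<phi> x) = h x ^ (m + 1)" and op: "open (\<phi> ` W)" and p: "p \<in> W"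
    using W(3) unfolding branch_disc_def by blast
  have sub: "\<phi> ` W \<subseteq> N" using W(1) eq by blast
  have im: "\<psi> ` W = \<Phi> ` \<phi> ` W" unfolding image_image using W(1) eq by (intro image_cong) auto
  have "openin (top_of_set M) (\<Phi> ` \<phi> ` W)"
    using op sub by (intro homeomorphism_imp_open_map[OF \<Phi>(1)]) (simp add: \<Phi>(2) openin_open_eq)
  then have "open (\<psi> ` W)" using \<Phi>(3) openin_open_eq im by metis
  moreover have "homeomorphism (\<phi> ` W) (\<psi> ` W) \<Phi> \<Phi>'"
    unfolding im by (rule homeomorphism_restrict[OF \<Phi>(1) sub])
  then have "homeomorphism (\<psi> ` W) (\<phi> ` W) \<Phi>' \<Phi>" using homeomorphism_symD by blast
  then have "homeomorphism (\<psi> ` W) (ball 0 1) (k \<circ> \<Phi>') (\<Phi> \<circ> k')" using k(1) by (rule homeomorphism_compose)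
  moreover have inv: "\<Phi>' (\<psi> x) = \<phi> x" if "x \<in> W" for x
    using that W(1) eq homeomorphism_apply1[OF \<Phi>(1)] by (metis subsetD)
  have "\<forall>x\<in>W. (k \<circ> \<Phi>') (\<psi> x) = h x ^ (m + 1)" using inv hk by simp
  moreover have "(k \<circ> \<Phi>') (\<psi> p) = 0" using inv p k(2) by simp
  ultimately have "branch_disc \<psi> p m W"
    unfolding branch_disc_def using p h by blast
  then show ?thesis using W(2) has_branch_order_iff_branch_disc by blast
qed

text \<open>The homeomorphism is absorbed into the source coordinate, which becomes
  \<open>h \<circ> f\<close>.\<close>

lemma has_branch_order_precompose:
  assumes f: "homeomorphism A B f g" and A: "openin (top_of_set U) A" "p \<in> A" and B: "openin (top_of_set V) B"
    and ord: "has_branch_order V \<phi> (f p) m" and eq: "\<And>x. x \<in> A \<Longrightarrow> \<psi> x = \<phi> (f x)"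
  shows "has_branch_order U \<psi> p m"
proof -
  have fp: "f p \<in> B" using A(2) homeomorphism_image1[OF f] by blast
  then obtain W where W: "W \<subseteq> B" "openin (top_of_set V) W" "branch_disc \<phi> (f p) m W"
    using has_branch_order_disc[OF ord B] by blast
  obtain h h' k k' where h: "homeomorphism W (ball (0::complex) 1) h h'" "h (f p) = 0"
    and k: "homeomorphism (\<phi> ` W) (ball (0::complex) 1) k k'" "k (\<phi> (f p)) = 0"
    and hk: "\<And>x. x \<in> W \<Longrightarrow> k (\<phi> x) = h x ^ (m + 1)" and op: "open (\<phi> ` W)" and p: "f p \<in> W"
    using W(3) unfolding branch_disc_def by blast
  define W' where "W' = g ` W"
  have gf: "homeomorphism B A g f" using f homeomorphism_symD by blast
  have W'A: "W' \<subseteq> A" using W(1) homeomorphism_image1[OF gf] by (auto simp: W'_def)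
  have hom: "homeomorphism W' W f g"
    unfolding W'_def using homeomorphism_restrict[OF gf W(1)] homeomorphism_symD by blast
  have "openin (top_of_set B) W"
    using openin_subset_trans[OF W(2,1) openin_imp_subset[OF B]] .
  then have "openin (top_of_set A) W'" unfolding W'_def by (rule homeomorphism_imp_open_map[OF gf])
  then have opW': "openin (top_of_set U) W'" using A(1) openin_trans by blast
  have pW': "p \<in> W'" using p A(2) homeomorphism_apply1[OF f] by (metis W'_def imageI)
  have im: "\<psi> ` W' = \<phi> ` W"
  proof -
    have "\<psi> ` W' = \<phi> ` f ` W'" unfolding image_image using W'A eq by (intro image_cong) auto
    then show ?thesis by (simp add: homeomorphism_image1[OF hom])
  qed
  have "homeomorphism W' (ball 0 1) (h \<circ> f) (g \<circ> h')" using hom h(1) by (rule homeomorphism_compose)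
  moreover have "\<forall>x\<in>W'. k (\<psi> x) = (h \<circ> f) x ^ (m + 1)"
    using W'A eq hk homeomorphism_image1[OF hom] by auto
  moreover have "(h \<circ> f) p = 0" "k (\<psi> p) = 0" using h k eq A(2) by auto
  ultimately have "branch_disc \<psi> p m W'"
    unfolding branch_disc_def im using pW' op k(1) by blast
  then show ?thesis using opW' has_branch_order_iff_branch_disc by blast
qed

section \<open>Coverings and deck transformations\<close>

text \<open>The library has path lifting, monodromy and the characterisation of simple connectedness by paths only
  for subsets of normed spaces.\<close>

lemma covering_lift_unique:
  assumes cov: "covering_space E \<pi> S" and X: "connected X" "a \<in> X"
    and f: "continuous_on X f" "f \<in> X \<rightarrow> E" and g: "continuous_on X g" "g \<in> X \<rightarrow> E"
    and fg: "\<And>x. x \<in> X \<Longrightarrow> \<pi> (f x) = \<pi> (g x)" and eq: "f a = g a" and "x \<in> X"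
  shows "f x = g x"
proof -
  \<comment> \<open>Agreement of the lifts is a locally constant truth value: on a common sheet
    injectivity of \<open>\<pi>\<close> forces it, on different sheets disjointness forbids
    it.\<close>
  have "(\<lambda>x. f x = g x) constant_on X"
  proof (rule locally_constant_imp_constant[OF X(1)])
    fix x assume x: "x \<in> X"
    have "\<pi> (f x) \<in> S" using cov f(2) x by (metis PiE covering_space_imp_surjective imageI)
    then obtain V v where V: "\<pi> (f x) \<in> V" "\<Union>v = E \<inter> \<pi> -` V" "pairwise disjnt v"
      "\<And>u. u \<in> v \<Longrightarrow> openin (top_of_set E) u" "\<And>u. u \<in> v \<Longrightarrow> \<exists>q. homeomorphism u V \<pi> q"
      using cov unfolding covering_space_def by metis
    have "f x \<in> \<Union>v" "g x \<in> \<Union>v" using V(1,2) f(2) g(2) x fg by auto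
    then obtain u w where uw: "u \<in> v" "f x \<in> u" "w \<in> v" "g x \<in> w" by blast
    define N where "N = (X \<inter> f -` u) \<inter> (X \<inter> g -` w)"
    have "openin (top_of_set X) N"
      unfolding N_def using uw V(4) f g by (intro openin_Int continuous_openin_preimage) auto
    moreover have "x \<in> N" using uw x by (simp add: N_def)
    moreover have "(f y = g y) = (f x = g x)" if "y \<in> N" for y
    proof (cases "u = w")
      case True
      obtain q where "homeomorphism u V \<pi> q" using V(5) uw(1) by blast
      then have "\<And>s t. s \<in> u \<Longrightarrow> t \<in> u \<Longrightarrow> \<pi> s = \<pi> t \<Longrightarrow> s = t" by (metis homeomorphism_apply1)
      then show ?thesis using that fg x uw True by (metis IntD1 IntD2 N_def vimageD)
    next
      case False
      then have "u \<inter> w = {}" using V(3) uw by (metis disjnt_def pairwiseD)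
      then show ?thesis using that uw by (auto simp: N_def)
    qed
    ultimately show "\<exists>T. openin (top_of_set X) T \<and> x \<in> T \<and> (\<forall>y\<in>T. (f y = g y) = (f x = g x))"
      by blast
  qed
  then show ?thesis using X(2) eq \<open>x \<in> X\<close> unfolding constant_on_def by metis
qed

section \<open>Lifting maps of the unit square\<close>

text \<open>The point \<open>p\<close> and the value over it are arbitrary, so that a lift over one
  piece can be continued onto the next from any common point.\<close>

definition lifts_on :: "'e::topological_space set \<Rightarrow> ('e \<Rightarrow> 's) \<Rightarrow> ('x::topological_space \<Rightarrow> 's) \<Rightarrow> 'x set \<Rightarrow> bool" where
  "lifts_on E \<pi> H R \<longleftrightarrow> (\<forall>p\<in>R. \<forall>a\<in>E. \<pi> a = H p \<longrightarrow>
     (\<exists>l. continuous_on R l \<and> l \<in> R \<rightarrow> E \<and> (\<forall>z\<in>R. \<pi> (l z) = H z) \<and> l p = a))"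

text \<open>Lifts that agree at one common point agree on the whole connected intersection by
  uniqueness; closedness of the pieces makes the combined lift continuous.\<close>

lemma lifts_on_Un:
  assumes cov: "covering_space E \<pi> S" and A: "lifts_on E \<pi> H A" "closed A" and B: "lifts_on E \<pi> H B" "closed B"
    and AB: "connected (A \<inter> B)" "c \<in> A \<inter> B"
  shows "lifts_on E \<pi> H (A \<union> B)"
proof -
  \<comment> \<open>Stated for arbitrary pieces, because the prescribed point may lie in either of
    them.\<close>
  have *: "\<exists>l. continuous_on (A \<union> B) l \<and> l \<in> A \<union> B \<rightarrow> E \<and> (\<forall>z\<in>A \<union> B. \<pi> (l z) = H z) \<and> l p = a"
    if A: "lifts_on E \<pi> H A" "closed A" and B: "lifts_on E \<pi> H B" "closed B"
      and AB: "connected (A \<inter> B)" "c \<in> A \<inter> B" and p: "p \<in> A" "a \<in> E" "\<pi> a = H p" for A B p a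
  proof -
    obtain l where l: "continuous_on A l" "l \<in> A \<rightarrow> E" "\<And>z. z \<in> A \<Longrightarrow> \<pi> (l z) = H z" "l p = a"
      using A p unfolding lifts_on_def by blast
    have "c \<in> B" "l c \<in> E" "\<pi> (l c) = H c" using l AB(2) by auto
    then obtain k where k: "continuous_on B k" "k \<in> B \<rightarrow> E" "\<And>z. z \<in> B \<Longrightarrow> \<pi> (k z) = H z" "k c = l c"
      using B unfolding lifts_on_def by blast
    have agree: "k z = l z" if "z \<in> A \<inter> B" for z
    proof (rule covering_lift_unique[OF cov AB])
      show "continuous_on (A \<inter> B) k" "continuous_on (A \<inter> B) l"
        using l(1) k(1) by (auto intro: continuous_on_subset)
    qed (use l k that in auto)
    have "continuous_on (A \<union> B) (\<lambda>z. if z \<in> A then l z else k z)"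
      using agree by (intro continuous_on_cases A B l k) auto
    then show ?thesis
      using l k p by (intro exI[of _ "\<lambda>z. if z \<in> A then l z else k z"]) auto
  qed
  show ?thesis
    unfolding lifts_on_def
  proof (intro ballI impI)
    fix p a assume p: "p \<in> A \<union> B" "a \<in> E" "\<pi> a = H p"
    show "\<exists>l. continuous_on (A \<union> B) l \<and> l \<in> A \<union> B \<rightarrow> E \<and> (\<forall>z\<in>A \<union> B. \<pi> (l z) = H z) \<and> l p = a"
    proof (cases "p \<in> A")
      case True
      then show ?thesis by (rule *[OF A B AB _ p(2,3)])
    next
      case False
      then have "p \<in> B" using p(1) by blast
      moreover have "connected (B \<inter> A)" "c \<in> B \<inter> A" using AB by (simp_all add: Int_commute)
      ultimately show ?thesis using *[OF B A _ _ _ p(2,3)] by (simp add: Un_commute)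
    qed
  qed
qed

text \<open>Over an evenly covered set the lift is the inverse of \<open>\<pi>\<close> on the sheet
  through the prescribed value, whatever the shape of \<open>R\<close>.\<close>

lemma lifts_on_locally:
  assumes cov: "covering_space E \<pi> S" and H: "continuous_on Q H" "H \<in> Q \<rightarrow> S" and z: "z \<in> Q"
  obtains N where "openin (top_of_set Q) N" "z \<in> N" "\<And>R. R \<subseteq> N \<Longrightarrow> lifts_on E \<pi> H R"
proof -
  have "H z \<in> S" using H z by auto
  then obtain V v where V: "H z \<in> V" "openin (top_of_set S) V" "\<Union>v = E \<inter> \<pi> -` V"
    "\<And>u. u \<in> v \<Longrightarrow> openin (top_of_set E) u" "\<And>u. u \<in> v \<Longrightarrow> \<exists>q. homeomorphism u V \<pi> q"
    using cov unfolding covering_space_def by metis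
  show ?thesis
  proof (rule that[of "Q \<inter> H -` V"])
    show "openin (top_of_set Q) (Q \<inter> H -` V)"
      using H V(2) by (rule continuous_openin_preimage)
    show "z \<in> Q \<inter> H -` V" using z V(1) by simp
    show "lifts_on E \<pi> H R" if R: "R \<subseteq> Q \<inter> H -` V" for R
      unfolding lifts_on_def
    proof (intro ballI impI)
      fix p a assume p: "p \<in> R" "a \<in> E" "\<pi> a = H p"
      then have "a \<in> E \<inter> \<pi> -` V" using R by auto
      then obtain u where u: "u \<in> v" "a \<in> u" unfolding V(3)[symmetric] by blast
      then obtain q where q: "homeomorphism u V \<pi> q" using V(5) by blast
      have "u \<subseteq> E" using u V(3) by blast
      have im: "q ` V = u" using q by (rule homeomorphism_image2)
      show "\<exists>l. continuous_on R l \<and> l \<in> R \<rightarrow> E \<and> (\<forall>z\<in>R. \<pi> (l z) = H z) \<and> l p = a"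
      proof (intro exI conjI ballI)
        show "continuous_on R (\<lambda>z. q (H z))"
          by (rule continuous_on_compose2[OF homeomorphism_cont2[OF q]])
            (use R H(1) in \<open>auto intro: continuous_on_subset\<close>)
        show "(\<lambda>z. q (H z)) \<in> R \<rightarrow> E" using R im \<open>u \<subseteq> E\<close> by blast
        show "\<pi> (q (H z)) = H z" if "z \<in> R" for z using that R homeomorphism_apply2[OF q] by auto
        show "q (H p) = a" using p(3) u(2) homeomorphism_apply1[OF q] by metis
      qed
    qed
  qed
qed

text \<open>Bisection takes the place of a Lebesgue number: in the first coordinate it yields lifts
  over thin strips around each height \<open>s\<close>, in the second one it stacks the
  strips.\<close>

lemma lifts_on_unit_square:
  fixes H :: "real \<times> real \<Rightarrow> 's::topological_space"
  assumes cov: "covering_space E \<pi> S" and H: "continuous_on ({0..1} \<times> {0..1}) H" "H \<in> {0..1} \<times> {0..1} \<rightarrow> S"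
  shows "lifts_on E \<pi> H ({0..1} \<times> {0..1})"
proof -
  define L where "L = (\<lambda>a b c d. lifts_on E \<pi> H ({a..b} \<times> {c..d}))"
  define near where "near = (\<lambda>(s::real) \<delta> c d. c \<le> s \<and> s \<le> d \<and> d - c < \<delta> \<and> 0 \<le> c \<and> d \<le> 1)"
  have loc: "\<exists>\<delta>>0. \<forall>a b c d. near t \<delta> a b \<longrightarrow> near s \<delta> c d \<longrightarrow> L a b c d"
    if ts: "t \<in> {0..1}" "s \<in> {0..1}" for t s
  proof -
    obtain N where N: "openin (top_of_set ({0..1} \<times> {0..1})) N" "(t, s) \<in> N" "\<And>R. R \<subseteq> N \<Longrightarrow> lifts_on E \<pi> H R"
      using lifts_on_locally[OF cov H, of "(t, s)"] ts by blast
    obtain e where e: "e > 0" "ball (t, s) e \<inter> ({0..1} \<times> {0..1}) \<subseteq> N"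
      using N(1,2) by (meson openin_contains_ball)
    have "L a b c d" if *: "near t (e / 2) a b" "near s (e / 2) c d" for a b c d
    proof -
      have "{a..b} \<times> {c..d} \<subseteq> ball (t, s) e \<inter> ({0..1} \<times> {0..1})"
      proof clarify
        fix x y assume xy: "x \<in> {a..b}" "y \<in> {c..d}"
        have "dist (t, s) (x, y) = sqrt (\<bar>t - x\<bar>\<^sup>2 + \<bar>s - y\<bar>\<^sup>2)"
          by (simp add: dist_Pair_Pair dist_real_def)
        also have "\<dots> \<le> \<bar>t - x\<bar> + \<bar>s - y\<bar>" by (rule sqrt_sum_squares_le_sum) auto
        also have "\<bar>t - x\<bar> < e / 2" using *(1) xy(1) unfolding near_def atLeastAtMost_iff by linarith
        also have "\<bar>s - y\<bar> < e / 2" using *(2) xy(2) unfolding near_def atLeastAtMost_iff by linarith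
        finally show "(x, y) \<in> ball (t, s) e \<inter> ({0..1} \<times> {0..1})"
          using * xy by (auto simp: near_def)
      qed
      then show ?thesis unfolding L_def using N(3) e(2) by blast
    qed
    then show ?thesis using e(1) by (intro exI[of _ "e / 2"]) auto
  qed
  have glue1: "L a c x y" if "L a b x y" "L b c x y" "a \<le> b" "b \<le> c" "x \<le> y" for a b c x y
  proof -
    have i: "({a..b} \<times> {x..y}) \<inter> ({b..c} \<times> {x..y}) = {b} \<times> {x..y}" using that by auto
    have "lifts_on E \<pi> H (({a..b} \<times> {x..y}) \<union> ({b..c} \<times> {x..y}))"
    proof (rule lifts_on_Un[OF cov])
      show "(b, x) \<in> ({a..b} \<times> {x..y}) \<inter> ({b..c} \<times> {x..y})" using that by auto
      show "connected (({a..b} \<times> {x..y}) \<inter> ({b..c} \<times> {x..y}))" unfolding i by (intro connected_Times) auto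
    qed (use that in \<open>auto simp: L_def intro: closed_Times\<close>)
    moreover have "({a..b} \<times> {x..y}) \<union> ({b..c} \<times> {x..y}) = {a..c} \<times> {x..y}" using that by auto
    ultimately show ?thesis by (simp add: L_def)
  qed
  have glue2: "L x y a c" if "L x y a b" "L x y b c" "a \<le> b" "b \<le> c" "x \<le> y" for a b c x y
  proof -
    have i: "({x..y} \<times> {a..b}) \<inter> ({x..y} \<times> {b..c}) = {x..y} \<times> {b}" using that by auto
    have "lifts_on E \<pi> H (({x..y} \<times> {a..b}) \<union> ({x..y} \<times> {b..c}))"
    proof (rule lifts_on_Un[OF cov])
      show "(x, b) \<in> ({x..y} \<times> {a..b}) \<inter> ({x..y} \<times> {b..c})" using that by auto
      show "connected (({x..y} \<times> {a..b}) \<inter> ({x..y} \<times> {b..c}))" unfolding i by (intro connected_Times) auto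
    qed (use that in \<open>auto simp: L_def intro: closed_Times\<close>)
    moreover have "({x..y} \<times> {a..b}) \<union> ({x..y} \<times> {b..c}) = {x..y} \<times> {a..c}" using that by auto
    ultimately show ?thesis by (simp add: L_def)
  qed
  have strip: "\<exists>\<delta>>0. \<forall>c d. near s \<delta> c d \<longrightarrow> L 0 1 c d" if s: "s \<in> {0..1}" for s
  proof -
    \<comment> \<open>The width of the strip may depend on the interval, since gluing two intervals
      costs passing to the smaller width.\<close>
    define P where "P = (\<lambda>a b. 0 \<le> a \<and> b \<le> 1 \<longrightarrow> (\<exists>\<delta>>0. \<forall>c d. near s \<delta> c d \<longrightarrow> L a b c d))"
    have "P 0 1"
    proof (rule Bolzano[where P = P])
      fix a b c assume abc: "P a b" "P b c" "a \<le> b" "b \<le> c"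
      show "P a c"
        unfolding P_def
      proof
        assume ac: "0 \<le> a \<and> c \<le> 1"
        obtain \<delta> where \<delta>: "\<delta> > 0" "\<And>x y. near s \<delta> x y \<Longrightarrow> L a b x y"
          using abc(1,3,4) ac unfolding P_def by (meson order_trans)
        obtain \<epsilon> where \<epsilon>: "\<epsilon> > 0" "\<And>x y. near s \<epsilon> x y \<Longrightarrow> L b c x y"
          using abc(2,3,4) ac unfolding P_def by (meson order_trans)
        have "L a c x y" if "near s (min \<delta> \<epsilon>) x y" for x y
          by (rule glue1[OF \<delta>(2) \<epsilon>(2) abc(3,4)]) (use that in \<open>auto simp: near_def\<close>)
        then show "\<exists>\<delta>>0. \<forall>x y. near s \<delta> x y \<longrightarrow> L a c x y"
          using \<delta>(1) \<epsilon>(1) by (intro exI[of _ "min \<delta> \<epsilon>"]) auto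
      qed
    next
      fix t :: real assume t: "0 \<le> t" "t \<le> 1"
      then obtain \<delta> where \<delta>: "\<delta> > 0" "\<And>a b c d. near t \<delta> a b \<Longrightarrow> near s \<delta> c d \<Longrightarrow> L a b c d"
        using loc[of t s] s by (metis atLeastAtMost_iff)
      have "P a b" if "a \<le> t \<and> t \<le> b \<and> b - a < \<delta>" for a b
        unfolding P_def
      proof
        assume "0 \<le> a \<and> b \<le> 1"
        then have "near t \<delta> a b" using that by (simp add: near_def)
        then show "\<exists>\<delta>>0. \<forall>c d. near s \<delta> c d \<longrightarrow> L a b c d" using \<delta> by blast
      qed
      then show "\<exists>d>0. \<forall>a b. a \<le> t \<and> t \<le> b \<and> b - a < d \<longrightarrow> P a b" using \<delta>(1) by blast
    qed simp
    then show ?thesis by (simp add: P_def)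
  qed
  define P where "P = (\<lambda>c d. 0 \<le> c \<and> d \<le> 1 \<longrightarrow> L 0 1 c d)"
  have "P 0 1"
  proof (rule Bolzano[where P = P])
    fix a b c assume abc: "P a b" "P b c" "a \<le> b" "b \<le> c"
    show "P a c"
      unfolding P_def
    proof
      assume ac: "0 \<le> a \<and> c \<le> 1"
      then have "L 0 1 a b" "L 0 1 b c" using abc by (simp_all add: P_def)
      then show "L 0 1 a c" using glue2 abc(3,4) zero_le_one by blast
    qed
  next
    fix s :: real assume s: "0 \<le> s" "s \<le> 1"
    then obtain \<delta> where \<delta>: "\<delta> > 0" "\<And>c d. near s \<delta> c d \<Longrightarrow> L 0 1 c d"
      using strip[of s] by (metis atLeastAtMost_iff)
    have "P a b" if "a \<le> s \<and> s \<le> b \<and> b - a < \<delta>" for a b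
      unfolding P_def using that \<delta>(2) by (simp add: near_def)
    then show "\<exists>d>0. \<forall>a b. a \<le> s \<and> s \<le> b \<and> b - a < d \<longrightarrow> P a b" using \<delta>(1) by blast
  qed simp
  then show ?thesis by (simp add: P_def L_def)
qed

text \<open>A path is a map on the square that ignores the second coordinate.\<close>

lemma covering_path_lifting:
  assumes cov: "covering_space E \<pi> S" and g: "path g" "path_image g \<subseteq> S" and a: "a \<in> E" "\<pi> a = pathstart g"
  obtains h where "path h" "path_image h \<subseteq> E" "pathstart h = a" "\<And>t. t \<in> {0..1} \<Longrightarrow> \<pi> (h t) = g t"
proof -
  have "lifts_on E \<pi> (\<lambda>z. g (fst z)) ({0..1} \<times> {0..1::real})"
  proof (rule lifts_on_unit_square[OF cov])
    show "continuous_on ({0..1} \<times> {0..1::real}) (\<lambda>z. g (fst z))"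
      by (rule continuous_on_compose2[OF g(1)[unfolded path_def]]) (auto intro!: continuous_intros)
    show "(\<lambda>z. g (fst z)) \<in> {0..1} \<times> {0..1::real} \<rightarrow> S" using g(2) by (auto simp: path_image_def)
  qed
  then obtain l where l: "continuous_on ({0..1} \<times> {0..1::real}) l" "l \<in> {0..1} \<times> {0..1} \<rightarrow> E"
    "\<And>z. z \<in> {0..1} \<times> {0..1} \<Longrightarrow> \<pi> (l z) = g (fst z)" "l (0, 0) = a"
    using a unfolding lifts_on_def pathstart_def by (metis (no_types, lifting) SigmaI atLeastAtMost_iff fst_conv order_refl zero_le_one)
  show ?thesis
  proof (rule that[of "\<lambda>t. l (t, 0)"])
    show "path (\<lambda>t. l (t, 0))"
      unfolding path_def by (rule continuous_on_compose2[OF l(1)]) (auto intro!: continuous_intros)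
    show "path_image (\<lambda>t. l (t, 0)) \<subseteq> E" using l(2) by (auto simp: path_image_def)
    show "pathstart (\<lambda>t. l (t, 0)) = a" by (simp add: pathstart_def l)
    show "\<pi> (l (t, 0)) = g t" if "t \<in> {0..1}" for t using l(3)[of "(t, 0)"] that by simp
  qed
qed

lemma covering_paths_unique:
  assumes cov: "covering_space E \<pi> S" and p: "path p" "path_image p \<subseteq> E" and q: "path q" "path_image q \<subseteq> E"
    and eq: "\<And>t. t \<in> {0..1} \<Longrightarrow> \<pi> (p t) = \<pi> (q t)" and s: "pathstart p = pathstart q"
  shows "pathfinish p = pathfinish q"
  unfolding pathfinish_def
  by (rule covering_lift_unique[OF cov, of "{0..1}" 0])
    (use p q s eq in \<open>auto simp: path_def path_image_def pathstart_def\<close>)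

text \<open>The homotopy lifts to the square. By uniqueness two opposite sides of the lift are
  constant and the other two are \<open>p\<close> and \<open>q\<close>.\<close>

lemma covering_monodromy:
  assumes cov: "covering_space E \<pi> S" and p: "path p" "path_image p \<subseteq> E" and q: "path q" "path_image q \<subseteq> E"
    and hom: "homotopic_paths S (\<pi> \<circ> p) (\<pi> \<circ> q)" and s: "pathstart p = pathstart q"
  shows "pathfinish p = pathfinish q"
proof -
  obtain H :: "real \<times> real \<Rightarrow> _" where H: "continuous_on ({0..1} \<times> {0..1}) H" "H \<in> {0..1} \<times> {0..1} \<rightarrow> S"
    "\<And>x. x \<in> {0..1} \<Longrightarrow> H (0, x) = \<pi> (p x)" "\<And>x. x \<in> {0..1} \<Longrightarrow> H (1, x) = \<pi> (q x)"
    "\<And>t. t \<in> {0..1} \<Longrightarrow> H (t, 0) = \<pi> (p 0)" "\<And>t. t \<in> {0..1} \<Longrightarrow> H (t, 1) = \<pi> (p 1)"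
  proof -
    obtain H :: "real \<times> real \<Rightarrow> _" where "continuous_on ({0..1} \<times> {0..1}) H \<and> H \<in> {0..1} \<times> {0..1} \<rightarrow> S \<and>
      (\<forall>x\<in>{0..1}. H (0, x) = (\<pi> \<circ> p) x) \<and> (\<forall>x\<in>{0..1}. H (1, x) = (\<pi> \<circ> q) x) \<and>
      (\<forall>t\<in>{0..1}. pathstart (H \<circ> Pair t) = pathstart (\<pi> \<circ> p) \<and> pathfinish (H \<circ> Pair t) = pathfinish (\<pi> \<circ> p))"
      using hom unfolding homotopic_paths by blast
    then show ?thesis by (intro that[of H]) (simp_all add: pathstart_def pathfinish_def)
  qed
  have "p 0 \<in> E" using p(2) by (auto simp: path_image_def)
  then obtain l where l: "continuous_on ({0..1} \<times> {0..1}) l" "l \<in> {0..1} \<times> {0..1} \<rightarrow> E"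
    "\<And>z. z \<in> {0..1} \<times> {0..1} \<Longrightarrow> \<pi> (l z) = H z" "l (0, 0) = p 0"
    using lifts_on_unit_square[OF cov H(1,2)] H(3)[of 0] unfolding lifts_on_def
    by (metis (no_types, lifting) SigmaI atLeastAtMost_iff order_refl zero_le_one)
  have row: "continuous_on {0..1} (\<lambda>x. l (t, x))" "(\<lambda>x. l (t, x)) \<in> {0..1} \<rightarrow> E" if "t \<in> {0..1}" for t
    using that l(2) by (auto intro!: continuous_on_compose2[OF l(1)] continuous_intros)
  have col: "continuous_on {0..1} (\<lambda>t. l (t, x))" "(\<lambda>t. l (t, x)) \<in> {0..1} \<rightarrow> E" if "x \<in> {0..1}" for x
    using that l(2) by (auto intro!: continuous_on_compose2[OF l(1)] continuous_intros)
  have pq: "continuous_on {0..1} p" "p \<in> {0..1} \<rightarrow> E" "continuous_on {0..1} q" "q \<in> {0..1} \<rightarrow> E"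
    using p q by (auto simp: path_def path_image_def)
  have con: "connected {0..1::real}" by simp
  have "l (1, 0) = p 0"
    by (rule covering_lift_unique[OF cov con, where f = "\<lambda>t. l (t, 0)" and g = "\<lambda>t. p 0" and a = 0])
      (use col l H \<open>p 0 \<in> E\<close> in auto)
  have "l (0, 1) = p 1"
    by (rule covering_lift_unique[OF cov con, where f = "\<lambda>x. l (0, x)" and g = p and a = 0])
      (use row l H pq in auto)
  have "l (1, 1) = q 1"
    by (rule covering_lift_unique[OF cov con, where f = "\<lambda>x. l (1, x)" and g = q and a = 0])
      (use row l H pq s \<open>l (1, 0) = p 0\<close> in \<open>auto simp: pathstart_def\<close>)
  have "p 1 \<in> E" using pq by auto
  have "l (1, 1) = l (0, 1)"
    by (rule covering_lift_unique[OF cov con, where f = "\<lambda>t. l (t, 1)" and g = "\<lambda>t. l (0, 1)" and a = 0])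
      (use col l H \<open>p 1 \<in> E\<close> \<open>l (0, 1) = p 1\<close> in auto)
  then show ?thesis using \<open>l (0, 1) = p 1\<close> \<open>l (1, 1) = q 1\<close> by (simp add: pathfinish_def)
qed


section \<open>Path classes and simple connectedness\<close>

lemma path_class_eq_iff:
  assumes "path p" "path_image p \<subseteq> S"
  shows "path_class S p = path_class S q \<longleftrightarrow> homotopic_paths S p q"
proof
  assume "path_class S p = path_class S q"
  moreover have "p \<in> path_class S p" using assms by (simp add: path_class_def)
  ultimately show "homotopic_paths S p q" by (simp add: path_class_def homotopic_paths_sym)
next
  assume "homotopic_paths S p q"
  then show "path_class S p = path_class S q"
    unfolding path_class_def
    by (intro Collect_cong iffI) (blast intro: homotopic_paths_trans homotopic_paths_sym)+
qed

lemma fundamental_group_carrierI: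
  assumes "path p" "path_image p \<subseteq> S" "pathstart p = x" "pathfinish p = x"
  shows "path_class S p \<in> carrier (fundamental_group S x)"
  using assms by (auto simp: fundamental_group_def loops_at_def)

text \<open>Concatenation respects homotopy, so the union over representatives that defines the
  product is a union of copies of one class.\<close>

lemma fundamental_group_mult:
  assumes p: "path p" "path_image p \<subseteq> S" "pathfinish p = x" and q: "path q" "path_image q \<subseteq> S" "pathstart q = x"
  shows "path_class S p \<otimes>\<^bsub>fundamental_group S x\<^esub> path_class S q = path_class S (p +++ q)"
proof -
  have "path_class S (p' +++ q') = path_class S (p +++ q)" if "p' \<in> path_class S p" "q' \<in> path_class S q" for p' q'
  proof -
    have "homotopic_paths S (p +++ q) (p' +++ q')"
      using that p q by (intro homotopic_paths_join) (auto simp: path_class_def)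
    then show ?thesis
      using p q by (subst eq_commute, subst path_class_eq_iff) (auto simp: subset_path_image_join)
  qed
  moreover have "p \<in> path_class S p" "q \<in> path_class S q" using p q by (simp_all add: path_class_def)
  ultimately have "(\<Union>p'\<in>path_class S p. \<Union>q'\<in>path_class S q. path_class S (p' +++ q')) = path_class S (p +++ q)"
    by blast
  then show ?thesis by (simp add: fundamental_group_def)
qed

text \<open>Two constant loops are freely homotopic, and the track of one point under such a
  homotopy is a path between them.\<close>

lemma simply_connected_path_connected:
  assumes "simply_connected E"
  shows "path_connected E"
  unfolding path_connected_def
proof (intro ballI)
  fix y z assume yz: "y \<in> E" "z \<in> E"
  have "homotopic_loops E (\<lambda>_. y) (\<lambda>_. z)"
    by (rule assms[unfolded simply_connected_def, rule_format])
      (use yz in \<open>auto simp: path_def pathfinish_def pathstart_def path_image_def\<close>)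
  then obtain h :: "real \<times> real \<Rightarrow> 'a" where h: "continuous_on ({0..1} \<times> {0..1}) h" "h \<in> {0..1} \<times> {0..1} \<rightarrow> E"
    "\<forall>x\<in>{0..1}. h (0, x) = y" "\<forall>x\<in>{0..1}. h (1, x) = z"
    unfolding homotopic_loops by blast
  show "\<exists>g. path g \<and> path_image g \<subseteq> E \<and> pathstart g = y \<and> pathfinish g = z"
  proof (intro exI conjI)
    show "path (\<lambda>t. h (t, 0))"
      unfolding path_def by (rule continuous_on_compose2[OF h(1)]) (auto intro!: continuous_intros)
  qed (use h in \<open>auto simp: path_image_def pathstart_def pathfinish_def\<close>)
qed

lemma homotopic_paths_through_convex:
  fixes D :: "'c::real_normed_vector set"
  assumes "convex D" "continuous_on D H" "H \<in> D \<rightarrow> E"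
    and "path p" "path_image p \<subseteq> D" "path q" "path_image q \<subseteq> D" "pathstart p = pathstart q" "pathfinish p = pathfinish q"
  shows "homotopic_paths E (H \<circ> p) (H \<circ> q)"
proof (rule homotopic_paths_continuous_image[OF _ assms(2,3)])
  show "homotopic_paths D p q"
    using convex_imp_simply_connected[OF assms(1)] assms(4-) by (simp add: simply_connected_eq_homotopic_paths)
qed

text \<open>A free null homotopy of the loop going along \<open>p\<close> and back along \<open>q\<close> is a map on the unit square with
  \<open>p\<close> on one half of a side. That half is homotopic in the square to the path around the rest of the
  boundary, whose image runs along a path \<open>\<alpha>\<close>, back along \<open>\<alpha>\<close>, and then along \<open>q\<close>.\<close>

lemma simply_connected_homotopic_paths:
  assumes sc: "simply_connected E" and p: "path p" "path_image p \<subseteq> E" and q: "path q" "path_image q \<subseteq> E"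
    and ends: "pathstart p = pathstart q" "pathfinish p = pathfinish q"
  shows "homotopic_paths E p q"
proof -
  define f where "f = p +++ reversepath q"
  define a where "a = pathstart p"
  have a: "a \<in> E" using p(2) by (auto simp: a_def)
  have "homotopic_loops E f (\<lambda>_. a)"
  proof (rule sc[unfolded simply_connected_def, rule_format], intro conjI)
    show "path f" "path_image f \<subseteq> E" "pathfinish f = pathstart f"
      using p q ends by (auto simp: f_def subset_path_image_join)
  qed (use a in \<open>auto simp: path_def pathfinish_def pathstart_def path_image_def\<close>)
  then obtain h :: "real \<times> real \<Rightarrow> 'a" where h: "continuous_on ({0..1} \<times> {0..1}) h" "h \<in> {0..1} \<times> {0..1} \<rightarrow> E"
    "\<forall>x\<in>{0..1}. h (0, x) = f x" "\<forall>x\<in>{0..1}. h (1, x) = a"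
    "\<forall>t\<in>{0..1}. pathfinish (h \<circ> Pair t) = pathstart (h \<circ> Pair t)"
    unfolding homotopic_loops by blast
  have per: "h (t, 1) = h (t, 0)" if "t \<in> {0..1}" for t
    using h(5) that by (simp add: pathfinish_def pathstart_def)
  \<comment> \<open>Negative arguments run along the track of the base point of the loop under the
    homotopy, positive ones along \<open>q\<close>; the two meet at 0.\<close>
  define F where "F = (\<lambda>u::real. if u \<le> 0 then h (- u, 0) else q u)"
  have q0: "q 0 = h (0, 0)"
    using h(3) ends by (simp add: f_def joinpaths_def pathstart_def)
  have F: "continuous_on {-1..1} F"
  proof -
    have "continuous_on ({-1..0} \<union> {0..1}) F"
      unfolding F_def
    proof (rule continuous_on_cases)
      show "continuous_on {-1..0} (\<lambda>u. h (- u, 0))"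
        by (rule continuous_on_compose2[OF h(1)]) (auto intro!: continuous_intros)
      show "continuous_on {0..1} q" using q(1) by (simp add: path_def)
      show "\<forall>x. x \<in> {-1..0} \<and> \<not> x \<le> 0 \<or> x \<in> {0..1} \<and> x \<le> 0 \<longrightarrow> h (- x, 0) = q x"
        using q0 by force
    qed auto
    moreover have "{-1..0} \<union> {0..1} = {-1..1::real}" by auto
    ultimately show ?thesis by simp
  qed
  have FE: "F \<in> {-1..1} \<rightarrow> E"
  proof
    fix u :: real assume u: "u \<in> {-1..1}"
    show "F u \<in> E"
    proof (cases "u \<le> 0")
      case True
      then show ?thesis using u h(2) Pi_mem[of h "{0..1} \<times> {0..1}" "\<lambda>_. E" "(- u, 0)"] by (simp add: F_def)
    next
      case False
      then have "q u \<in> path_image q" using u by (simp add: path_image_def)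
      then show ?thesis using False q(2) by (auto simp: F_def)
    qed
  qed
  \<comment> \<open>The detour around the square: along the track, the constant side and the track
    backwards, then back along the upper half of the initial side, where \<open>f\<close> reversed
    is \<open>q\<close>.\<close>
  define r where "r = linepath (0, 0) (1, 0) +++ (linepath (1, 0) (1, 1) +++
    (linepath (1, 1) (0, 1) +++ linepath (0, 1) (0::real, 1 / 2 :: real)))"
  \<comment> \<open>\<open>F \<circ> c\<close> is the same path as \<open>h \<circ> r\<close>, but
    \<open>c\<close> lives in an interval, where it is homotopic to the stretch from 0 to 1, the one
    that carries \<open>q\<close>.\<close>
  define c where "c = linepath 0 (-1) +++ (linepath (-1) (-1) +++ (linepath (-1) 0 +++ linepath 0 (1::real)))"
  have cvx: "convex ({0..1::real} \<times> {0..1::real})" by (intro convex_Times) auto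
  have seg: "path_image (linepath x y) \<subseteq> {0..1} \<times> {0..1}"
    if "x \<in> {0..1::real} \<times> {0..1::real}" "y \<in> {0..1::real} \<times> {0..1::real}" for x y
    unfolding path_image_linepath by (rule closed_segment_subset[OF that cvx])
  have segc: "path_image (linepath x y) \<subseteq> {-1..1}" if "x \<in> {-1..1}" "y \<in> {-1..1::real}" for x y
    unfolding path_image_linepath by (rule closed_segment_subset[OF that]) simp
  have "homotopic_paths E (h \<circ> linepath (0, 0) (0, 1 / 2)) (h \<circ> r)"
  proof (rule homotopic_paths_through_convex[OF cvx h(1,2)])
    show "path_image (linepath (0, 0) (0, 1 / 2)) \<subseteq> {0..1::real} \<times> {0..1::real}" by (rule seg) simp_all
    show "path_image r \<subseteq> {0..1} \<times> {0..1}"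
      unfolding r_def by (intro subset_path_image_join seg) simp_all
  qed (simp_all add: r_def)
  moreover have "homotopic_paths E p (h \<circ> linepath (0, 0) (0, 1 / 2))"
  proof (rule homotopic_paths_eq[OF p])
    fix t :: real assume "t \<in> {0..1}"
    then show "p t = (h \<circ> linepath (0, 0) (0, 1 / 2)) t"
      using h(3) by (auto simp: linepath_def f_def joinpaths_def)
  qed
  moreover have "homotopic_paths E (h \<circ> r) (F \<circ> c)"
  proof (rule homotopic_paths_eq)
    show "path (h \<circ> r)" "path_image (h \<circ> r) \<subseteq> E"
      using calculation(1) homotopic_paths_imp_path homotopic_paths_imp_subset by blast+
    fix t :: real assume t: "t \<in> {0..1}"
    \<comment> \<open>The break points are those of the nested joins in \<open>r\<close> and
      \<open>c\<close>.\<close>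
    consider "t \<le> 1 / 2" | "1 / 2 < t" "t \<le> 3 / 4" | "3 / 4 < t" "t \<le> 7 / 8" | "7 / 8 < t" by linarith
    then show "(h \<circ> r) t = (F \<circ> c) t"
    proof cases
      case 1
      then show ?thesis using t by (simp add: r_def c_def joinpaths_def linepath_def F_def)
    next
      case 2
      then have "(h \<circ> r) t = h (1, 2 * (2 * t - 1))"
        by (simp add: r_def joinpaths_def linepath_def)
      also have "\<dots> = h (1, 0)" using h(4) 2 by simp
      also have "\<dots> = (F \<circ> c) t" using 2 by (simp add: c_def joinpaths_def linepath_def F_def)
      finally show ?thesis .
    next
      case 3
      define u where "u = 2 * (2 * (2 * t - 1) - 1)"
      have u: "0 \<le> u" "u \<le> 1" using 3 by (auto simp: u_def)
      have "(h \<circ> r) t = h (1 - u, 1)"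
        using 3 by (simp add: r_def joinpaths_def linepath_def u_def)
      also have "\<dots> = h (1 - u, 0)" using per u by simp
      also have "\<dots> = F (u - 1)" using u by (simp add: F_def)
      also have "\<dots> = (F \<circ> c) t" using 3 by (simp add: c_def joinpaths_def linepath_def u_def)
      finally show ?thesis .
    next
      case 4
      define u where "u = 2 * (2 * (2 * t - 1) - 1) - 1"
      have u: "0 < u" "u \<le> 1" using 4 t by (auto simp: u_def)
      have "(h \<circ> r) t = h (0, 1 - u / 2)"
        using 4 by (simp add: r_def joinpaths_def linepath_def u_def field_simps)
      also have "\<dots> = f (1 - u / 2)" using h(3) u by simp
      also have "\<dots> = q u"
        using u ends by (auto simp: f_def joinpaths_def reversepath_def pathfinish_def)
      also have "\<dots> = F u" using u by (simp add: F_def)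
      also have "\<dots> = (F \<circ> c) t" using 4 by (simp add: c_def joinpaths_def linepath_def u_def)
      finally show ?thesis .
    qed
  qed
  moreover have "homotopic_paths E (F \<circ> c) (F \<circ> linepath 0 1)"
  proof (rule homotopic_paths_through_convex[OF _ F FE])
    show "path_image (linepath 0 1) \<subseteq> {-1..1::real}" by (rule segc) simp_all
    show "path_image c \<subseteq> {-1..1}"
      unfolding c_def by (intro subset_path_image_join segc) simp_all
  qed (simp_all add: c_def)
  moreover have "homotopic_paths E q (F \<circ> linepath 0 1)"
  proof (rule homotopic_paths_eq[OF q])
    fix t :: real assume "t \<in> {0..1}"
    then show "q t = (F \<circ> linepath 0 1) t"
      using q0 by (auto simp: linepath_def F_def)
  qed
  ultimately show ?thesis by (metis homotopic_paths_trans homotopic_paths_sym)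
qed

section \<open>Deck transformations\<close>

text \<open>Holonomy only asserts that some deck transformation exists for each class;
  \<open>T\<close> fixes a choice. It turns out to be an action of the fundamental group that is
  free and transitive on fibres.\<close>

locale deck_action =
  fixes S :: "'s::topological_space set" and E :: "'e::topological_space set" and \<pi> :: "'e \<Rightarrow> 's" and e :: 'e
    and T :: "(real \<Rightarrow> 's) set \<Rightarrow> 'e \<Rightarrow> 'e"
  assumes cov: "covering_space E \<pi> S" and sc: "simply_connected E" and e: "e \<in> E"
    and T: "\<And>\<gamma>. \<gamma> \<in> carrier (fundamental_group S (\<pi> e)) \<Longrightarrow> deck_transformation_of E \<pi> e \<gamma> (T \<gamma>)"
begin

abbreviation "\<Gamma> \<equiv> fundamental_group S (\<pi> e)"

lemma \<pi>_cont: "continuous_on E \<pi>" using cov by (rule covering_space_imp_continuous)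
lemma \<pi>_S: "y \<in> E \<Longrightarrow> \<pi> y \<in> S" using cov covering_space_imp_surjective by blast

lemma path_image_\<pi>:
  assumes "path q" "path_image q \<subseteq> E"
  shows "path (\<pi> \<circ> q)" "path_image (\<pi> \<circ> q) \<subseteq> S"
proof -
  show "path (\<pi> \<circ> q)" by (rule path_continuous_image[OF assms(1) continuous_on_subset[OF \<pi>_cont assms(2)]])
  show "path_image (\<pi> \<circ> q) \<subseteq> S" using assms(2) \<pi>_S by (auto simp: path_image_compose)
qed

lemma deck_homeomorphism:
  assumes "\<gamma> \<in> carrier \<Gamma>"
  obtains T' where "homeomorphism E E (T \<gamma>) T'"
  using T[OF assms] unfolding deck_transformation_of_def by blast

lemma deck_\<pi>: "\<gamma> \<in> carrier \<Gamma> \<Longrightarrow> y \<in> E \<Longrightarrow> \<pi> (T \<gamma> y) = \<pi> y"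
  using T unfolding deck_transformation_of_def by blast

lemma deck_in: "\<gamma> \<in> carrier \<Gamma> \<Longrightarrow> y \<in> E \<Longrightarrow> T \<gamma> y \<in> E"
  using deck_homeomorphism by (metis homeomorphism_image1 imageI)

lemma deck_cont: "\<gamma> \<in> carrier \<Gamma> \<Longrightarrow> continuous_on E (T \<gamma>)"
  using deck_homeomorphism homeomorphism_cont1 by metis

lemma deck_path:
  assumes "\<gamma> \<in> carrier \<Gamma>"
  obtains q where "path q" "path_image q \<subseteq> E" "pathstart q = e" "pathfinish q = T \<gamma> e" "\<gamma> = path_class S (\<pi> \<circ> q)"
proof -
  obtain q where q: "path q" "path_image q \<subseteq> E" "pathstart q = e" "pathfinish q = T \<gamma> e" "\<pi> \<circ> q \<in> \<gamma>"
    using T[OF assms] unfolding deck_transformation_of_def by blast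
  obtain p where p: "p \<in> loops_at S (\<pi> e)" "\<gamma> = path_class S p"
    using assms by (auto simp: fundamental_group_def)
  then have "homotopic_paths S p (\<pi> \<circ> q)" using q(5) by (simp add: path_class_def)
  then have "\<gamma> = path_class S (\<pi> \<circ> q)"
    using p path_class_eq_iff[of p S "\<pi> \<circ> q"] by (simp add: loops_at_def)
  then show ?thesis using that q by blast
qed

lemma E_connected: "path_connected E" "connected E"
  using simply_connected_path_connected[OF sc] by (simp_all add: path_connected_imp_connected)

lemma path_image_deck:
  assumes "\<gamma> \<in> carrier \<Gamma>" "path q" "path_image q \<subseteq> E"
  shows "path (T \<gamma> \<circ> q)" "path_image (T \<gamma> \<circ> q) \<subseteq> E"
proof -
  show "path (T \<gamma> \<circ> q)"
    by (rule path_continuous_image[OF assms(2) continuous_on_subset[OF deck_cont[OF assms(1)] assms(3)]])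
  show "path_image (T \<gamma> \<circ> q) \<subseteq> E" using assms(3) deck_in[OF assms(1)] by (auto simp: path_image_compose)
qed

lemma E_homotopic:
  assumes "path p" "path_image p \<subseteq> E" "path q" "path_image q \<subseteq> E" "pathstart p = pathstart q" "pathfinish p = pathfinish q"
  shows "homotopic_paths S (\<pi> \<circ> p) (\<pi> \<circ> q)"
proof (rule homotopic_paths_continuous_image)
  show "homotopic_paths E p q" using sc assms by (rule simply_connected_homotopic_paths)
  show "continuous_on E \<pi>" by (rule \<pi>_cont)
  show "\<pi> \<in> E \<rightarrow> S" using \<pi>_S by blast
qed

lemma deck_eqI:
  assumes f: "continuous_on E f" "f \<in> E \<rightarrow> E" and g: "continuous_on E g" "g \<in> E \<rightarrow> E"
    and fg: "\<And>y. y \<in> E \<Longrightarrow> \<pi> (f y) = \<pi> (g y)" and y: "y \<in> E" "f y = g y" and "z \<in> E"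
  shows "f z = g z"
  by (rule covering_lift_unique[OF cov E_connected(2) y(1) f g fg y(2) \<open>z \<in> E\<close>])

text \<open>Deck transformations that agree at one point agree at \<open>e\<close>. The paths from
  \<open>e\<close> that define the two classes then have the same end, hence are homotopic in
  \<open>E\<close>, and so are their projections.\<close>

lemma deck_inj:
  assumes \<gamma>: "\<gamma> \<in> carrier \<Gamma>" and \<delta>: "\<delta> \<in> carrier \<Gamma>" and y: "y \<in> E" "T \<gamma> y = T \<delta> y"
  shows "\<gamma> = \<delta>"
proof -
  have eq: "T \<gamma> e = T \<delta> e"
    by (rule deck_eqI[OF deck_cont[OF \<gamma>] _ deck_cont[OF \<delta>] _ _ y e])
      (use deck_in deck_\<pi> \<gamma> \<delta> in auto)
  obtain p where p: "path p" "path_image p \<subseteq> E" "pathstart p = e" "pathfinish p = T \<gamma> e" "\<gamma> = path_class S (\<pi> \<circ> p)"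
    by (rule deck_path[OF \<gamma>])
  obtain q where q: "path q" "path_image q \<subseteq> E" "pathstart q = e" "pathfinish q = T \<delta> e" "\<delta> = path_class S (\<pi> \<circ> q)"
    by (rule deck_path[OF \<delta>])
  have "homotopic_paths S (\<pi> \<circ> p) (\<pi> \<circ> q)" using p q eq by (intro E_homotopic) auto
  then show ?thesis using path_class_eq_iff[OF path_image_\<pi>[OF p(1,2)], of "\<pi> \<circ> q"] p(5) q(5) by simp
qed

text \<open>The path \<open>p\<close> followed by the translate \<open>T \<gamma> \<circ> q\<close>
  ends at \<open>T \<gamma> (T \<delta> e)\<close> and projects to the product loop, so monodromy
  gives the equation at \<open>e\<close>; uniqueness of lifts spreads it over
  \<open>E\<close>.\<close>

lemma deck_mult:
  assumes \<gamma>: "\<gamma> \<in> carrier \<Gamma>" and \<delta>: "\<delta> \<in> carrier \<Gamma>"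
  shows mult_in: "\<gamma> \<otimes>\<^bsub>\<Gamma>\<^esub> \<delta> \<in> carrier \<Gamma>" and "y \<in> E \<Longrightarrow> T (\<gamma> \<otimes>\<^bsub>\<Gamma>\<^esub> \<delta>) y = T \<gamma> (T \<delta> y)"
proof -
  obtain p where p: "path p" "path_image p \<subseteq> E" "pathstart p = e" "pathfinish p = T \<gamma> e" "\<gamma> = path_class S (\<pi> \<circ> p)"
    by (rule deck_path[OF \<gamma>])
  obtain q where q: "path q" "path_image q \<subseteq> E" "pathstart q = e" "pathfinish q = T \<delta> e" "\<delta> = path_class S (\<pi> \<circ> q)"
    by (rule deck_path[OF \<delta>])
  note \<pi>p = path_image_\<pi>[OF p(1,2)] and \<pi>q = path_image_\<pi>[OF q(1,2)]
  have ends: "pathstart (\<pi> \<circ> p) = \<pi> e" "pathfinish (\<pi> \<circ> p) = \<pi> e" "pathstart (\<pi> \<circ> q) = \<pi> e" "pathfinish (\<pi> \<circ> q) = \<pi> e"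
    using p q e deck_\<pi> \<gamma> \<delta> by (simp_all add: pathstart_compose pathfinish_compose)
  have m: "\<gamma> \<otimes>\<^bsub>\<Gamma>\<^esub> \<delta> = path_class S ((\<pi> \<circ> p) +++ (\<pi> \<circ> q))"
    unfolding p(5) q(5) using \<pi>p \<pi>q ends by (intro fundamental_group_mult) auto
  then show in\<Gamma>: "\<gamma> \<otimes>\<^bsub>\<Gamma>\<^esub> \<delta> \<in> carrier \<Gamma>"
    using \<pi>p \<pi>q ends by (simp add: fundamental_group_carrierI subset_path_image_join)
  obtain r where r: "path r" "path_image r \<subseteq> E" "pathstart r = e" "pathfinish r = T (\<gamma> \<otimes>\<^bsub>\<Gamma>\<^esub> \<delta>) e"
    "\<gamma> \<otimes>\<^bsub>\<Gamma>\<^esub> \<delta> = path_class S (\<pi> \<circ> r)"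
    by (rule deck_path[OF in\<Gamma>])
  define s where "s = p +++ (T \<gamma> \<circ> q)"
  note Tq = path_image_deck[OF \<gamma> q(1,2)]
  have s: "path s" "path_image s \<subseteq> E" "pathstart s = e" "pathfinish s = T \<gamma> (T \<delta> e)"
    using p q Tq by (auto simp: s_def pathstart_compose pathfinish_compose subset_path_image_join)
  have "(\<pi> \<circ> s) t = ((\<pi> \<circ> p) +++ (\<pi> \<circ> q)) t" if "t \<in> {0..1}" for t
  proof -
    have "\<pi> (T \<gamma> (q (2 * t - 1))) = \<pi> (q (2 * t - 1))" if "t > 1 / 2"
      using that \<open>t \<in> {0..1}\<close> q(2) by (intro deck_\<pi>[OF \<gamma>]) (auto simp: path_image_def)
    then show ?thesis by (simp add: s_def joinpaths_def)
  qed
  then have "homotopic_paths S (\<pi> \<circ> s) ((\<pi> \<circ> p) +++ (\<pi> \<circ> q))"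
    using path_image_\<pi>[OF s(1,2)] by (intro homotopic_paths_eq) auto
  moreover have "homotopic_paths S (\<pi> \<circ> r) ((\<pi> \<circ> p) +++ (\<pi> \<circ> q))"
    using r(5) m path_class_eq_iff[OF path_image_\<pi>[OF r(1,2)], of "(\<pi> \<circ> p) +++ (\<pi> \<circ> q)"] by simp
  ultimately have "homotopic_paths S (\<pi> \<circ> r) (\<pi> \<circ> s)"
    by (metis homotopic_paths_sym homotopic_paths_trans)
  then have "pathfinish r = pathfinish s"
    using r s by (intro covering_monodromy[OF cov]) auto
  then have eq: "T (\<gamma> \<otimes>\<^bsub>\<Gamma>\<^esub> \<delta>) e = T \<gamma> (T \<delta> e)" using r s by simp
  show "T (\<gamma> \<otimes>\<^bsub>\<Gamma>\<^esub> \<delta>) y = T \<gamma> (T \<delta> y)" if "y \<in> E"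
  proof (rule deck_eqI[where f = "T (\<gamma> \<otimes>\<^bsub>\<Gamma>\<^esub> \<delta>)" and g = "\<lambda>y. T \<gamma> (T \<delta> y)" and y = e])
    show "continuous_on E (\<lambda>y. T \<gamma> (T \<delta> y))"
    proof (rule continuous_on_compose2[OF deck_cont[OF \<gamma>] deck_cont[OF \<delta>]])
      show "T \<delta> ` E \<subseteq> E" using deck_in[OF \<delta>] by blast
    qed
  qed (use deck_in deck_\<pi> \<gamma> \<delta> in\<Gamma> deck_cont eq e that in auto)
qed

text \<open>A path from \<open>e\<close> to \<open>y\<close> projects to a loop, and by monodromy
  the deck transformation of its class takes \<open>e\<close> to the same end.\<close>

lemma deck_trans_base:
  assumes "y \<in> E" "\<pi> y = \<pi> e"
  obtains \<gamma> where "\<gamma> \<in> carrier \<Gamma>" "T \<gamma> e = y"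
proof -
  obtain b where b: "path b" "path_image b \<subseteq> E" "pathstart b = e" "pathfinish b = y"
    using E_connected(1)[unfolded path_connected_def, rule_format, OF e assms(1)] by blast
  define \<gamma> where "\<gamma> = path_class S (\<pi> \<circ> b)"
  have \<gamma>: "\<gamma> \<in> carrier \<Gamma>"
    unfolding \<gamma>_def using path_image_\<pi>[OF b(1,2)] b(3,4) assms(2)
    by (intro fundamental_group_carrierI) (simp_all add: pathstart_compose pathfinish_compose)
  obtain q where q: "path q" "path_image q \<subseteq> E" "pathstart q = e" "pathfinish q = T \<gamma> e" "\<gamma> = path_class S (\<pi> \<circ> q)"
    by (rule deck_path[OF \<gamma>])
  have "homotopic_paths S (\<pi> \<circ> q) (\<pi> \<circ> b)"
    using q(5) path_class_eq_iff[OF path_image_\<pi>[OF q(1,2)], of "\<pi> \<circ> b"] by (simp add: \<gamma>_def)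
  then have "pathfinish q = pathfinish b" using q b by (intro covering_monodromy[OF cov]) auto
  then show ?thesis using that \<gamma> q b by simp
qed

text \<open>Reduced to the fibre of \<open>e\<close>: the projection of a path from \<open>e\<close>
  to \<open>y\<close> is lifted backwards from \<open>z\<close> and reaches a translate of
  \<open>e\<close>. The same translate of the original path must then end at
  \<open>z\<close>.\<close>

lemma deck_trans:
  assumes y: "y \<in> E" and z: "z \<in> E" and yz: "\<pi> y = \<pi> z"
  obtains \<gamma> where "\<gamma> \<in> carrier \<Gamma>" "T \<gamma> y = z"
proof -
  obtain a where a: "path a" "path_image a \<subseteq> E" "pathstart a = e" "pathfinish a = y"
    using E_connected(1)[unfolded path_connected_def, rule_format, OF e y] by blast
  note \<pi>a = path_image_\<pi>[OF a(1,2)]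
  have "\<pi> z = pathstart (reversepath (\<pi> \<circ> a))" using a yz by (simp add: pathfinish_compose)
  then obtain r where r: "path r" "path_image r \<subseteq> E" "pathstart r = z"
    "\<And>t. t \<in> {0..1} \<Longrightarrow> \<pi> (r t) = reversepath (\<pi> \<circ> a) t"
    using covering_path_lifting[OF cov, of "reversepath (\<pi> \<circ> a)" z] \<pi>a z by auto
  have "pathfinish r \<in> E" using r(2) by blast
  moreover have "\<pi> (pathfinish r) = \<pi> e"
    using r(4)[of 1] a(3) by (simp add: pathfinish_def reversepath_def pathstart_def)
  ultimately obtain \<gamma> where \<gamma>: "\<gamma> \<in> carrier \<Gamma>" "T \<gamma> e = pathfinish r" by (rule deck_trans_base)
  have "pathfinish (T \<gamma> \<circ> a) = pathfinish (reversepath r)"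
  proof (rule covering_paths_unique[OF cov])
    show "path (T \<gamma> \<circ> a)" "path_image (T \<gamma> \<circ> a) \<subseteq> E"
      by (rule path_image_deck[OF \<gamma>(1) a(1,2)])+
    show "\<pi> ((T \<gamma> \<circ> a) t) = \<pi> (reversepath r t)" if "t \<in> {0..1}" for t
    proof -
      have "a t \<in> E" using that a(2) by (auto simp: path_image_def)
      then have "\<pi> ((T \<gamma> \<circ> a) t) = \<pi> (a t)" using deck_\<pi>[OF \<gamma>(1)] by simp
      then show ?thesis using r(4)[of "1 - t"] that by (simp add: reversepath_def)
    qed
  qed (use r a \<gamma> in \<open>auto simp: pathstart_compose\<close>)
  then have "T \<gamma> y = z" using a r by (simp add: pathfinish_compose)
  then show ?thesis using that \<gamma> by blast
qed

end

section \<open>Structures from equivariant developing maps\<close>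

lemma covering_open_map:
  assumes cov: "covering_space E \<pi> S" and W: "openin (top_of_set E) W"
  shows "openin (top_of_set S) (\<pi> ` W)"
proof (subst openin_subopen, intro ballI)
  fix x assume "x \<in> \<pi> ` W"
  then obtain y where y: "y \<in> W" "x = \<pi> y" by blast
  have "y \<in> E" using y(1) openin_imp_subset[OF W] by blast
  obtain u V q where V': "y \<in> u" "openin (top_of_set E) u" "\<pi> y \<in> V" "openin (top_of_set S) V"
   and q: "homeomorphism u V \<pi> q"
   by (rule covering_space_local_homeomorphism[OF cov \<open>y \<in> E\<close>])
 note V = V'(4,3,2,1)
  have "openin (top_of_set u) (u \<inter> W)"
    using V(3) W by (metis inf_le1 openin_Int openin_imp_subset openin_subset_trans)
  then have "openin (top_of_set V) (\<pi> ` (u \<inter> W))" by (rule homeomorphism_imp_open_map[OF q])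
  then have "openin (top_of_set S) (\<pi> ` (u \<inter> W))" using V(1) openin_trans by blast
  then show "\<exists>N. openin (top_of_set S) N \<and> x \<in> N \<and> N \<subseteq> \<pi> ` W" using y V(4) by blast
qed

section \<open>Charts developed by a given map\<close>

text \<open>The condition of \<open>developing_map\<close> for a single chart. With
  \<open>dev\<close> fixed, it selects the charts that belong to the structure of
  \<open>dev\<close>.\<close>

definition develops :: "'b::topological_space set \<Rightarrow> ('b \<Rightarrow> 'a) \<Rightarrow> ('b \<Rightarrow> rp2) \<Rightarrow> 'a chart \<Rightarrow> bool" where
  "develops E \<pi> dev = (\<lambda>(U, \<phi>). \<forall>y\<in>E. \<pi> y \<in> U \<longrightarrow>
     (\<exists>W. openin (top_of_set E) W \<and> y \<in> W \<and> \<pi> ` W \<subseteq> U \<and>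
        (\<exists>A\<in>PSL3. \<forall>z\<in>W. dev z = proj_act A (\<phi> (\<pi> z)))))"

lemma developing_map_iff_develops:
  "developing_map E \<pi> \<sigma> dev \<longleftrightarrow> (\<forall>c\<in>all_charts \<sigma>. develops E \<pi> dev c)"
proof -
  have swap: "(\<forall>y\<in>E. \<forall>c\<in>C. P y c) \<longleftrightarrow> (\<forall>c\<in>C. \<forall>y\<in>E. P y c)" for C :: "'c set" and P by blast
  show ?thesis unfolding developing_map_def develops_def split_beta by (rule swap)
qed

lemma developsE:
  assumes "develops E \<pi> dev (U, \<phi>)" "y \<in> E" "\<pi> y \<in> U"
  obtains W A where "openin (top_of_set E) W" "y \<in> W" "\<pi> ` W \<subseteq> U" "A \<in> PSL3"
    "\<And>z. z \<in> W \<Longrightarrow> dev z = proj_act A (\<phi> (\<pi> z))"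
proof -
  have "\<exists>W. openin (top_of_set E) W \<and> y \<in> W \<and> \<pi> ` W \<subseteq> U \<and>
      (\<exists>A\<in>PSL3. \<forall>z\<in>W. dev z = proj_act A (\<phi> (\<pi> z)))"
    using assms by (simp add: develops_def)
  then show ?thesis by (elim exE conjE bexE) (rule that; (assumption | erule (1) bspec))
qed

text \<open>Locally \<open>dev\<close> is the chart with \<open>\<pi>\<close> before it and a
  projective transformation after it; both are local homeomorphisms and leave the order
  alone.\<close>

lemma has_branch_order_develops:
  assumes cov: "covering_space E \<pi> S" and dev: "develops E \<pi> dev (U, \<phi>)" and U: "openin (top_of_set S) U"
    and y: "y \<in> E" "\<pi> y \<in> U" and ord: "has_branch_order U \<phi> (\<pi> y) m"
  shows "has_branch_order E dev y m"
proof -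
  obtain W A where W: "openin (top_of_set E) W" "y \<in> W" "\<pi> ` W \<subseteq> U" "A \<in> PSL3"
    "\<And>z. z \<in> W \<Longrightarrow> dev z = proj_act A (\<phi> (\<pi> z))"
    using developsE[OF dev y] by blast
  obtain u V q where V': "y \<in> u" "openin (top_of_set E) u" "\<pi> y \<in> V" "openin (top_of_set S) V"
    and q: "homeomorphism u V \<pi> q"
    by (rule covering_space_local_homeomorphism[OF cov y(1)])
  note V = V'(4,3,2,1)
  define u' where "u' = u \<inter> W"
  have u': "openin (top_of_set E) u'" "y \<in> u'" using V W by (auto simp: u'_def)
  have hom: "homeomorphism u' (\<pi> ` u') \<pi> q"
    by (rule homeomorphism_restrict[OF q]) (simp add: u'_def)
  have sub: "\<pi> ` u' \<subseteq> U" using W(3) by (auto simp: u'_def)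
  have "openin (top_of_set S) (\<pi> ` u')" by (rule covering_open_map[OF cov u'(1)])
  then have "openin (top_of_set U) (\<pi> ` u')"
    using sub openin_imp_subset[OF U] by (metis openin_subset_trans)
  then have "has_branch_order E (\<lambda>z. \<phi> (\<pi> z)) y m"
    by (rule has_branch_order_precompose[OF hom u' _ ord]) simp
  then show ?thesis
  proof (rule has_branch_order_postcompose[OF _ homeomorphism_proj_act open_UNIV open_UNIV u'])
    show "det A \<noteq> 0" using W(4) by (rule PSL3_det)
  qed (use W in \<open>auto simp: u'_def\<close>)
qed

text \<open>The branch data become an order function \<open>n\<close> on the surface, the form in
  which the deformed developing map inherits them.\<close>

lemma branched_structure_developing_orders:
  assumes cov: "covering_space E \<pi> S" and \<sigma>: "branched_projective_structure S \<sigma>"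
    and \<mu>: "has_branch_data \<sigma> \<mu>" "\<forall>m\<in>set \<mu>. m > 0" and dev: "developing_map E \<pi> \<sigma> dev"
  obtains n ps where "\<And>y. y \<in> E \<Longrightarrow> has_branch_order E dev y (n (\<pi> y))"
    "\<And>x. x \<in> branch_points \<sigma> \<Longrightarrow> n x > 0" "\<And>x. x \<notin> branch_points \<sigma> \<Longrightarrow> n x = 0"
    "distinct ps" "set ps = branch_points \<sigma>" "length ps = length \<mu>" "\<And>i. i < length \<mu> \<Longrightarrow> n (ps ! i) = \<mu> ! i"
proof -
  obtain ps where ps: "distinct ps" "set ps = branch_points \<sigma>" "length ps = length \<mu>"
    "\<And>i. i < length \<mu> \<Longrightarrow> branch_point_of_order \<sigma> (ps ! i) (\<mu> ! i)"
    using \<mu>(1) unfolding has_branch_data_def by blast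
  \<comment> \<open>The index is unique because \<open>ps\<close> is distinct.\<close>
  define n where "n = (\<lambda>x. if x \<in> branch_points \<sigma> then \<mu> ! (THE i. i < length \<mu> \<and> ps ! i = x) else 0)"
  have nth: "n (ps ! i) = \<mu> ! i" if "i < length \<mu>" for i
  proof -
    have "(THE j. j < length \<mu> \<and> ps ! j = ps ! i) = i"
      using that ps(1,3) by (intro the_equality) (auto simp: nth_eq_iff_index_eq)
    then show ?thesis using that ps(2,3) nth_mem[of i ps] by (simp add: n_def)
  qed
  have idx: "\<exists>i<length \<mu>. x = ps ! i" if "x \<in> branch_points \<sigma>" for x
    using that ps(2,3) by (metis in_set_conv_nth)
  show ?thesis
  proof (rule that[of n ps])
    fix y assume y: "y \<in> E"
    show "has_branch_order E dev y (n (\<pi> y))"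
    proof (cases "\<pi> y \<in> branch_points \<sigma>")
      case True
      then obtain i where i: "i < length \<mu>" "\<pi> y = ps ! i" using idx by blast
      then obtain U \<phi> where U: "(U, \<phi>) \<in> branched_charts \<sigma>" "\<pi> y \<in> U" "has_branch_order U \<phi> (\<pi> y) (\<mu> ! i)"
        using ps(4)[OF i(1)] unfolding branch_point_of_order_def by auto
      have "branched_chart S (branch_points \<sigma>) (U, \<phi>)" using \<sigma> U(1) unfolding branched_projective_structure_def by blast
      then have "openin (top_of_set S) U" by (simp add: branched_chart_def)
      moreover have "develops E \<pi> dev (U, \<phi>)" using dev U(1) by (simp add: developing_map_iff_develops all_charts_def)
      ultimately show ?thesis using has_branch_order_develops[OF cov _ _ y U(2,3)] nth[OF i(1)] i(2) by simp
    next
      case False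
      have "\<pi> y \<in> S" using y cov covering_space_imp_surjective by blast
      then have "\<pi> y \<in> (\<Union>c\<in>regular_charts \<sigma>. fst c)" using False \<sigma> unfolding branched_projective_structure_def by blast
      then obtain U \<phi> where U: "(U, \<phi>) \<in> regular_charts \<sigma>" "\<pi> y \<in> U" by auto
      have "regular_chart S (branch_points \<sigma>) (U, \<phi>)" using \<sigma> U(1) unfolding branched_projective_structure_def by blast
      then obtain \<psi> where oU: "openin (top_of_set S) U" "open (\<phi> ` U)" "homeomorphism U (\<phi> ` U) \<phi> \<psi>"
        by (auto simp: regular_chart_def)
      have "has_branch_order U \<phi> (\<pi> y) 0"
        using oU U(2) by (intro has_branch_order_0I[OF oU(3)]) auto
      moreover have "develops E \<pi> dev (U, \<phi>)" using dev U(1) by (simp add: developing_map_iff_develops all_charts_def)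
      ultimately show ?thesis
        using has_branch_order_develops[OF cov _ oU(1) y U(2)] False by (simp add: n_def)
    qed
  next
    show "n x > 0" if "x \<in> branch_points \<sigma>" for x
      using idx[OF that] nth \<mu>(2) by force
    show "n x = 0" if "x \<notin> branch_points \<sigma>" for x using that by (simp add: n_def)
    show "n (ps ! i) = \<mu> ! i" if "i < length \<mu>" for i using that by (rule nth)
  qed (fact ps)+
qed

section \<open>The structure of an equivariant branched map\<close>

text \<open>What a branched structure leaves on the universal covering once its atlas is forgotten.
  The deformation replaces \<open>dev\<close> and \<open>\<rho>\<close> and keeps all other
  parameters.\<close>

locale equivariant_branched_map = deck_action S E \<pi> e T
  for S :: "'s::t2_space set" and E :: "'e::topological_space set" and \<pi> e T +
  fixes dev :: "'e \<Rightarrow> rp2" and \<rho> :: "'s representation" and n :: "'s \<Rightarrow> nat" and B :: "'s set"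
  assumes \<rho>: "\<And>\<gamma>. \<gamma> \<in> carrier \<Gamma> \<Longrightarrow> \<rho> \<gamma> \<in> PSL3"
    and equiv: "\<And>\<gamma> y. \<gamma> \<in> carrier \<Gamma> \<Longrightarrow> y \<in> E \<Longrightarrow> dev (T \<gamma> y) = proj_act (\<rho> \<gamma>) (dev y)"
    and ord: "\<And>y. y \<in> E \<Longrightarrow> has_branch_order E dev y (n (\<pi> y))"
    and B: "B \<subseteq> S" "finite B" "discrete B"
    and n: "\<And>x. x \<in> B \<Longrightarrow> n x > 0" "\<And>x. x \<notin> B \<Longrightarrow> n x = 0"
begin

lemma \<pi>_surj:
  assumes "x \<in> S" obtains y where "y \<in> E" "\<pi> y = x"
  using assms covering_space_imp_surjective[OF cov] by blast

text \<open>Admitting every chart that \<open>dev\<close> develops, instead of generating an atlas,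
  reduces maximality to showing that a compatible chart is developed.\<close>

definition charted :: "'s branched_structure" where
  "charted = \<lparr>branch_points = B,
     regular_charts = {c. regular_chart S B c \<and> develops E \<pi> dev c},
     branched_charts = {c. branched_chart S B c \<and> develops E \<pi> dev c}\<rparr>"

text \<open>The chart is \<open>dev\<close> after a local section of \<open>\<pi>\<close>, on a
  branch disc. Over the other sheets equivariance supplies the required projective transformation,
  the inverse of \<open>\<rho> \<gamma>\<close>.\<close>

lemma developing_chart:
  assumes x: "x \<in> S" and Q: "openin (top_of_set S) Q" "x \<in> Q"
  obtains U \<phi> where "openin (top_of_set S) U" "x \<in> U" "U \<subseteq> Q" "branch_disc \<phi> x (n x) U" "\<phi> \<in> extensional U"
    "develops E \<pi> dev (U, \<phi>)"
proof -
  obtain y where y: "y \<in> E" "\<pi> y = x" using \<pi>_surj[OF x] by blast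
  obtain u V q where V': "y \<in> u" "openin (top_of_set E) u" "\<pi> y \<in> V" "openin (top_of_set S) V"
    and q: "homeomorphism u V \<pi> q"
    by (rule covering_space_local_homeomorphism[OF cov y(1)])
  note V = V'(4,3,2,1)
  have q': "homeomorphism V u q \<pi>" using q homeomorphism_symD by blast
  have qx: "q x = y" using homeomorphism_apply1[OF q V(4)] y(2) by simp
  have uE: "u \<subseteq> E" using V(3) by (rule openin_imp_subset)
  have "has_branch_order S (\<lambda>x. dev (q x)) x (n x)"
    by (rule has_branch_order_precompose[OF q' V(1) _ V(3)]) (use V(2) y qx ord[OF y(1)] in auto)
  moreover have "openin (top_of_set S) (Q \<inter> V)" "x \<in> Q \<inter> V" using Q V y by auto
  ultimately obtain U where U: "U \<subseteq> Q \<inter> V" "openin (top_of_set S) U" "branch_disc (\<lambda>x. dev (q x)) x (n x) U"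
    by (rule has_branch_order_disc)
  define \<phi> where "\<phi> = restrict (\<lambda>x. dev (q x)) U"
  have xU: "x \<in> U" using U(3) by (simp add: branch_disc_def)
  have eq: "\<phi> z = dev (q z)" if "z \<in> U" for z using that by (simp add: \<phi>_def)
  have im: "\<phi> ` U = (\<lambda>x. dev (q x)) ` U" using eq by (intro image_cong) auto
  have "branch_disc \<phi> x (n x) U"
    using U(3) unfolding branch_disc_def im by (simp add: eq cong: ball_cong)
  moreover have "develops E \<pi> dev (U, \<phi>)"
    unfolding develops_def split
  proof (intro ballI impI)
    fix z assume z: "z \<in> E" "\<pi> z \<in> U"
    then have zV: "\<pi> z \<in> V" using U(1) by blast
    have qz: "q (\<pi> z) \<in> u" "\<pi> (q (\<pi> z)) = \<pi> z"
      using zV homeomorphism_image2[OF q] homeomorphism_apply2[OF q] by auto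
    then obtain \<gamma> where \<gamma>: "\<gamma> \<in> carrier \<Gamma>" "T \<gamma> z = q (\<pi> z)"
      \<comment> \<open>An arbitrary point over \<open>U\<close> is moved into the sheet
        \<open>u\<close>; continuity keeps its neighbours in \<open>u\<close> under the same deck
        transformation.\<close>
      using deck_trans[OF z(1), of "q (\<pi> z)"] uE by auto
    define W where "W = (E \<inter> T \<gamma> -` u) \<inter> (E \<inter> \<pi> -` U)"
    show "\<exists>W. openin (top_of_set E) W \<and> z \<in> W \<and> \<pi> ` W \<subseteq> U \<and>
        (\<exists>A\<in>PSL3. \<forall>w\<in>W. dev w = proj_act A (\<phi> (\<pi> w)))"
    proof (intro exI[of _ W] conjI bexI[of _ "matrix_inv (\<rho> \<gamma>)"] ballI)
      show "openin (top_of_set E) W"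
        unfolding W_def using deck_cont[OF \<gamma>(1)] deck_in[OF \<gamma>(1)] V(3) \<pi>_cont \<pi>_S U(2)
        by (intro openin_Int continuous_openin_preimage) auto
      show "z \<in> W" using z \<gamma> qz by (simp add: W_def)
      show "\<pi> ` W \<subseteq> U" by (auto simp: W_def)
      show "matrix_inv (\<rho> \<gamma>) \<in> PSL3" using \<rho>[OF \<gamma>(1)] by (rule PSL3_matrix_inv)
      fix w assume w: "w \<in> W"
      then have "q (\<pi> (T \<gamma> w)) = T \<gamma> w" using homeomorphism_apply1[OF q] by (simp add: W_def)
      then have "\<phi> (\<pi> w) = dev (T \<gamma> w)" using w deck_\<pi>[OF \<gamma>(1)] eq by (simp add: W_def)
      also have "\<dots> = proj_act (\<rho> \<gamma>) (dev w)" using w equiv[OF \<gamma>(1)] by (simp add: W_def)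
      finally show "dev w = proj_act (matrix_inv (\<rho> \<gamma>)) (\<phi> (\<pi> w))"
        using PSL3_det(1)[OF \<rho>[OF \<gamma>(1)]] by simp
    qed
  qed
  ultimately show ?thesis using that[of U \<phi>] U xU by (auto simp: \<phi>_def)
qed

text \<open>The finitely many other branch points form a closed set and can be avoided, so the
  domain meets \<open>B\<close> at most in \<open>x\<close>. Its connectedness later makes overlaps
  single components.\<close>

lemma chart_of_charted:
  assumes x: "x \<in> S" and Q: "openin (top_of_set S) Q" "x \<in> Q"
  obtains U \<phi> where "x \<in> U" "U \<subseteq> Q" "connected U" "develops E \<pi> dev (U, \<phi>)" "has_branch_order U \<phi> x (n x)"
    "x \<notin> B \<Longrightarrow> (U, \<phi>) \<in> regular_charts charted" "x \<in> B \<Longrightarrow> (U, \<phi>) \<in> branched_charts charted"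
proof -
  define Q' where "Q' = Q \<inter> (S - (B - {x}))"
  have "open (- (B - {x}))" using B(2) by (intro open_Compl finite_imp_closed) simp
  then have "openin (top_of_set S) (S - (B - {x}))" unfolding Diff_eq[of S] by (rule openin_open_Int)
  then have Q': "openin (top_of_set S) Q'" "x \<in> Q'" using Q x by (simp_all add: Q'_def openin_Int)
  obtain U \<phi> where U: "openin (top_of_set S) U" "x \<in> U" "U \<subseteq> Q'" "branch_disc \<phi> x (n x) U" "\<phi> \<in> extensional U"
    "develops E \<pi> dev (U, \<phi>)"
    by (rule developing_chart[OF x Q'])
  have ord: "has_branch_order U \<phi> x (n x)"
    using U(4) by (auto simp: has_branch_order_iff_branch_disc)
  show ?thesis
  proof (rule that[of U \<phi>])
    show "connected U" using branch_disc_connected[OF U(4)] .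
    show "(U, \<phi>) \<in> regular_charts charted" if "x \<notin> B"
    proof -
      have "branch_disc \<phi> x 0 U" using U(4) n(2)[OF that] by simp
      then obtain \<psi> where "homeomorphism U (\<phi> ` U) \<phi> \<psi>" by (rule branch_disc_0_homeomorphism)
      moreover have "open (\<phi> ` U)" using U(4) by (simp add: branch_disc_def)
      ultimately show ?thesis using U that by (auto simp: charted_def regular_chart_def Q'_def)
    qed
    show "(U, \<phi>) \<in> branched_charts charted" if "x \<in> B"
    proof -
      have "U \<inter> B = {x}" using U(2,3) that by (auto simp: Q'_def)
      then show ?thesis
        using U ord n(1)[OF that] branch_disc_finite_branched_covering[OF U(4)]
        by (auto simp: charted_def branched_chart_def)
    qed
  qed (use U ord in \<open>auto simp: Q'_def\<close>)
qed

text \<open>Near each point \<open>dev\<close> is open, whatever the branch order. This provides the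
  open sets needed for \<open>PSL3_eqI\<close>, also at branch points.\<close>

lemma develops_open_image:
  assumes dev: "develops E \<pi> dev (V, \<psi>)" and N: "openin (top_of_set S) N" "x \<in> N" "x \<in> V"
  obtains Q where "open Q" "Q \<noteq> {}" "Q \<subseteq> \<psi> ` N"
proof -
  have "x \<in> S" using N openin_imp_subset by blast
  then obtain y where y: "y \<in> E" "\<pi> y = x" using \<pi>_surj by blast
  then obtain W A where W: "openin (top_of_set E) W" "y \<in> W" "A \<in> PSL3"
    "\<And>z. z \<in> W \<Longrightarrow> dev z = proj_act A (\<psi> (\<pi> z))"
    using developsE[OF dev, of y] N(3) by metis
  define W' where "W' = W \<inter> (E \<inter> \<pi> -` N)"
  have oW': "openin (top_of_set E) W'"
    unfolding W'_def using W(1) N(1) \<pi>_cont \<pi>_S by (intro openin_Int continuous_openin_preimage) auto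
  have yW': "y \<in> W'" using W(2) y N(2) by (simp add: W'_def)
  obtain O' where O': "open O'" "dev y \<in> O'" "O' \<subseteq> dev ` W'"
    by (rule has_branch_order_open_image[OF ord[OF y(1)] oW' yW'])
  have det: "det A \<noteq> 0" using W(3) by (rule PSL3_det)
  have hom: "homeomorphism UNIV UNIV (proj_act (matrix_inv A)) (proj_act A)"
    using homeomorphism_proj_act[OF det] homeomorphism_symD by blast
  show ?thesis
  proof (rule that[of "proj_act (matrix_inv A) ` O'"])
    show "open (proj_act (matrix_inv A) ` O')"
      using homeomorphism_imp_open_map[OF hom, of O'] O'(1) by (simp add: subtopology_UNIV)
    show "proj_act (matrix_inv A) ` O' \<subseteq> \<psi> ` N"
    proof clarify
      fix L assume "L \<in> O'"
      then obtain z where z: "z \<in> W'" "L = dev z" using O'(3) by blast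
      then have "proj_act (matrix_inv A) L = \<psi> (\<pi> z)" using W(4) det by (simp add: W'_def)
      then show "proj_act (matrix_inv A) L \<in> \<psi> ` N" using z(1) by (auto simp: W'_def)
    qed
  qed (use O' in auto)
qed

text \<open>Near each point of the overlap both charts agree with \<open>dev\<close> up to elements
  of \<open>PSL3\<close>, which yields a transition element there. It is unique because the images
  have interior, so it is locally constant and hence constant on components.\<close>

lemma develops_compatible:
  assumes c: "develops E \<pi> dev (U, \<phi>)" "openin (top_of_set S) U"
    and d: "develops E \<pi> dev (V, \<psi>)" "openin (top_of_set S) V"
  shows "compatible (U, \<phi>) (V, \<psi>)"
  unfolding compatible_def split
proof
  fix C assume C: "C \<in> components (U \<inter> V)"
  define trans where "trans = (\<lambda>x G. G \<in> PSL3 \<and> (\<exists>N. openin (top_of_set S) N \<and> x \<in> N \<and>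
    (\<forall>z\<in>N. \<phi> z = proj_act G (\<psi> z))))"
  have CUV: "C \<subseteq> U \<inter> V" using in_components_subset[OF C] .
  have ex: "\<exists>G. trans x G" if x: "x \<in> U" "x \<in> V" for x
  proof -
    have "x \<in> S" using x c(2) openin_imp_subset by blast
    then obtain y where y: "y \<in> E" "\<pi> y = x" using \<pi>_surj by blast
    obtain W A where W: "openin (top_of_set E) W" "y \<in> W" "A \<in> PSL3"
      "\<And>z. z \<in> W \<Longrightarrow> dev z = proj_act A (\<phi> (\<pi> z))"
      using developsE[OF c(1) y(1)] y(2) x by metis
    obtain W' A' where W': "openin (top_of_set E) W'" "y \<in> W'" "A' \<in> PSL3"
      "\<And>z. z \<in> W' \<Longrightarrow> dev z = proj_act A' (\<psi> (\<pi> z))"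
      using developsE[OF d(1) y(1)] y(2) x by metis
    have "openin (top_of_set S) (\<pi> ` (W \<inter> W'))" using W W' by (intro covering_open_map[OF cov]) auto
    moreover have "x \<in> \<pi> ` (W \<inter> W')" using y W W' by blast
    moreover have "\<phi> w = proj_act (matrix_inv A ** A') (\<psi> w)" if w: "w \<in> \<pi> ` (W \<inter> W')" for w
    proof -
      obtain z where z: "z \<in> W" "z \<in> W'" "w = \<pi> z" using w by blast
      then have "proj_act A (\<phi> w) = proj_act A' (\<psi> w)"
        using W(4)[OF z(1)] W'(4)[OF z(2)] z(3) by simp
      then have "proj_act (matrix_inv A) (proj_act A (\<phi> w)) = proj_act (matrix_inv A) (proj_act A' (\<psi> w))" by simp
      then show ?thesis using PSL3_det(1)[OF W(3)] PSL3_det(1)[OF W'(3)] by (simp add: proj_act_mult)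
    qed
    moreover have "matrix_inv A ** A' \<in> PSL3" by (intro PSL3_mult PSL3_matrix_inv W W')
    ultimately have "trans x (matrix_inv A ** A')" unfolding trans_def by blast
    then show ?thesis by (rule exI)
  qed
  have uniq: "G = G'" if x: "x \<in> V" and G: "trans x G" and G': "trans x G'" for x G G'
  proof -
    obtain N where N: "openin (top_of_set S) N" "x \<in> N" "\<forall>z\<in>N. \<phi> z = proj_act G (\<psi> z)" and GP: "G \<in> PSL3"
      using G unfolding trans_def by blast
    obtain N' where N': "openin (top_of_set S) N'" "x \<in> N'" "\<forall>z\<in>N'. \<phi> z = proj_act G' (\<psi> z)" and GP': "G' \<in> PSL3"
      using G' unfolding trans_def by blast
    have NN': "openin (top_of_set S) (N \<inter> N')" "x \<in> N \<inter> N'" using N N' by auto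
    obtain Q where Q: "open Q" "Q \<noteq> {}" "Q \<subseteq> \<psi> ` (N \<inter> N')"
      by (rule develops_open_image[OF d(1) NN' x])
    show ?thesis
    proof (rule PSL3_eqI[OF GP GP' Q(1,2)])
      fix L assume "L \<in> Q"
      then obtain z where "z \<in> N" "z \<in> N'" "L = \<psi> z" using Q(3) by blast
      then show "proj_act G L = proj_act G' L" using N(3) N'(3) by metis
    qed
  qed
  define g where "g = (\<lambda>x. SOME G. trans x G)"
  have g: "trans x (g x)" if "x \<in> C" for x
  proof -
    have "x \<in> U" "x \<in> V" using that CUV by auto
    then have "\<exists>G. trans x G" by (rule ex)
    then show ?thesis unfolding g_def by (rule someI_ex)
  qed
  have "g constant_on C"
  proof (rule locally_constant_imp_constant)
    show "connected C" using in_components_connected[OF C] .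
    fix a assume a: "a \<in> C"
    obtain N where N: "openin (top_of_set S) N" "a \<in> N" "\<forall>z\<in>N. \<phi> z = proj_act (g a) (\<psi> z)" "g a \<in> PSL3"
      using g[OF a] unfolding trans_def by blast
    have "C \<subseteq> S" using CUV c(2) openin_imp_subset by blast
    then have "openin (top_of_set C) (C \<inter> N)"
      using N(1) by (auto simp: openin_open)
    moreover have "g z = g a" if "z \<in> C \<inter> N" for z
    proof -
      have "trans z (g a)" unfolding trans_def using N that by blast
      moreover have "z \<in> V" "z \<in> C" using that CUV by auto
      ultimately show ?thesis using uniq g by simp
    qed
    ultimately show "\<exists>T. openin (top_of_set C) T \<and> a \<in> T \<and> (\<forall>x\<in>T. g x = g a)" using a N(2) by blast
  qed
  then obtain G where G: "\<And>x. x \<in> C \<Longrightarrow> g x = G" unfolding constant_on_def by blast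
  obtain a where "a \<in> C" using in_components_nonempty[OF C] by blast
  then have "G \<in> PSL3" using g[of a] G[of a] unfolding trans_def by simp
  moreover have "\<phi> x = proj_act G (\<psi> x)" if "x \<in> C" for x
    using g[OF that] G[OF that] unfolding trans_def by blast
  ultimately show "\<exists>A\<in>PSL3. \<forall>x\<in>C. \<phi> x = proj_act A (\<psi> x)" by blast
qed

text \<open>The chart is compared with one of \<open>charted\<close> whose connected domain lies
  inside \<open>U\<close>: the overlap is a single component, and one transition element relates the
  chart to \<open>dev\<close>. \<open>F\<close> selects the charts with which compatibility is
  known, since maximality tests regular charts against regular ones only.\<close>

lemma compatible_develops:
  assumes U: "openin (top_of_set S) U"
    and charts: "\<And>x. x \<in> U \<Longrightarrow> x \<notin> B \<Longrightarrow> F x = regular_charts charted" "\<And>x. x \<in> U \<Longrightarrow> x \<in> B \<Longrightarrow> F x = branched_charts charted"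
    and comp: "\<And>x d. x \<in> U \<Longrightarrow> d \<in> F x \<Longrightarrow> compatible (U, \<phi>) d"
  shows "develops E \<pi> dev (U, \<phi>)"
  unfolding develops_def split
proof (intro ballI impI)
  fix y assume y: "y \<in> E" "\<pi> y \<in> U"
  obtain V \<psi> where V: "\<pi> y \<in> V" "V \<subseteq> U" "connected V" "develops E \<pi> dev (V, \<psi>)"
    "\<pi> y \<notin> B \<Longrightarrow> (V, \<psi>) \<in> regular_charts charted" "\<pi> y \<in> B \<Longrightarrow> (V, \<psi>) \<in> branched_charts charted"
    using chart_of_charted[OF \<pi>_S[OF y(1)] U y(2)] by metis
  have "compatible (U, \<phi>) (V, \<psi>)"
    using V(5,6) charts[OF y(2)] comp[OF y(2)] by blast
  moreover have "components (U \<inter> V) = {V}"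
    using V(1,2,3) by (metis components_eq_sing_iff empty_iff inf.absorb2)
  ultimately obtain A where A: "A \<in> PSL3" "\<And>x. x \<in> V \<Longrightarrow> \<phi> x = proj_act A (\<psi> x)"
    unfolding compatible_def by auto
  obtain W G where W: "openin (top_of_set E) W" "y \<in> W" "\<pi> ` W \<subseteq> V" "G \<in> PSL3"
    "\<And>z. z \<in> W \<Longrightarrow> dev z = proj_act G (\<psi> (\<pi> z))"
    using developsE[OF V(4) y(1) V(1)] by metis
  show "\<exists>W. openin (top_of_set E) W \<and> y \<in> W \<and> \<pi> ` W \<subseteq> U \<and>
      (\<exists>A\<in>PSL3. \<forall>z\<in>W. dev z = proj_act A (\<phi> (\<pi> z)))"
  proof (intro exI[of _ W] conjI bexI[of _ "G ** matrix_inv A"] ballI)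
    show "G ** matrix_inv A \<in> PSL3" using A(1) W(4) PSL3_mult PSL3_matrix_inv by blast
    fix z assume z: "z \<in> W"
    then have "\<phi> (\<pi> z) = proj_act A (\<psi> (\<pi> z))" using A(2) W(3) by blast
    then show "dev z = proj_act (G ** matrix_inv A) (\<phi> (\<pi> z))"
      using W(5)[OF z] PSL3_det(1)[OF A(1)] PSL3_det(1)[OF PSL3_matrix_inv[OF A(1)]] by (simp add: proj_act_mult)
  qed (use W V in auto)
qed

lemma charted_develops: "c \<in> all_charts charted \<Longrightarrow> develops E \<pi> dev c"
  unfolding all_charts_def charted_def by (elim UnE) simp_all

lemma charted_developing_map: "developing_map E \<pi> charted dev"
  unfolding developing_map_iff_develops by (intro ballI charted_develops)

lemma charted_open:
  assumes "(U, \<phi>) \<in> all_charts charted"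
  shows "openin (top_of_set S) U"
  using assms unfolding all_charts_def charted_def
  by (elim UnE) (simp_all add: regular_chart_def branched_chart_def)

lemma branched_projective_structure_charted: "branched_projective_structure S charted"
  unfolding branched_projective_structure_def
proof (intro conjI)
  have bp: "branch_points charted = B" by (simp add: charted_def)
  show "branch_points charted \<subseteq> S" "discrete (branch_points charted)" using B by (simp_all add: bp)
  show "\<forall>c\<in>regular_charts charted. regular_chart S (branch_points charted) c"
    "\<forall>c\<in>branched_charts charted. branched_chart S (branch_points charted) c"
    by (simp_all add: charted_def)
  show "(\<Union>c\<in>regular_charts charted. fst c) = S - branch_points charted"
  proof
    show "(\<Union>c\<in>regular_charts charted. fst c) \<subseteq> S - branch_points charted"
      by (auto simp: charted_def regular_chart_def)
    show "S - branch_points charted \<subseteq> (\<Union>c\<in>regular_charts charted. fst c)"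
    proof
      fix x assume "x \<in> S - branch_points charted"
      then have x: "x \<in> S" "x \<notin> B" by (auto simp: bp)
      obtain U \<phi> where "x \<in> U" "x \<notin> B \<Longrightarrow> (U, \<phi>) \<in> regular_charts charted"
        using chart_of_charted[OF x(1) openin_subtopology_self x(1)] by metis
      then show "x \<in> (\<Union>c\<in>regular_charts charted. fst c)" using x(2) by force
    qed
  qed
  show "branch_points charted \<subseteq> (\<Union>c\<in>branched_charts charted. fst c)"
  proof
    fix x assume "x \<in> branch_points charted"
    then have x: "x \<in> S" "x \<in> B" using B(1) by (auto simp: bp)
    obtain U \<phi> where "x \<in> U" "x \<in> B \<Longrightarrow> (U, \<phi>) \<in> branched_charts charted"
      using chart_of_charted[OF x(1) openin_subtopology_self x(1)] by metis
    then show "x \<in> (\<Union>c\<in>branched_charts charted. fst c)" using x(2) by force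
  qed
  show "\<forall>c\<in>all_charts charted. \<forall>d\<in>all_charts charted. compatible c d"
  proof (intro ballI)
    fix c d assume cd: "c \<in> all_charts charted" "d \<in> all_charts charted"
    obtain U \<phi> V \<psi> where "c = (U, \<phi>)" "d = (V, \<psi>)" by (cases c, cases d)
    then show "compatible c d" using cd develops_compatible charted_develops charted_open by simp
  qed
  show "\<forall>c. regular_chart S (branch_points charted) c \<and> (\<forall>d\<in>regular_charts charted. compatible c d)
      \<longrightarrow> c \<in> regular_charts charted"
  proof (intro allI impI)
    fix c assume c: "regular_chart S (branch_points charted) c \<and> (\<forall>d\<in>regular_charts charted. compatible c d)"
    obtain U \<phi> where c': "c = (U, \<phi>)" by (cases c)
    have U: "openin (top_of_set S) U" "U \<inter> B = {}" using c by (auto simp: c' regular_chart_def bp)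
    have "develops E \<pi> dev (U, \<phi>)"
      by (rule compatible_develops[OF U(1), where F = "\<lambda>x. regular_charts charted"]) (use U(2) c c' in auto)
    then show "c \<in> regular_charts charted" using c unfolding bp by (simp add: c' charted_def)
  qed
  show "\<forall>c. branched_chart S (branch_points charted) c \<and> (\<forall>d\<in>all_charts charted. compatible c d)
      \<longrightarrow> c \<in> branched_charts charted"
  proof (intro allI impI)
    fix c assume c: "branched_chart S (branch_points charted) c \<and> (\<forall>d\<in>all_charts charted. compatible c d)"
    obtain U \<phi> where c': "c = (U, \<phi>)" by (cases c)
    have U: "openin (top_of_set S) U" using c by (auto simp: c' branched_chart_def)
    have "develops E \<pi> dev (U, \<phi>)"
      by (rule compatible_develops[OF U, where F = "\<lambda>x. if x \<in> B then branched_charts charted else regular_charts charted"])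
        (use c c' in \<open>auto simp: all_charts_def split: if_splits\<close>)
    then show "c \<in> branched_charts charted" using c unfolding bp by (simp add: c' charted_def)
  qed
qed

lemma branch_point_of_order_charted:
  assumes "x \<in> B"
  shows "branch_point_of_order charted x (n x)"
proof -
  have x: "x \<in> S" using assms B(1) by blast
  obtain U \<phi> where "x \<in> U" "has_branch_order U \<phi> x (n x)" "x \<in> B \<Longrightarrow> (U, \<phi>) \<in> branched_charts charted"
    using chart_of_charted[OF x openin_subtopology_self x] by metis
  then show ?thesis
    using assms unfolding branch_point_of_order_def by (auto simp: charted_def intro!: bexI[of _ "(U, \<phi>)"])
qed

lemma charted_in_structures_with_data:
  assumes "distinct ps" "set ps = B" "length ps = length \<mu>" "\<And>i. i < length \<mu> \<Longrightarrow> n (ps ! i) = \<mu> ! i"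
  shows "charted \<in> structures_with_data S \<mu>"
proof -
  have "branch_point_of_order charted (ps ! i) (\<mu> ! i)" if "i < length \<mu>" for i
    using that assms branch_point_of_order_charted[of "ps ! i"] nth_mem[of i ps] by simp
  then have "has_branch_data charted \<mu>"
    unfolding has_branch_data_def using assms by (intro exI[of _ ps]) (auto simp: charted_def)
  then show ?thesis by (simp add: structures_with_data_def branched_projective_structure_charted)
qed

end

section \<open>Gluing data\<close>

lemma matrix_scaleR_left: "(c *\<^sub>R A) ** B = c *\<^sub>R (A ** B)"
  and matrix_scaleR_right: "A ** (c *\<^sub>R B) = c *\<^sub>R (A ** B)"
  and matrix_add_mult_right: "(A + A') ** B = A ** B + A' ** B"
  for A A' :: "real^'n^'m" and B :: "real^'k^'n"
  by (simp_all add: matrix_matrix_mult_def vec_eq_iff sum_distrib_left sum.distrib algebra_simps)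

lemma matrix_mult_sum_right: "(\<Sum>i\<in>I. A ** F i) = A ** (\<Sum>i\<in>I. F i)" for A :: "real^'n^'m"
  by (induction I rule: infinite_finite_induct) (simp_all add: matrix_add_ldistrib)

lemma matrix_mult_sum_left: "(\<Sum>i\<in>I. F i ** A) = (\<Sum>i\<in>I. F i) ** A" for A :: "real^'n^'m"
  by (induction I rule: infinite_finite_induct) (simp_all add: matrix_add_mult_right)

lemma matrix_inv_mult:
  fixes A B :: "real^'n^'n"
  assumes "invertible A" "invertible B"
  shows "matrix_inv (A ** B) = matrix_inv B ** matrix_inv A"
proof -
  have "invertible (A ** B)" using assms by (rule invertible_mult)
  then have "matrix_inv (A ** B) ** (A ** B) = mat 1" by (rule matrix_inv_left)
  then have "matrix_inv (A ** B) ** ((A ** B) ** (matrix_inv B ** matrix_inv A)) = matrix_inv B ** matrix_inv A"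
    by (simp add: matrix_mul_assoc)
  moreover have "(A ** B) ** (matrix_inv B ** matrix_inv A) = A ** (B ** matrix_inv B) ** matrix_inv A"
    by (simp add: matrix_mul_assoc)
  ultimately show ?thesis using assms by (simp add: matrix_inv_right)
qed

lemma locally_lipschitz_at_pos_nearby:
  fixes f :: "'a::metric_space \<Rightarrow> real"
  assumes "locally_lipschitz_at f a" "f a > 0"
  obtains r where "r > 0" "\<And>x. x \<in> ball a r \<Longrightarrow> f x > 0"
proof -
  obtain r K where r: "r > 0" "K-lipschitz_on (ball a r) f"
    using assms(1) unfolding locally_lipschitz_at_def by blast
  have "continuous_on (ball a r) f" using r(2) by (rule lipschitz_on_continuous_on)
  then have "open (f -` {0<..} \<inter> ball a r)" by (simp add: continuous_on_open_vimage)
  moreover have "a \<in> f -` {0<..} \<inter> ball a r" using assms(2) r(1) by simp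
  ultimately obtain s where "s > 0" "ball a s \<subseteq> f -` {0<..} \<inter> ball a r" by (meson openE)
  then show ?thesis using that by blast
qed

lemma line_through_unit:
  obtains v where "norm v = 1" "(L::rp2) = line_through v"
proof -
  obtain w where w: "w \<noteq> 0" "L = line_through w" by (rule line_through_surj)
  then show ?thesis by (intro that[of "(1 / norm w) *\<^sub>R w"]) simp_all
qed

text \<open>The bump function is a truncation of the squared cosine of the angle with the given line.\<close>

lemma rp2_bump_function:
  fixes L0 :: rp2
  assumes Q: "open Q" "L0 \<in> Q"
  shows "\<exists>(g :: rp2 \<Rightarrow> real) C. compact C \<and> C \<subseteq> Q \<and> g L0 > 0 \<and> (\<forall>L. g L \<ge> 0) \<and> (\<forall>L. g L > 0 \<longrightarrow> L \<in> C) \<and>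
    open {L. g L > 0} \<and> (\<forall>v. v \<noteq> 0 \<longrightarrow> locally_lipschitz_at (\<lambda>v. g (line_through v)) v)"
proof -
  obtain u where u: "norm u = 1" "L0 = line_through u" by (rule line_through_unit)
  have "u \<in> {v. v \<noteq> 0 \<and> line_through v \<in> Q}" using u Q(2) by auto
  then obtain \<epsilon> where \<epsilon>: "\<epsilon> > 0" "ball u \<epsilon> \<subseteq> {v. v \<noteq> 0 \<and> line_through v \<in> Q}"
    using open_vimage_line_through[OF Q(1)] by (meson openE)
  \<comment> \<open>Unit vectors \<open>w\<close> with \<open>w \<bullet> u \<ge> c\<close> have
    squared distance \<open>2 - 2 * (w \<bullet> u)\<close> from \<open>u\<close>, which is less
    than \<open>\<epsilon>\<^sup>2\<close>; the maximum with 1/2 keeps \<open>c\<close>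
    positive.\<close>
  define c where "c = max (1 / 2) (1 - \<epsilon>\<^sup>2 / 4)"
  have c: "c > 0" "c < 1" "2 - 2 * c < \<epsilon>\<^sup>2" using \<epsilon>(1) by (auto simp: c_def max_def field_simps)
  define G where "G = (\<lambda>v. max 0 ((v \<bullet> u) * (v \<bullet> u) * inverse (v \<bullet> v) - c))"
  define g where "g = (\<lambda>L. G (SOME v. v \<noteq> 0 \<and> L = line_through v))"
  \<comment> \<open>The threshold is included here, which makes this set compact, while positivity
    of \<open>g\<close> is an open condition.\<close>
  define C where "C = line_through ` {v. norm v = 1 \<and> (v \<bullet> u) * (v \<bullet> u) \<ge> c}"
  have g: "g (line_through v) = G v" if v: "v \<noteq> 0" for v
  proof -
    have "\<exists>w. w \<noteq> 0 \<and> line_through v = line_through w" using v by blast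
    from someI_ex[OF this] obtain w where w: "w \<noteq> 0" "line_through v = line_through w" "g (line_through v) = G w"
      unfolding g_def by blast
    then obtain a where "a \<noteq> 0" "w = a *\<^sub>R v"
      using line_through_eq_iff[OF v w(1)] by blast
    then have "G w = G v" by (simp add: G_def field_simps)
    then show ?thesis using w by simp
  qed
  have Glip: "locally_lipschitz_at G v" if "v \<noteq> 0" for v
  proof -
    have vu: "locally_lipschitz_at (\<lambda>v. v \<bullet> u) v"
      by (rule locally_lipschitz_at_bounded_linear) (rule bounded_linear_inner_left)
    have "locally_lipschitz_at (\<lambda>v. \<Sum>i\<in>Basis. (v \<bullet> i) * (v \<bullet> i)) v"
      by (intro locally_lipschitz_at_sum locally_lipschitz_at_mult locally_lipschitz_at_bounded_linear
          bounded_linear_inner_left) simp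
    then have vv: "locally_lipschitz_at (\<lambda>v. v \<bullet> v) v"
      by (simp flip: euclidean_inner)
    \<comment> \<open>Subtraction of \<open>c\<close> is written as a sum over the booleans, so that
      the lemma on sums applies.\<close>
    have "locally_lipschitz_at (\<lambda>v. \<Sum>b\<in>UNIV. if b then (v \<bullet> u) * (v \<bullet> u) * inverse (v \<bullet> v) else - c) v"
    proof (rule locally_lipschitz_at_sum)
      show "locally_lipschitz_at (\<lambda>v. if b then (v \<bullet> u) * (v \<bullet> u) * inverse (v \<bullet> v) else - c) v" for b
        using that by (cases b) (simp_all add: locally_lipschitz_at_mult locally_lipschitz_at_inverse vu vv)
    qed simp
    then have "locally_lipschitz_at (\<lambda>v. (v \<bullet> u) * (v \<bullet> u) * inverse (v \<bullet> v) - c) v"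
      by (simp add: UNIV_bool)
    then show ?thesis unfolding G_def by (rule locally_lipschitz_at_pos_part)
  qed
  have GC: "line_through v \<in> C" if "v \<noteq> 0" "G v > 0" for v
  proof -
    define w where "w = (1 / norm v) *\<^sub>R v"
    have w: "norm w = 1" "line_through w = line_through v" using that(1) by (simp_all add: w_def)
    have "w \<noteq> 0" using w(1) by auto
    then have "G w = G v" using g[of w] g[OF that(1)] w(2) by simp
    moreover have "G w = max 0 ((w \<bullet> u) * (w \<bullet> u) - c)" using w(1) by (simp add: G_def dot_square_norm)
    ultimately have "(w \<bullet> u) * (w \<bullet> u) \<ge> c" using that(2) by (simp add: less_max_iff_disj)
    then have "line_through w \<in> C" unfolding C_def using w(1) by (intro imageI) simp
    then show ?thesis using w(2) by simp
  qed
  show ?thesis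
  proof (intro exI[of _ g] exI[of _ C] conjI allI impI)
    have "compact ({v. norm v = 1} \<inter> {v. (v \<bullet> u) * (v \<bullet> u) \<ge> c})"
    proof (rule compact_Int_closed)
      show "compact {v::real^3. norm v = 1}" using compact_sphere[of "0::real^3" 1] by (simp add: sphere_def)
      show "closed {v. (v \<bullet> u) * (v \<bullet> u) \<ge> c}" by (intro closed_Collect_le continuous_intros)
    qed
    moreover have "{v. norm v = 1} \<inter> {v. (v \<bullet> u) * (v \<bullet> u) \<ge> c} = {v. norm v = 1 \<and> (v \<bullet> u) * (v \<bullet> u) \<ge> c}" by auto
    ultimately show "compact C"
      unfolding C_def
      by (intro compact_continuous_image continuous_on_subset[OF continuous_on_line_through]) auto
    show "C \<subseteq> Q"
    proof
      fix L assume "L \<in> C"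
      then obtain v where v: "norm v = 1" "(v \<bullet> u) * (v \<bullet> u) \<ge> c" "L = line_through v" by (auto simp: C_def)
      \<comment> \<open>Of the two unit vectors on the line, this one makes an acute or right angle
        with \<open>u\<close>; as its cosine lies between 0 and 1, it is at least its own square and
        hence at least \<open>c\<close>.\<close>
      define w where "w = (if v \<bullet> u \<ge> 0 then v else - v)"
      have w: "norm w = 1" "w \<bullet> u \<ge> 0" "(w \<bullet> u) * (w \<bullet> u) \<ge> c" using v by (auto simp: w_def)
      have Lw: "L = line_through w" using v(3) line_through_scaleR[of "-1" v] by (simp add: w_def)
      have "w \<bullet> u \<le> 1" using norm_cauchy_schwarz[of w u] w(1) u(1) by simp
      then have "(w \<bullet> u) * (w \<bullet> u) \<le> w \<bullet> u" using w(2) by (simp add: mult_left_le)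
      then have "w \<bullet> u \<ge> c" using w(3) by linarith
      have "(norm (u - w))\<^sup>2 = 2 - 2 * (w \<bullet> u)"
      proof -
        have "u \<bullet> u = 1" "w \<bullet> w = 1" using w(1) u(1) by (simp_all add: dot_square_norm)
        then show ?thesis
          unfolding power2_norm_eq_inner inner_diff_left inner_diff_right using inner_commute[of u w] by simp
      qed
      also have "\<dots> < \<epsilon>\<^sup>2" using c(3) \<open>w \<bullet> u \<ge> c\<close> by linarith
      finally have "norm (u - w) < \<epsilon>" using \<epsilon>(1) by (simp add: power_less_imp_less_base)
      then have "w \<in> ball u \<epsilon>" by (simp add: dist_norm)
      then show "L \<in> Q" using \<epsilon>(2) Lw by blast
    qed
    have "u \<noteq> 0" using u(1) by auto
    then show "g L0 > 0" using u c by (simp add: g G_def dot_square_norm)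
    show "g L \<ge> 0" for L by (simp add: g_def G_def)
    show "L \<in> C" if "g L > 0" for L
    proof -
      obtain v where v: "v \<noteq> 0" "L = line_through v" by (rule line_through_surj)
      then show ?thesis using GC[OF v(1)] g[OF v(1)] that by simp
    qed
    have "open ({v. v \<noteq> 0} \<inter> {v. (v \<bullet> u) * (v \<bullet> u) > c * (v \<bullet> v)})"
      by (intro open_Int open_Collect_neq open_Collect_less continuous_intros)
    then have "open (line_through ` ({v. v \<noteq> 0} \<inter> {v. (v \<bullet> u) * (v \<bullet> u) > c * (v \<bullet> v)}))"
      by (rule open_line_through_image) simp
    moreover have "line_through ` ({v. v \<noteq> 0} \<inter> {v. (v \<bullet> u) * (v \<bullet> u) > c * (v \<bullet> v)}) = {L. g L > 0}"
    proof -
      have Gpos: "G v > 0 \<longleftrightarrow> (v \<bullet> u) * (v \<bullet> u) > c * (v \<bullet> v)" if "v \<noteq> 0" for v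
        using that pos_less_divide_eq[of "v \<bullet> v" c "(v \<bullet> u) * (v \<bullet> u)"]
        unfolding G_def less_max_iff_disj divide_inverse[symmetric] by simp
      show ?thesis
      proof (intro equalityI subsetI)
        fix L assume "L \<in> {L. g L > 0}"
        moreover obtain v where v: "v \<noteq> 0" "L = line_through v" by (rule line_through_surj)
        ultimately show "L \<in> line_through ` ({v. v \<noteq> 0} \<inter> {v. (v \<bullet> u) * (v \<bullet> u) > c * (v \<bullet> v)})"
          using Gpos[OF v(1)] g[OF v(1)] by simp
      qed (use Gpos g in auto)
    qed
    ultimately show "open {L. g L > 0}" by simp
    show "locally_lipschitz_at (\<lambda>v. g (line_through v)) v" if "v \<noteq> 0" for v
      by (rule locally_lipschitz_at_cong[OF Glip[OF that], of "- {0}"]) (simp_all add: that g open_Compl)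
  qed
qed

text \<open>The power map is proper, and the roots of a subset of the open unit disc stay in the
  disc. Hence bumps pulled back along a branched chart have support in a compact part of its
  domain.\<close>

lemma branch_disc_compact_preimage:
  assumes W: "branch_disc \<phi> p m W" and C: "compact C" "C \<subseteq> \<phi> ` W"
  shows "compact (W \<inter> \<phi> -` C)"
proof -
  obtain h h' k k' where h: "homeomorphism W (ball (0::complex) 1) h h'"
    and k: "homeomorphism (\<phi> ` W) (ball (0::complex) 1) k k'"
    and hk: "\<And>x. x \<in> W \<Longrightarrow> k (\<phi> x) = h x ^ (m + 1)"
    using W unfolding branch_disc_def by blast
  define Z where "Z = {z. z ^ (m + 1) \<in> k ` C}"
  have kC: "compact (k ` C)"
    using C by (intro compact_continuous_image continuous_on_subset[OF homeomorphism_cont1[OF k]])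
  have kball: "k ` C \<subseteq> ball 0 1" using C(2) homeomorphism_image1[OF k] by blast
  have Zball: "Z \<subseteq> ball 0 1"
  proof
    fix z assume "z \<in> Z"
    then have "norm (z ^ (m + 1)) < 1" using kball by (auto simp: Z_def simp del: power_Suc)
    then show "z \<in> ball 0 1" by (simp add: norm_power power_less_one_iff del: power_Suc)
  qed
  have "closed ((\<lambda>z. z ^ (m + 1)) -` (k ` C))"
    using compact_imp_closed[OF kC] by (intro continuous_closed_vimage) auto
  then have "compact Z"
    unfolding Z_def vimage_def[symmetric]
    using bounded_subset[OF bounded_ball Zball] by (simp add: compact_eq_bounded_closed Z_def vimage_def)
  then have "compact (h' ` Z)"
    by (intro compact_continuous_image continuous_on_subset[OF homeomorphism_cont2[OF h] Zball])
  moreover have "W \<inter> \<phi> -` C = h' ` Z"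
  proof (intro equalityI subsetI)
    fix x assume x: "x \<in> W \<inter> \<phi> -` C"
    then have "h x ^ (m + 1) \<in> k ` C" using hk[of x] by (auto simp del: power_Suc intro!: image_eqI[of _ k "\<phi> x"])
    then have "h x \<in> Z" by (simp add: Z_def)
    moreover have "x = h' (h x)" using x homeomorphism_apply1[OF h] by simp
    ultimately show "x \<in> h' ` Z" by blast
  next
    fix x assume "x \<in> h' ` Z"
    then obtain z where z: "z \<in> Z" "x = h' z" by blast
    have zb: "z \<in> ball 0 1" using z(1) Zball by blast
    then have xW: "x \<in> W" "h x = z" using z(2) homeomorphism_image2[OF h] homeomorphism_apply2[OF h] by auto
    obtain y where y: "y \<in> C" "k (\<phi> x) = k y" using z(1) hk[OF xW(1)] xW(2) by (auto simp: Z_def simp del: power_Suc)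
    have "\<phi> x \<in> \<phi> ` W" "y \<in> \<phi> ` W" using xW y(1) C(2) by auto
    then have "\<phi> x = y" using y(2) homeomorphism_apply1[OF k] by metis
    then show "x \<in> W \<inter> \<phi> -` C" using xW y(1) by simp
  qed
  ultimately show ?thesis by simp
qed

section \<open>Bump charts on the surface\<close>

context equivariant_branched_map
begin

text \<open>\<open>K\<close> contains all points where the bump \<open>g \<circ> \<phi>\<close> is
  positive and is closed in the ambient space, so the extension by zero vanishes near every point
  outside \<open>U\<close>. The sheet \<open>u\<close> with section \<open>q\<close> is the chosen
  lift of the patch.\<close>

definition bump_chart ::
    "'s \<Rightarrow> 's set \<Rightarrow> ('s \<Rightarrow> rp2) \<Rightarrow> 'e set \<Rightarrow> ('s \<Rightarrow> 'e) \<Rightarrow> (rp2 \<Rightarrow> real) \<Rightarrow> 's set \<Rightarrow> bool" where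
  "bump_chart p U \<phi> u q g K \<longleftrightarrow> p \<in> U \<and> openin (top_of_set S) U \<and> develops E \<pi> dev (U, \<phi>) \<and>
     openin (top_of_set E) u \<and> homeomorphism u U \<pi> q \<and>
     (\<forall>L. g L \<ge> 0) \<and> (\<forall>v. v \<noteq> 0 \<longrightarrow> locally_lipschitz_at (\<lambda>v. g (line_through v)) v) \<and>
     closed K \<and> K \<subseteq> U \<and> (\<forall>x\<in>U. g (\<phi> x) > 0 \<longrightarrow> x \<in> K) \<and>
     g (\<phi> p) > 0 \<and> openin (top_of_set S) {x \<in> U. g (\<phi> x) > 0}"

lemma bump_chart_exists:
  assumes p: "p \<in> S"
  shows "\<exists>U \<phi> u q g K. bump_chart p U \<phi> u q g K"
proof -
  obtain y where y: "y \<in> E" "\<pi> y = p" using \<pi>_surj[OF p] by blast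
  obtain u' V q where V': "y \<in> u'" "openin (top_of_set E) u'" "\<pi> y \<in> V" "openin (top_of_set S) V"
    and q: "homeomorphism u' V \<pi> q"
    by (rule covering_space_local_homeomorphism[OF cov y(1)])
  note V = V'(4,3,2,1)
  have "p \<in> V" using V(2) y by simp
  obtain U \<phi> where U: "openin (top_of_set S) U" "p \<in> U" "U \<subseteq> V" "branch_disc \<phi> p (n p) U" "\<phi> \<in> extensional U"
    "develops E \<pi> dev (U, \<phi>)"
    by (rule developing_chart[OF p V(1) \<open>p \<in> V\<close>])
  have q': "homeomorphism V u' q \<pi>" using q homeomorphism_symD by blast
  have hom: "homeomorphism (q ` U) U \<pi> q"
    using homeomorphism_restrict[OF q' U(3)] homeomorphism_symD by blast
  have "openin (top_of_set V) U" using U(1,3) openin_imp_subset[OF V(1)] by (metis openin_subset_trans)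
  then have "openin (top_of_set u') (q ` U)" by (rule homeomorphism_imp_open_map[OF q'])
  then have ou: "openin (top_of_set E) (q ` U)" using V(3) openin_trans by blast
  have \<phi>U: "open (\<phi> ` U)" "\<phi> p \<in> \<phi> ` U" using U(2,4) by (simp_all add: branch_disc_def)
  obtain g C where g: "compact C" "C \<subseteq> \<phi> ` U" "g (\<phi> p) > (0::real)" "\<forall>L. g L \<ge> 0" "\<forall>L. g L > 0 \<longrightarrow> L \<in> C"
    "open {L. g L > 0}" "\<forall>v. v \<noteq> 0 \<longrightarrow> locally_lipschitz_at (\<lambda>v. g (line_through v)) v"
    using rp2_bump_function[OF \<phi>U] by (elim exE conjE) (rule that)
  \<comment> \<open>Compactness gives closedness in the Hausdorff space that contains the surface,
    and not merely in \<open>U\<close>.\<close>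
  have K: "closed (U \<inter> \<phi> -` C)"
    using branch_disc_compact_preimage[OF U(4) g(1,2)] by (rule compact_imp_closed)
  have "openin (top_of_set U) (U \<inter> \<phi> -` {L. g L > 0})"
    using branch_disc_continuous_on[OF U(4)] g(6) by (rule continuous_openin_preimage_gen)
  moreover have "U \<inter> \<phi> -` {L. g L > 0} = {x \<in> U. g (\<phi> x) > 0}" by auto
  ultimately have o: "openin (top_of_set S) {x \<in> U. g (\<phi> x) > 0}" using U(1) openin_trans by metis
  have "bump_chart p U \<phi> (q ` U) q g (U \<inter> \<phi> -` C)"
    unfolding bump_chart_def using U(1,2,6) ou hom g(3,4,5,7) K o by simp
  then show ?thesis by (intro exI)
qed

end

section \<open>The averaged matrix\<close>

locale holonomy_deformation = equivariant_branched_map S E \<pi> e T dev \<rho> n B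
  for S :: "'s::t2_space set" and E :: "'e::topological_space set" and \<pi> e T dev \<rho> n B +
  fixes P :: "'s set" and U \<phi> u q g K
  assumes hom: "\<rho> \<in> hom \<Gamma> PSL3_group" and S_compact: "compact S" and P: "finite P"
    and charts: "\<And>p. p \<in> P \<Longrightarrow> bump_chart p (U p) (\<phi> p) (u p) (q p) (g p) (K p)"
    and cover: "\<And>x. x \<in> S \<Longrightarrow> \<exists>p\<in>P. x \<in> U p \<and> g p (\<phi> p x) > 0"
begin

lemma chart:
  assumes "p \<in> P"
  shows "openin (top_of_set S) (U p)" "develops E \<pi> dev (U p, \<phi> p)" "openin (top_of_set E) (u p)"
    "homeomorphism (u p) (U p) \<pi> (q p)" "\<And>L. g p L \<ge> 0"
    "\<And>v. v \<noteq> 0 \<Longrightarrow> locally_lipschitz_at (\<lambda>v. g p (line_through v)) v"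
    "closed (K p)" "K p \<subseteq> U p" "\<And>x. x \<in> U p \<Longrightarrow> g p (\<phi> p x) > 0 \<Longrightarrow> x \<in> K p"
  using charts[OF assms] unfolding bump_chart_def by blast+

definition f :: "'s \<Rightarrow> 's \<Rightarrow> real" where
  "f p x = (if x \<in> U p then g p (\<phi> p x) else 0)"

text \<open>If \<open>\<pi> y\<close> lies outside \<open>U p\<close> the value is arbitrary, but it
  then enters \<open>M\<close> with weight \<open>f p (\<pi> y) = 0\<close>.\<close>

definition \<gamma> :: "'s \<Rightarrow> 'e \<Rightarrow> (real \<Rightarrow> 's) set" where
  "\<gamma> p y = (SOME \<delta>. \<delta> \<in> carrier \<Gamma> \<and> T \<delta> (q p (\<pi> y)) = y)"

text \<open>A convex combination of matrices which, wherever the weight is nonzero, are the identity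
  for \<open>\<rho>' = \<rho>\<close>. The determinant of the average is not controlled, only its
  invertibility.\<close>

definition M :: "'s representation \<Rightarrow> 'e \<Rightarrow> real^3^3" where
  "M \<rho>' y = (\<Sum>p\<in>P. (f p (\<pi> y) / (\<Sum>p\<in>P. f p (\<pi> y))) *\<^sub>R (\<rho>' (\<gamma> p y) ** matrix_inv (\<rho> (\<gamma> p y))))"

definition deformed :: "'s representation \<Rightarrow> 'e \<Rightarrow> rp2" where
  "deformed \<rho>' y = proj_act (M \<rho>' y) (dev y)"

lemma f_nonneg: "p \<in> P \<Longrightarrow> f p x \<ge> 0"
  using chart(5) by (simp add: f_def)

lemma f_sum_pos:
  assumes "x \<in> S"
  shows "(\<Sum>p\<in>P. f p x) > 0"
proof -
  obtain p where p: "p \<in> P" "x \<in> U p" "g p (\<phi> p x) > 0" using cover[OF assms] by blast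
  then have "f p x > 0" by (simp add: f_def)
  then show ?thesis using P p(1) f_nonneg by (intro sum_pos2[of P p]) auto
qed

lemma q_in:
  assumes "p \<in> P" "x \<in> U p"
  shows "q p x \<in> u p" "q p x \<in> E" "\<pi> (q p x) = x"
proof -
  show "q p x \<in> u p" using homeomorphism_image2[OF chart(4)[OF assms(1)]] assms(2) by blast
  then show "q p x \<in> E" using openin_imp_subset[OF chart(3)[OF assms(1)]] by blast
  show "\<pi> (q p x) = x" using homeomorphism_apply2[OF chart(4)[OF assms(1)] assms(2)] .
qed

lemma \<gamma>:
  assumes "p \<in> P" "y \<in> E" "\<pi> y \<in> U p"
  shows "\<gamma> p y \<in> carrier \<Gamma>" "T (\<gamma> p y) (q p (\<pi> y)) = y"
proof -
  obtain \<delta> where "\<delta> \<in> carrier \<Gamma>" "T \<delta> (q p (\<pi> y)) = y"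
    using deck_trans[OF q_in(2)[OF assms(1,3)] assms(2)] q_in(3)[OF assms(1,3)] by metis
  then have "\<exists>\<delta>. \<delta> \<in> carrier \<Gamma> \<and> T \<delta> (q p (\<pi> y)) = y" by blast
  from someI_ex[OF this] show "\<gamma> p y \<in> carrier \<Gamma>" "T (\<gamma> p y) (q p (\<pi> y)) = y"
    unfolding \<gamma>_def by blast+
qed

lemma \<gamma>_eqI:
  assumes "p \<in> P" "y \<in> E" "\<pi> y \<in> U p" "\<delta> \<in> carrier \<Gamma>" "T \<delta> (q p (\<pi> y)) = y"
  shows "\<gamma> p y = \<delta>"
  using deck_inj[OF \<gamma>(1)[OF assms(1-3)] assms(4) q_in(2)[OF assms(1,3)]] \<gamma>(2)[OF assms(1-3)] assms(5) by simp

text \<open>The weights depend only on \<open>\<pi> y\<close>, and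
  \<open>\<gamma> p (T \<delta> y)\<close> is the product of \<open>\<delta>\<close> and
  \<open>\<gamma> p y\<close>; so \<open>\<rho>' \<delta>\<close> factors out on the left of every
  summand and the inverse of \<open>\<rho> \<delta>\<close> on the right.\<close>

lemma M_equivariant:
  assumes \<rho>': "\<rho>' \<in> hom \<Gamma> PSL3_group" and \<delta>: "\<delta> \<in> carrier \<Gamma>" and y: "y \<in> E"
  shows "M \<rho>' (T \<delta> y) = \<rho>' \<delta> ** M \<rho>' y ** matrix_inv (\<rho> \<delta>)"
proof -
  have \<pi>y: "\<pi> (T \<delta> y) = \<pi> y" by (rule deck_\<pi>[OF \<delta> y])
  define a where "a = (\<lambda>p. f p (\<pi> y) / (\<Sum>p\<in>P. f p (\<pi> y)))"
  have term_eq: "a p *\<^sub>R (\<rho>' (\<gamma> p (T \<delta> y)) ** matrix_inv (\<rho> (\<gamma> p (T \<delta> y)))) =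
      a p *\<^sub>R (\<rho>' \<delta> ** (\<rho>' (\<gamma> p y) ** matrix_inv (\<rho> (\<gamma> p y))) ** matrix_inv (\<rho> \<delta>))" if p: "p \<in> P" for p
  proof (cases "\<pi> y \<in> U p")
    case True
    note g = \<gamma>[OF p y True]
    have "T (\<delta> \<otimes>\<^bsub>\<Gamma>\<^esub> \<gamma> p y) (q p (\<pi> y)) = T \<delta> y"
      using deck_mult(2)[OF \<delta> g(1) q_in(2)[OF p True]] g(2) by simp
    then have "\<gamma> p (T \<delta> y) = \<delta> \<otimes>\<^bsub>\<Gamma>\<^esub> \<gamma> p y"
      using mult_in[OF \<delta> g(1)] deck_in[OF \<delta> y] True \<pi>y by (intro \<gamma>_eqI[OF p]) simp_all
    moreover have "\<rho>' (\<delta> \<otimes>\<^bsub>\<Gamma>\<^esub> \<gamma> p y) = \<rho>' \<delta> ** \<rho>' (\<gamma> p y)" "\<rho> (\<delta> \<otimes>\<^bsub>\<Gamma>\<^esub> \<gamma> p y) = \<rho> \<delta> ** \<rho> (\<gamma> p y)"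
      using hom_mult[OF \<rho>' \<delta> g(1)] hom_mult[OF hom \<delta> g(1)] by (simp_all add: PSL3_group_def)
    moreover have "matrix_inv (\<rho> \<delta> ** \<rho> (\<gamma> p y)) = matrix_inv (\<rho> (\<gamma> p y)) ** matrix_inv (\<rho> \<delta>)"
      using PSL3_det(2)[OF \<rho>[OF \<delta>]] PSL3_det(2)[OF \<rho>[OF g(1)]] by (rule matrix_inv_mult)
    ultimately show ?thesis by (simp add: matrix_mul_assoc)
  next
    case False
    then show ?thesis by (simp add: a_def f_def)
  qed
  have "M \<rho>' (T \<delta> y) = (\<Sum>p\<in>P. a p *\<^sub>R (\<rho>' (\<gamma> p (T \<delta> y)) ** matrix_inv (\<rho> (\<gamma> p (T \<delta> y)))))"
    by (simp add: M_def a_def \<pi>y)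
  also have "\<dots> = (\<Sum>p\<in>P. \<rho>' \<delta> ** (a p *\<^sub>R (\<rho>' (\<gamma> p y) ** matrix_inv (\<rho> (\<gamma> p y)))) ** matrix_inv (\<rho> \<delta>))"
    by (intro sum.cong refl) (simp add: term_eq matrix_scaleR_left matrix_scaleR_right)
  also have "\<dots> = \<rho>' \<delta> ** M \<rho>' y ** matrix_inv (\<rho> \<delta>)"
    by (simp add: M_def a_def matrix_mult_sum_left matrix_mult_sum_right)
  finally show ?thesis .
qed

end

section \<open>Deformations of the developing map\<close>

text \<open>A vector in the kernel satisfies \<open>norm v \<le> norm v / 2\<close>.\<close>

lemma near_identity_det_nonzero:
  fixes X :: "real^'n^'n"
  assumes "\<And>v. norm (X *v v - v) \<le> norm v / 2"
  shows "det X \<noteq> 0"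
proof -
  have "x = 0" if "X *v x = 0" for x
    using assms[of x] that by simp
  then have "\<exists>Y. Y ** X = mat 1" by (simp add: matrix_left_invertible_ker)
  then show ?thesis by (simp flip: invertible_left_inverse invertible_det_nz)
qed

context holonomy_deformation
begin

text \<open>Near \<open>y0\<close> only the patches around \<open>\<pi> y0\<close> contribute, each
  with a constant group element and with a weight that is a function of \<open>dev\<close>. So
  \<open>M\<close> is a function of \<open>dev\<close> there, and closeness at finitely many
  elements controls it on all of \<open>Z\<close>.\<close>

lemma local_deformation:
  assumes y0: "y0 \<in> E"
  shows "\<exists>Z J \<epsilon>. openin (top_of_set E) Z \<and> y0 \<in> Z \<and> finite J \<and> J \<subseteq> carrier \<Gamma> \<and> \<epsilon> > 0 \<and>
    (\<forall>\<rho>'. (\<forall>\<delta>\<in>J. norm (\<rho>' \<delta> ** matrix_inv (\<rho> \<delta>) - mat 1) < \<epsilon>) \<longrightarrow>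
      (\<forall>z\<in>Z. det (M \<rho>' z) \<noteq> 0 \<and> has_branch_order E (deformed \<rho>') z (n (\<pi> z))))"
proof -
  define I where "I = {p \<in> P. \<pi> y0 \<in> U p}"
  define g0 where "g0 = (\<lambda>p. \<gamma> p y0)"
  have I: "p \<in> P" "\<pi> y0 \<in> U p" "g0 p \<in> carrier \<Gamma>" "T (g0 p) (q p (\<pi> y0)) = y0" if "p \<in> I" for p
    using that \<gamma>[of p y0] y0 by (simp_all add: I_def g0_def)
  have "\<forall>p\<in>I. \<exists>W A. openin (top_of_set E) W \<and> y0 \<in> W \<and> \<pi> ` W \<subseteq> U p \<and> A \<in> PSL3 \<and>
      (\<forall>z\<in>W. dev z = proj_act A (\<phi> p (\<pi> z)))"
  proof
    fix p assume p: "p \<in> I"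
    obtain W A where "openin (top_of_set E) W" "y0 \<in> W" "\<pi> ` W \<subseteq> U p" "A \<in> PSL3"
      "\<And>z. z \<in> W \<Longrightarrow> dev z = proj_act A (\<phi> p (\<pi> z))"
      using developsE[OF chart(2)[OF I(1)[OF p]] y0 I(2)[OF p]] by metis
    then show "\<exists>W A. openin (top_of_set E) W \<and> y0 \<in> W \<and> \<pi> ` W \<subseteq> U p \<and> A \<in> PSL3 \<and>
      (\<forall>z\<in>W. dev z = proj_act A (\<phi> p (\<pi> z)))" by (intro exI conjI ballI)
  qed
  then obtain W A where WA: "\<forall>p\<in>I. openin (top_of_set E) (W p) \<and> y0 \<in> W p \<and> \<pi> ` W p \<subseteq> U p \<and> A p \<in> PSL3 \<and>
      (\<forall>z\<in>W p. dev z = proj_act (A p) (\<phi> p (\<pi> z)))"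
    unfolding bchoice_iff by blast
  \<comment> \<open>For a patch around \<open>\<pi> y0\<close>, \<open>W p\<close> makes
    \<open>dev\<close> a projective image of the chart and the translated sheet makes
    \<open>\<gamma> p\<close> constant; for any other patch the complement of \<open>K p\<close>
    makes the weight vanish.\<close>
  define N where "N = (\<lambda>p. if p \<in> I then W p \<inter> T (g0 p) ` u p else E \<inter> \<pi> -` (S - K p))"
  have N: "openin (top_of_set E) (N p)" "y0 \<in> N p" if p: "p \<in> P" for p
  proof -
    have "openin (top_of_set E) (N p) \<and> y0 \<in> N p"
    proof (cases "p \<in> I")
      case True
      obtain T' where T': "homeomorphism E E (T (g0 p)) T'" using deck_homeomorphism[OF I(3)[OF True]] by blast
      have "openin (top_of_set E) (T (g0 p) ` u p)" by (rule homeomorphism_imp_open_map[OF T' chart(3)[OF p]])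
      moreover have "y0 \<in> T (g0 p) ` u p"
        using q_in(1)[OF p I(2)[OF True]] I(4)[OF True] by (metis imageI)
      ultimately show ?thesis using True WA by (simp add: N_def openin_Int)
    next
      case False
      have "openin (top_of_set S) (S - K p)"
        unfolding Diff_eq using chart(7)[OF p] by (intro openin_open_Int open_Compl)
      then have "openin (top_of_set E) (E \<inter> \<pi> -` (S - K p))"
        using \<pi>_cont \<pi>_S by (intro continuous_openin_preimage) auto
      moreover have "\<pi> y0 \<notin> K p" using False p chart(8)[OF p] by (auto simp: I_def)
      ultimately show ?thesis using False y0 \<pi>_S by (simp add: N_def)
    qed
    then show "openin (top_of_set E) (N p)" "y0 \<in> N p" by simp_all
  qed
  define Z0 where "Z0 = (\<Inter>p\<in>P. N p) \<inter> E"
  have Z0: "openin (top_of_set E) Z0" "y0 \<in> Z0"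
    using openin_INT[OF P, of "top_of_set E" N] N y0 by (simp_all add: Z0_def)
  have Z0N: "z \<in> N p" if "z \<in> Z0" "p \<in> P" for z p using that unfolding Z0_def by blast
  \<comment> \<open>The weights transported to the projective plane, where they can be evaluated at
    \<open>dev z\<close> without knowing \<open>z\<close>; \<open>b\<close> normalises them.\<close>
  define G where "G = (\<lambda>p L. if p \<in> I then g p (proj_act (matrix_inv (A p)) L) else 0)"
  define b where "b = (\<lambda>p L. G p L * inverse (\<Sum>p\<in>P. G p L))"
  have fG: "f p (\<pi> z) = G p (dev z)" if z: "z \<in> Z0" and p: "p \<in> P" for z p
  proof (cases "p \<in> I")
    case True
    then have zW: "z \<in> W p" using Z0N[OF z p] by (simp add: N_def)
    then have "dev z = proj_act (A p) (\<phi> p (\<pi> z))" "\<pi> z \<in> U p" "A p \<in> PSL3" using WA True by auto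
    then show ?thesis using True PSL3_det(1) by (simp add: f_def G_def)
  next
    case False
    then have "z \<in> E \<inter> \<pi> -` (S - K p)" using Z0N[OF z p] by (simp add: N_def)
    then have "\<pi> z \<in> U p \<Longrightarrow> \<not> g p (\<phi> p (\<pi> z)) > 0" using chart(9)[OF p] by blast
    then show ?thesis
      using False chart(5)[OF p, of "\<phi> p (\<pi> z)"] by (simp add: f_def G_def less_le)
  qed
  have \<gamma>g0: "\<gamma> p z = g0 p" if z: "z \<in> Z0" and p: "p \<in> I" for z p
  proof -
    have zN: "z \<in> W p" "z \<in> T (g0 p) ` u p" "z \<in> E"
      using Z0N[OF z I(1)[OF p]] p z by (simp_all add: Z0_def N_def)
    then obtain w where w: "w \<in> u p" "z = T (g0 p) w" by blast
    have "w \<in> E" using w(1) openin_imp_subset[OF chart(3)[OF I(1)[OF p]]] by blast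
    then have "\<pi> z = \<pi> w" using w(2) deck_\<pi>[OF I(3)[OF p]] by simp
    then have "q p (\<pi> z) = w" using homeomorphism_apply1[OF chart(4)[OF I(1)[OF p]] w(1)] by simp
    moreover have "\<pi> z \<in> U p" using WA p zN(1) by blast
    ultimately show ?thesis using w(2) by (intro \<gamma>_eqI[OF I(1)[OF p] zN(3) _ I(3)[OF p]]) simp_all
  qed
  obtain v0 where v0: "v0 \<noteq> 0" "dev y0 = line_through v0" by (rule line_through_surj)
  have Glip: "locally_lipschitz_at (\<lambda>v. G p (line_through v)) v0" if p: "p \<in> P" for p
  proof (cases "p \<in> I")
    case True
    have det: "det (matrix_inv (A p)) \<noteq> 0" using WA True PSL3_det(1) by (intro det_matrix_inv_nonzero) blast
    have "locally_lipschitz_at (\<lambda>v. matrix_inv (A p) *v v) v0"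
      by (rule locally_lipschitz_at_bounded_linear) (simp add: matrix_vector_mul_bounded_linear)
    moreover have "locally_lipschitz_at (\<lambda>v. g p (line_through v)) (matrix_inv (A p) *v v0)"
      using chart(6)[OF p] matrix_vector_mult_nonzero[OF det v0(1)] by blast
    ultimately have "locally_lipschitz_at (\<lambda>v. g p (line_through (matrix_inv (A p) *v v))) v0"
      by (rule locally_lipschitz_at_compose)
    then show ?thesis
    proof (rule locally_lipschitz_at_cong[of _ _ "- {0}"])
      show "g p (line_through (matrix_inv (A p) *v v)) = G p (line_through v)" if "v \<in> - {0}" for v
        using that True by (simp add: G_def proj_act_line_through)
    qed (use v0 in \<open>simp_all add: open_Compl\<close>)
  next
    case False
    then show ?thesis by (simp add: G_def)
  qed
  then have Gsum: "locally_lipschitz_at (\<lambda>v. \<Sum>p\<in>P. G p (line_through v)) v0"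
    using P by (intro locally_lipschitz_at_sum)
  have sum_pos: "(\<Sum>p\<in>P. G p (dev z)) > 0" if "z \<in> Z0" for z
  proof -
    have "(\<Sum>p\<in>P. G p (dev z)) = (\<Sum>p\<in>P. f p (\<pi> z))" using fG[OF that] by simp
    then show ?thesis using f_sum_pos \<pi>_S that by (simp add: Z0_def)
  qed
  then have "(\<Sum>p\<in>P. G p (line_through v0)) > 0" using Z0(2) v0(2) by metis
  then obtain r where r: "r > 0" "\<And>v. v \<in> ball v0 r \<Longrightarrow> (\<Sum>p\<in>P. G p (line_through v)) > 0"
    using locally_lipschitz_at_pos_nearby[OF Gsum] by blast
  have blip: "locally_lipschitz_at (\<lambda>v. b p (line_through v)) v0" if "p \<in> P" for p
    unfolding b_def using Glip[OF that] Gsum r(2)[of v0] r(1)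
    by (intro locally_lipschitz_at_mult locally_lipschitz_at_inverse) simp_all
  \<comment> \<open>The radius keeps the sum of the weights positive and excludes the
    origin.\<close>
  define V where "V = ball v0 (min r (norm v0))"
  have V: "open V" "0 \<notin> V" "v0 \<in> V" using r(1) v0(1) by (simp_all add: V_def)
  have G_nonneg: "G p L \<ge> 0" if "p \<in> P" for p L using chart(5)[OF that] by (simp add: G_def)
  have bnonneg: "b p L \<ge> 0" if "p \<in> P" for p L
    using G_nonneg that by (simp add: b_def sum_nonneg)
  have bone: "(\<Sum>p\<in>P. b p L) = 1" if "(\<Sum>p\<in>P. G p L) > 0" for L
    using that by (simp add: b_def flip: sum_distrib_right)
  have oneV: "(\<Sum>p\<in>P. b p L) = 1" if "L \<in> line_through ` V" for L
    using that r(2) by (intro bone) (auto simp: V_def)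
  obtain \<eta> D where \<eta>: "\<eta> > 0" and D: "open D" "line_through v0 \<in> D" and
    \<Phi>: "\<And>X. (\<And>p v. p \<in> P \<Longrightarrow> norm (X p *v v - v) \<le> \<eta> * norm v) \<Longrightarrow>
      (\<exists>\<Phi>'. homeomorphism D ((\<lambda>L. proj_act (\<Sum>p\<in>P. b p L *\<^sub>R X p) L) ` D) (\<lambda>L. proj_act (\<Sum>p\<in>P. b p L *\<^sub>R X p) L) \<Phi>') \<and>
      open ((\<lambda>L. proj_act (\<Sum>p\<in>P. b p L *\<^sub>R X p) L) ` D)"
    using perturbed_identity_local_homeomorphism[OF P v0(1) blip bnonneg open_line_through_image[OF V(1,2)] imageI[OF V(3)] oneV]
    by blast
  \<comment> \<open>\<open>\<eta>\<close> makes the perturbation a homeomorphism near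
    \<open>dev y0\<close>, and 1/2 makes \<open>M\<close> invertible by
    \<open>near_identity_det_nonzero\<close>.\<close>
  define \<epsilon> where "\<epsilon> = min \<eta> (1 / 2)"
  have \<epsilon>: "\<epsilon> > 0" "\<epsilon> \<le> \<eta>" "\<epsilon> \<le> 1 / 2" using \<eta> by (simp_all add: \<epsilon>_def)
  obtain W0 where W0: "W0 \<subseteq> Z0" "openin (top_of_set E) W0" "branch_disc dev y0 (n (\<pi> y0)) W0"
    by (rule has_branch_order_disc[OF ord[OF y0] Z0])
  \<comment> \<open>The branch disc \<open>W0\<close> supplies the continuity of \<open>dev\<close>
    that makes this set open.\<close>
  define Z where "Z = W0 \<inter> dev -` D"
  have "openin (top_of_set W0) Z"
    unfolding Z_def using branch_disc_continuous_on[OF W0(3)] D(1) by (rule continuous_openin_preimage_gen)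
  then have Z: "openin (top_of_set E) Z" using W0(2) openin_trans by blast
  have y0Z: "y0 \<in> Z" using W0(3) D(2) v0(2) by (simp add: Z_def branch_disc_def)
  have main: "det (M \<rho>' z) \<noteq> 0 \<and> has_branch_order E (deformed \<rho>') z (n (\<pi> z))"
    if close: "\<forall>\<delta>\<in>g0 ` I. norm (\<rho>' \<delta> ** matrix_inv (\<rho> \<delta>) - mat 1) < \<epsilon>" and z: "z \<in> Z" for \<rho>' z
  proof -
    \<comment> \<open>The default \<open>mat 1\<close> extends the bound to all patches; it does not
      change the sum, because \<open>G p\<close> vanishes for \<open>p\<close> outside
      \<open>I\<close>.\<close>
    define X where "X = (\<lambda>p. if p \<in> I then \<rho>' (g0 p) ** matrix_inv (\<rho> (g0 p)) else mat 1)"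
    have X: "norm (X p *v v - v) \<le> \<epsilon> * norm v" for p v
    proof (cases "p \<in> I")
      case True
      have "X p *v v - v = (X p - mat 1) *v v" by (simp add: matrix_vector_mult_diff_rdistrib)
      also have "norm \<dots> \<le> norm (X p - mat 1) * norm v" by (rule norm_matrix_vector_mult_le)
      also have "\<dots> \<le> \<epsilon> * norm v"
        using close True by (intro mult_right_mono) (auto simp: X_def less_imp_le)
      finally show ?thesis .
    qed (use \<epsilon> in \<open>simp add: X_def\<close>)
    have MX: "M \<rho>' w = (\<Sum>p\<in>P. b p (dev w) *\<^sub>R X p)" if w: "w \<in> Z0" for w
      unfolding M_def
    proof (rule sum.cong[OF refl])
      fix p assume p: "p \<in> P"
      have s: "(\<Sum>p\<in>P. f p (\<pi> w)) = (\<Sum>p\<in>P. G p (dev w))" using fG[OF w] by (intro sum.cong) auto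
      show "(f p (\<pi> w) / (\<Sum>p\<in>P. f p (\<pi> w))) *\<^sub>R (\<rho>' (\<gamma> p w) ** matrix_inv (\<rho> (\<gamma> p w))) = b p (dev w) *\<^sub>R X p"
      proof (cases "p \<in> I")
        case True
        then show ?thesis using \<gamma>g0[OF w True] fG[OF w p] s by (simp add: b_def X_def divide_inverse)
      next
        case False
        then have "G p (dev w) = 0" by (simp add: G_def)
        then show ?thesis using fG[OF w p] by (simp add: b_def)
      qed
    qed
    have zZ0: "z \<in> Z0" using z W0(1) by (auto simp: Z_def)
    have "det (M \<rho>' z) \<noteq> 0"
    proof (rule near_identity_det_nonzero)
      fix v
      have one: "(\<Sum>p\<in>P. b p (dev z)) = 1" using bone sum_pos[OF zZ0] by blast
      \<comment> \<open>As the weights have sum 1, the deviation of the average from the identity is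
        the average of the deviations.\<close>
      have "M \<rho>' z *v v - v = (\<Sum>p\<in>P. b p (dev z) *\<^sub>R (X p *v v)) - (\<Sum>p\<in>P. b p (dev z)) *\<^sub>R v"
        unfolding MX[OF zZ0] one by (simp add: matrix_vector_mult_sum_left scaleR_matrix_vector_assoc[symmetric])
      also have "\<dots> = (\<Sum>p\<in>P. b p (dev z) *\<^sub>R (X p *v v - v))"
        by (simp add: scaleR_right_diff_distrib sum_subtractf scaleR_left.sum)
      also have "norm \<dots> \<le> (\<Sum>p\<in>P. b p (dev z) * (\<epsilon> * norm v))"
        using X bnonneg by (intro sum_norm_le) (simp add: mult_left_mono)
      also have "\<dots> = \<epsilon> * norm v" using one by (simp flip: sum_distrib_right)
      also have "\<dots> \<le> norm v / 2" using mult_right_mono[OF \<epsilon>(3), of "norm v"] by simp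
      finally show "norm (M \<rho>' z *v v - v) \<le> norm v / 2" .
    qed
    moreover have "has_branch_order E (deformed \<rho>') z (n (\<pi> z))"
    proof -
      have "norm (X p *v v - v) \<le> \<eta> * norm v" for p v
        using X[of p v] mult_right_mono[OF \<epsilon>(2), of "norm v"] by simp
      then obtain \<Phi>' where \<Phi>': "homeomorphism D ((\<lambda>L. proj_act (\<Sum>p\<in>P. b p L *\<^sub>R X p) L) ` D) (\<lambda>L. proj_act (\<Sum>p\<in>P. b p L *\<^sub>R X p) L) \<Phi>'"
        "open ((\<lambda>L. proj_act (\<Sum>p\<in>P. b p L *\<^sub>R X p) L) ` D)"
        using \<Phi>[of X] by blast
      have zE: "z \<in> E" using zZ0 by (simp add: Z0_def)
      show ?thesis
      proof (rule has_branch_order_postcompose[OF ord[OF zE] \<Phi>'(1) D(1) \<Phi>'(2) Z z])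
        fix w assume w: "w \<in> Z"
        then show "dev w \<in> D" by (simp add: Z_def)
        show "deformed \<rho>' w = proj_act (\<Sum>p\<in>P. b p (dev w) *\<^sub>R X p) (dev w)"
          using MX[of w] w W0(1) by (auto simp: deformed_def Z_def)
      qed
    qed
    ultimately show ?thesis by blast
  qed
  have "finite (g0 ` I)" using P by (simp add: I_def)
  moreover have "g0 ` I \<subseteq> carrier \<Gamma>" using I(3) by blast
  moreover have "\<forall>\<rho>'. (\<forall>\<delta>\<in>g0 ` I. norm (\<rho>' \<delta> ** matrix_inv (\<rho> \<delta>) - mat 1) < \<epsilon>) \<longrightarrow>
      (\<forall>z\<in>Z. det (M \<rho>' z) \<noteq> 0 \<and> has_branch_order E (deformed \<rho>') z (n (\<pi> z)))"
    by (intro allI impI ballI) (rule main)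
  ultimately show ?thesis
    using Z y0Z \<epsilon>(1) by (intro exI[of _ Z] exI[of _ "g0 ` I"] exI[of _ \<epsilon>] conjI)
qed

text \<open>The trailing inverse of \<open>\<rho> \<delta>\<close> in the transformed
  \<open>M\<close> cancels the factor produced by the equivariance of \<open>dev\<close>.\<close>

lemma deformed_equivariant:
  assumes \<rho>': "\<rho>' \<in> hom \<Gamma> PSL3_group" and \<delta>: "\<delta> \<in> carrier \<Gamma>" and y: "y \<in> E" and det: "det (M \<rho>' y) \<noteq> 0"
  shows "deformed \<rho>' (T \<delta> y) = proj_act (\<rho>' \<delta>) (deformed \<rho>' y)" "det (M \<rho>' (T \<delta> y)) \<noteq> 0"
proof -
  note d = PSL3_det(1)[OF \<rho>[OF \<delta>]]
  note di = det_matrix_inv_nonzero[OF d]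
  have P': "\<rho>' \<delta> \<in> PSL3" using hom_in_carrier[OF \<rho>' \<delta>] by (simp add: PSL3_group_def)
  show "det (M \<rho>' (T \<delta> y)) \<noteq> 0"
    using PSL3_det(1)[OF P'] det di by (simp add: M_equivariant[OF \<rho>' \<delta> y] det_mul)
  have "deformed \<rho>' (T \<delta> y) = proj_act (\<rho>' \<delta> ** M \<rho>' y ** matrix_inv (\<rho> \<delta>)) (proj_act (\<rho> \<delta>) (dev y))"
    by (simp add: deformed_def M_equivariant[OF \<rho>' \<delta> y] equiv[OF \<delta> y])
  also have "\<dots> = proj_act (\<rho>' \<delta>) (proj_act (M \<rho>' y) (dev y))"
    using d di det by (simp add: proj_act_mult)
  finally show "deformed \<rho>' (T \<delta> y) = proj_act (\<rho>' \<delta>) (deformed \<rho>' y)" by (simp add: deformed_def)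
qed

text \<open>By compactness finitely many of the sets \<open>Z y\<close> project onto a cover of the
  surface. Every point of \<open>E\<close> is a deck translate of a point in one of them, and
  equivariance carries over invertibility and branch order.\<close>

lemma global_deformation:
  "\<exists>J \<epsilon>. finite J \<and> J \<subseteq> carrier \<Gamma> \<and> \<epsilon> > 0 \<and>
    (\<forall>\<rho>'\<in>hom \<Gamma> PSL3_group. (\<forall>\<delta>\<in>J. norm (\<rho>' \<delta> ** matrix_inv (\<rho> \<delta>) - mat 1) < \<epsilon>) \<longrightarrow>
      equivariant_branched_map S E \<pi> e T (deformed \<rho>') \<rho>' n B)"
proof -
  have "\<forall>y\<in>E. \<exists>Z J \<epsilon>. openin (top_of_set E) Z \<and> y \<in> Z \<and> finite J \<and> J \<subseteq> carrier \<Gamma> \<and> \<epsilon> > 0 \<and>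
    (\<forall>\<rho>'. (\<forall>\<delta>\<in>J. norm (\<rho>' \<delta> ** matrix_inv (\<rho> \<delta>) - mat 1) < \<epsilon>) \<longrightarrow>
      (\<forall>z\<in>Z. det (M \<rho>' z) \<noteq> 0 \<and> has_branch_order E (deformed \<rho>') z (n (\<pi> z))))"
    using local_deformation by (rule ballI)
  then obtain Z J \<epsilon> where ZJ: "\<forall>y\<in>E. openin (top_of_set E) (Z y) \<and> y \<in> Z y \<and> finite (J y) \<and> J y \<subseteq> carrier \<Gamma> \<and> \<epsilon> y > 0 \<and>
    (\<forall>\<rho>'. (\<forall>\<delta>\<in>J y. norm (\<rho>' \<delta> ** matrix_inv (\<rho> \<delta>) - mat 1) < \<epsilon> y) \<longrightarrow>
      (\<forall>z\<in>Z y. det (M \<rho>' z) \<noteq> 0 \<and> has_branch_order E (deformed \<rho>') z (n (\<pi> z))))"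
    unfolding bchoice_iff by blast
  define C where "C = (\<lambda>y. \<pi> ` Z y) ` E"
  have Copen: "\<forall>c\<in>C. openin (top_of_set S) c" using ZJ covering_open_map[OF cov] by (auto simp: C_def)
  have SC: "S \<subseteq> \<Union>C"
  proof
    fix x assume "x \<in> S"
    then obtain y where "y \<in> E" "\<pi> y = x" using \<pi>_surj by blast
    then show "x \<in> \<Union>C" using ZJ by (auto simp: C_def)
  qed
  obtain C' where C': "C' \<subseteq> C" "finite C'" "S \<subseteq> \<Union>C'"
    using S_compact Copen SC unfolding compact_eq_openin_cover by meson
  then obtain Y where Y: "Y \<subseteq> E" "finite Y" "C' = (\<lambda>y. \<pi> ` Z y) ` Y"
    using finite_subset_image[of C' "\<lambda>y. \<pi> ` Z y" E] by (metis C_def)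
  define J' where "J' = (\<Union>y\<in>Y. J y)"
  \<comment> \<open>The inserted 1 makes the minimum meaningful even for empty
    \<open>Y\<close>.\<close>
  define \<epsilon>' where "\<epsilon>' = Min (insert 1 (\<epsilon> ` Y))"
  have \<epsilon>': "\<epsilon>' > 0" "\<And>y. y \<in> Y \<Longrightarrow> \<epsilon>' \<le> \<epsilon> y" using Y(1,2) ZJ by (auto simp: \<epsilon>'_def)
  have "equivariant_branched_map S E \<pi> e T (deformed \<rho>') \<rho>' n B"
    if \<rho>': "\<rho>' \<in> hom \<Gamma> PSL3_group" and close: "\<forall>\<delta>\<in>J'. norm (\<rho>' \<delta> ** matrix_inv (\<rho> \<delta>) - mat 1) < \<epsilon>'" for \<rho>'
  proof -
    have good: "det (M \<rho>' z) \<noteq> 0 \<and> has_branch_order E (deformed \<rho>') z (n (\<pi> z))" if y: "y \<in> Y" and z: "z \<in> Z y" for y z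
    proof -
      have "\<forall>\<delta>\<in>J y. norm (\<rho>' \<delta> ** matrix_inv (\<rho> \<delta>) - mat 1) < \<epsilon> y"
        using close \<epsilon>'(2)[OF y] y by (fastforce simp: J'_def)
      moreover have "y \<in> E" using y Y(1) by blast
      ultimately show ?thesis using ZJ z by blast
    qed
    have rep: "\<exists>y z \<delta>. y \<in> Y \<and> z \<in> Z y \<and> z \<in> E \<and> \<delta> \<in> carrier \<Gamma> \<and> T \<delta> z = w" if w: "w \<in> E" for w
    proof -
      have "\<pi> w \<in> \<Union>C'" using C'(3) \<pi>_S[OF w] by blast
      then obtain y z where yz: "y \<in> Y" "z \<in> Z y" "\<pi> z = \<pi> w" using Y(3) by auto
      have "z \<in> E" using yz(1,2) Y(1) ZJ openin_imp_subset by blast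
      then obtain \<delta> where "\<delta> \<in> carrier \<Gamma>" "T \<delta> z = w" using deck_trans[OF _ w yz(3)] by blast
      then show ?thesis using yz \<open>z \<in> E\<close> by blast
    qed
    have det: "det (M \<rho>' w) \<noteq> 0" if w: "w \<in> E" for w
    proof -
      obtain y z \<delta> where "y \<in> Y" "z \<in> Z y" "z \<in> E" "\<delta> \<in> carrier \<Gamma>" "T \<delta> z = w" using rep[OF w] by blast
      then show ?thesis using deformed_equivariant(2)[OF \<rho>'] good by blast
    qed
    have P': "\<rho>' \<delta> \<in> PSL3" if "\<delta> \<in> carrier \<Gamma>" for \<delta>
      using hom_in_carrier[OF \<rho>' that] by (simp add: PSL3_group_def)
    have order: "has_branch_order E (deformed \<rho>') w (n (\<pi> w))" if w: "w \<in> E" for w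
    proof -
      obtain y z \<delta> where z: "y \<in> Y" "z \<in> Z y" "z \<in> E" "\<delta> \<in> carrier \<Gamma>" "T \<delta> z = w" using rep[OF w] by blast
      obtain T' where T': "homeomorphism E E (T \<delta>) T'" using deck_homeomorphism[OF z(4)] by blast
      then have T'': "homeomorphism E E T' (T \<delta>)" using homeomorphism_symD by blast
      have T'w: "T' w = z" using homeomorphism_apply1[OF T' z(3)] z(5) by simp
      have "\<pi> z = \<pi> w" using deck_\<pi>[OF z(4,3)] z(5) by simp
      then have "has_branch_order E (deformed \<rho>') (T' w) (n (\<pi> w))" using good[OF z(1,2)] T'w by simp
      \<comment> \<open>By equivariance the deformed map near \<open>w\<close> is its restriction
        near \<open>z\<close>, preceded by \<open>T'\<close> and followed by
        \<open>\<rho>' \<delta>\<close>, neither of which changes the order.\<close>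
      then have "has_branch_order E (\<lambda>x. deformed \<rho>' (T' x)) w (n (\<pi> w))"
        by (rule has_branch_order_precompose[OF T'' openin_subtopology_self w openin_subtopology_self]) simp
      then show ?thesis
      proof (rule has_branch_order_postcompose[OF _ homeomorphism_proj_act open_UNIV open_UNIV openin_subtopology_self w])
        show "det (\<rho>' \<delta>) \<noteq> 0" using PSL3_det(1)[OF P'[OF z(4)]] .
        fix x assume x: "x \<in> E"
        then have T'x: "T' x \<in> E" using homeomorphism_image1[OF T''] by blast
        have "T \<delta> (T' x) = x" using homeomorphism_apply2[OF T' x] .
        then show "deformed \<rho>' x = proj_act (\<rho>' \<delta>) (deformed \<rho>' (T' x))"
          using deformed_equivariant(1)[OF \<rho>' z(4) T'x det[OF T'x]] by simp
      qed simp
    qed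
    show ?thesis
    proof (intro equivariant_branched_map.intro equivariant_branched_map_axioms.intro)
      show "deck_action S E \<pi> e T" by (rule deck_action_axioms)
    qed (use P' deformed_equivariant(1)[OF \<rho>' _ _ det] order B n in simp_all)
  qed
  moreover have "finite J'" "J' \<subseteq> carrier \<Gamma>" using Y(1,2) ZJ by (auto simp: J'_def)
  ultimately show ?thesis using \<epsilon>'(1) by blast
qed

end

context equivariant_branched_map
begin

text \<open>A bump chart is chosen at every point, and finitely many sets of positive bump cover the
  surface; with them the auxiliary locale is discharged.\<close>

lemma deformation:
  assumes hom: "\<rho> \<in> hom \<Gamma> PSL3_group" and S: "compact S"
  shows "\<exists>J \<epsilon>. finite J \<and> J \<subseteq> carrier \<Gamma> \<and> \<epsilon> > 0 \<and>
    (\<forall>\<rho>'\<in>hom \<Gamma> PSL3_group. (\<forall>\<delta>\<in>J. norm (\<rho>' \<delta> ** matrix_inv (\<rho> \<delta>) - mat 1) < \<epsilon>) \<longrightarrow>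
      (\<exists>dev'. equivariant_branched_map S E \<pi> e T dev' \<rho>' n B))"
proof -
  have "\<forall>p\<in>S. \<exists>U \<phi> u q g K. bump_chart p U \<phi> u q g K"
    using bump_chart_exists by (rule ballI)
  then obtain U \<phi> u q g K where charts: "\<forall>p\<in>S. bump_chart p (U p) (\<phi> p) (u p) (q p) (g p) (K p)"
    unfolding bchoice_iff by blast
  define Q where "Q = (\<lambda>p. {x \<in> U p. g p (\<phi> p x) > 0})"
  have Q: "openin (top_of_set S) (Q p)" "p \<in> Q p" if "p \<in> S" for p
    using charts that unfolding Q_def bump_chart_def by simp_all
  have Qopen: "\<forall>c\<in>Q ` S. openin (top_of_set S) c" and SQ: "S \<subseteq> \<Union>(Q ` S)" using Q by auto
  obtain C' where C': "C' \<subseteq> Q ` S" "finite C'" "S \<subseteq> \<Union>C'"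
    using S Qopen SQ unfolding compact_eq_openin_cover by meson
  then obtain P where P: "P \<subseteq> S" "finite P" "C' = Q ` P" using finite_subset_image by metis
  interpret holonomy_deformation S E \<pi> e T dev \<rho> n B P U \<phi> u q g K
  proof
    show "bump_chart p (U p) (\<phi> p) (u p) (q p) (g p) (K p)" if "p \<in> P" for p
      using charts that P(1) by blast
    show "\<exists>p\<in>P. x \<in> U p \<and> g p (\<phi> p x) > 0" if "x \<in> S" for x
      using that C'(3) P(3) by (auto simp: Q_def)
  qed (fact hom S P)+
  show ?thesis using global_deformation by blast
qed

lemma is_holonomy_charted:
  assumes "\<rho> \<in> hom \<Gamma> PSL3_group"
  shows "is_holonomy S E \<pi> e charted \<rho>"
  unfolding is_holonomy_def
proof (intro conjI exI[of _ dev] ballI)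
  fix \<gamma> assume \<gamma>: "\<gamma> \<in> carrier \<Gamma>"
  show "\<exists>T'. deck_transformation_of E \<pi> e \<gamma> T' \<and> (\<forall>y\<in>E. dev (T' y) = proj_act (\<rho> \<gamma>) (dev y))"
    using T[OF \<gamma>] equiv[OF \<gamma>] by (intro exI[of _ "T \<gamma>"]) simp
qed (fact assms charted_developing_map)+

end

section \<open>Openness\<close>

text \<open>Pushing a chart by the identity restricts it to its own domain, which changes nothing
  because charts are extensional.\<close>

lemma structures_isotopic_refl:
  assumes "branched_projective_structure S \<sigma>"
  shows "structures_isotopic S \<sigma> \<sigma>"
  unfolding structures_isotopic_def
proof (intro exI conjI)
  show "homeomorphism S S (\<lambda>x. x) (\<lambda>x. x)" by (rule homeomorphism_ident)
  then show "isotopic_to_id S (\<lambda>x. x)"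
    unfolding isotopic_to_id_def
    by (intro exI[of _ snd]) (auto intro: continuous_on_snd continuous_on_id)
  have push: "push_chart (\<lambda>x. x) (\<lambda>x. x) c = c" if "snd c \<in> extensional (fst c)" for c :: "'a chart"
    using that by (cases c) (simp add: push_chart_def comp_def extensional_restrict)
  have "snd c \<in> extensional (fst c)" if "c \<in> regular_charts \<sigma> \<union> branched_charts \<sigma>" for c
  proof -
    obtain U \<phi> where c: "c = (U, \<phi>)" by (cases c)
    have "regular_chart S (branch_points \<sigma>) c \<or> branched_chart S (branch_points \<sigma>) c"
      using that assms unfolding branched_projective_structure_def by blast
    then show ?thesis by (auto simp: c regular_chart_def branched_chart_def)
  qed
  then have "\<And>c. c \<in> regular_charts \<sigma> \<union> branched_charts \<sigma> \<Longrightarrow> push_chart (\<lambda>x. x) (\<lambda>x. x) c = c"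
    using push by blast
  then show "regular_charts \<sigma> = push_chart (\<lambda>x. x) (\<lambda>x. x) ` regular_charts \<sigma>"
    "branched_charts \<sigma> = push_chart (\<lambda>x. x) (\<lambda>x. x) ` branched_charts \<sigma>"
    by simp_all
qed simp

text \<open>Each structure lies in its own class by reflexivity, so the image of the holonomy map
  can be described by single structures.\<close>

lemma Union_RP2_moduli: "\<Union>(RP2_moduli S \<mu>) = structures_with_data S \<mu>"
proof -
  have "\<sigma> \<in> structures_with_data S \<mu> \<Longrightarrow> structures_isotopic S \<sigma> \<sigma>" for \<sigma>
    using structures_isotopic_refl by (auto simp: structures_with_data_def)
  then show ?thesis by (fastforce simp: RP2_moduli_def quotient_def)
qed

section \<open>Conjugation and passage to the quotient\<close>

text \<open>The developing map is replaced by its composition with \<open>A\<close>; the structure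
  and the deck transformations stay the same.\<close>

lemma is_holonomy_conjugate:
  assumes hol: "is_holonomy S E \<pi> e \<sigma> \<rho>" and A: "A \<in> PSL3"
    and hom: "\<rho>' \<in> hom (fundamental_group S (\<pi> e)) PSL3_group"
    and eq: "\<And>\<gamma>. \<gamma> \<in> carrier (fundamental_group S (\<pi> e)) \<Longrightarrow> \<rho>' \<gamma> = A ** \<rho> \<gamma> ** matrix_inv A"
  shows "is_holonomy S E \<pi> e \<sigma> \<rho>'"
proof -
  note dA = PSL3_det(1)[OF A]
  obtain dev where dev: "developing_map E \<pi> \<sigma> dev"
    and T: "\<And>\<gamma>. \<gamma> \<in> carrier (fundamental_group S (\<pi> e)) \<Longrightarrow> \<exists>T. deck_transformation_of E \<pi> e \<gamma> T \<and>
           (\<forall>y\<in>E. dev (T y) = proj_act (\<rho> \<gamma>) (dev y))"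
    and \<rho>: "\<rho> \<in> hom (fundamental_group S (\<pi> e)) PSL3_group"
    using hol unfolding is_holonomy_def by blast
  have "develops E \<pi> (\<lambda>y. proj_act A (dev y)) (U, \<phi>)" if "(U, \<phi>) \<in> all_charts \<sigma>" for U \<phi>
    unfolding develops_def split
  proof (intro ballI impI)
    fix y assume y: "y \<in> E" "\<pi> y \<in> U"
    have dUphi: "develops E \<pi> dev (U, \<phi>)" using dev that by (simp add: developing_map_iff_develops)
    obtain W G where W: "openin (top_of_set E) W" "y \<in> W" "\<pi> ` W \<subseteq> U" "G \<in> PSL3"
      "\<And>z. z \<in> W \<Longrightarrow> dev z = proj_act G (\<phi> (\<pi> z))"
      using developsE[OF dUphi y] by metis
    show "\<exists>W. openin (top_of_set E) W \<and> y \<in> W \<and> \<pi> ` W \<subseteq> U \<and>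
        (\<exists>G\<in>PSL3. \<forall>z\<in>W. proj_act A (dev z) = proj_act G (\<phi> (\<pi> z)))"
      using W A PSL3_mult[OF A W(4)] PSL3_det(1)[OF W(4)]
      by (intro exI[of _ W] conjI bexI[of _ "A ** G"] ballI) (simp_all add: proj_act_mult)
  qed
  then have "developing_map E \<pi> \<sigma> (\<lambda>y. proj_act A (dev y))"
    unfolding developing_map_iff_develops by auto
  moreover have "\<exists>T. deck_transformation_of E \<pi> e \<gamma> T \<and>
      (\<forall>y\<in>E. proj_act A (dev (T y)) = proj_act (\<rho>' \<gamma>) (proj_act A (dev y)))"
    if \<gamma>: "\<gamma> \<in> carrier (fundamental_group S (\<pi> e))" for \<gamma>
  proof -
    obtain T where T': "deck_transformation_of E \<pi> e \<gamma> T" "\<And>y. y \<in> E \<Longrightarrow> dev (T y) = proj_act (\<rho> \<gamma>) (dev y)"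
      using T[OF \<gamma>] by blast
    have "\<rho> \<gamma> \<in> PSL3" using hom_in_carrier[OF \<rho> \<gamma>] by (simp add: PSL3_group_def)
    then have "proj_act A (dev (T y)) = proj_act (\<rho>' \<gamma>) (proj_act A (dev y))" if "y \<in> E" for y
      using T'(2)[OF that] dA PSL3_det(1)[of "\<rho> \<gamma>"] det_matrix_inv_nonzero[OF dA]
      by (simp add: eq[OF \<gamma>] proj_act_mult)
    then show ?thesis using T'(1) by blast
  qed
  ultimately show ?thesis unfolding is_holonomy_def using hom by blast
qed

lemma conjugacy_class_self:
  assumes "\<rho> \<in> Hom_plus S x"
  shows "\<rho> \<in> conjugacy_class S x \<rho>"
proof -
  have "matrix_inv (mat 1 :: real^3^3) = mat 1"
    using matrix_inv_left[of "mat 1 :: real^3^3"] by (simp add: invertible_det_nz det_I)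
  moreover have "\<rho> = restrict \<rho> (carrier (fundamental_group S x))"
    using assms by (simp add: Hom_plus_def extensional_restrict)
  ultimately show ?thesis
    unfolding conjugacy_class_def using PSL3_mat_1
    by (intro CollectI exI[of _ "mat 1"]) (simp add: restrict_def)
qed

text \<open>Representations with the same class are conjugate, and being a holonomy of a fixed
  structure is invariant under conjugation. Hence it does not depend on the representative.\<close>

lemma hol_image_iff:
  assumes \<rho>: "\<rho> \<in> Hom_plus S (\<pi> e)"
  shows "conjugacy_class S (\<pi> e) \<rho> \<in> hol_image S E \<pi> e \<mu> \<longleftrightarrow>
    (\<exists>\<sigma>\<in>structures_with_data S \<mu>. is_holonomy S E \<pi> e \<sigma> \<rho>)"
proof
  assume "conjugacy_class S (\<pi> e) \<rho> \<in> hol_image S E \<pi> e \<mu>"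
  then obtain \<rho>' c \<sigma> where \<rho>': "conjugacy_class S (\<pi> e) \<rho> = conjugacy_class S (\<pi> e) \<rho>'"
    and \<sigma>: "c \<in> RP2_moduli S \<mu>" "\<sigma> \<in> c" "is_holonomy S E \<pi> e \<sigma> \<rho>'"
    unfolding hol_image_def by blast
  have "\<rho> \<in> conjugacy_class S (\<pi> e) \<rho>'" using conjugacy_class_self[OF \<rho>] \<rho>' by simp
  then obtain A where A: "A \<in> PSL3" "\<rho> = (\<lambda>\<gamma>\<in>carrier (fundamental_group S (\<pi> e)). A ** \<rho>' \<gamma> ** matrix_inv A)"
    unfolding conjugacy_class_def by blast
  have "is_holonomy S E \<pi> e \<sigma> \<rho>"
    using \<rho> A(2) by (intro is_holonomy_conjugate[OF \<sigma>(3) A(1)]) (simp_all add: Hom_plus_def)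
  moreover have "\<sigma> \<in> structures_with_data S \<mu>" using \<sigma>(1,2) Union_RP2_moduli by blast
  ultimately show "\<exists>\<sigma>\<in>structures_with_data S \<mu>. is_holonomy S E \<pi> e \<sigma> \<rho>" by blast
next
  assume "\<exists>\<sigma>\<in>structures_with_data S \<mu>. is_holonomy S E \<pi> e \<sigma> \<rho>"
  then obtain \<sigma> where \<sigma>: "\<sigma> \<in> structures_with_data S \<mu>" "is_holonomy S E \<pi> e \<sigma> \<rho>" by blast
  then obtain c where "c \<in> RP2_moduli S \<mu>" "\<sigma> \<in> c" using Union_RP2_moduli[of S \<mu>] by blast
  then show "conjugacy_class S (\<pi> e) \<rho> \<in> hol_image S E \<pi> e \<mu>"
    unfolding hol_image_def using \<rho> \<sigma>(2) by blast
qed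

section \<open>Openness in the space of representations\<close>

lemma topspace_Hom_plus_topology: "topspace (Hom_plus_topology S x) = Hom_plus S x"
proof -
  have "Hom_plus S x \<subseteq> (\<Pi>\<^sub>E \<gamma>\<in>carrier (fundamental_group S x). PSL3)"
    by (auto simp: Hom_plus_def hom_def PSL3_group_def PiE_def)
  then show ?thesis by (auto simp: Hom_plus_topology_def)
qed

lemma continuous_on_matrix_mult_right:
  fixes B :: "real^'k^'n"
  shows "continuous_on X (\<lambda>A :: real^'n^'m. A ** B)"
  unfolding matrix_matrix_mult_def by (intro continuous_intros)

text \<open>Only finitely many coordinates are constrained, each by an open condition, as the
  product topology allows.\<close>

lemma openin_Hom_plus_close:
  assumes "finite J" "J \<subseteq> carrier (fundamental_group S x)"
  shows "openin (Hom_plus_topology S x) {\<rho> \<in> Hom_plus S x. \<forall>\<delta>\<in>J. norm (\<rho> \<delta> ** F \<delta> - mat 1) < \<epsilon>}"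
proof -
  let ?X = "product_topology (\<lambda>_. top_of_set PSL3) (carrier (fundamental_group S x))"
  define V where "V = (\<lambda>\<delta>. {\<rho> \<in> topspace ?X. \<rho> \<delta> \<in> PSL3 \<inter> {A. norm (A ** F \<delta> - mat 1) < \<epsilon>}})"
  have "openin ?X (V \<delta>)" if "\<delta> \<in> J" for \<delta>
    unfolding V_def
  proof (rule openin_continuous_map_preimage)
    show "continuous_map ?X (top_of_set PSL3) (\<lambda>\<rho>. \<rho> \<delta>)"
      using assms(2) that by (intro continuous_map_product_projection) blast
    have "open {A. norm (A ** F \<delta> - mat 1) < \<epsilon>}"
      by (intro open_Collect_less continuous_intros continuous_on_matrix_mult_right)
    then show "openin (top_of_set PSL3) (PSL3 \<inter> {A. norm (A ** F \<delta> - mat 1) < \<epsilon>})"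
      by (rule openin_open_Int)
  qed
  then have "openin ?X ((\<Inter>\<delta>\<in>J. V \<delta>) \<inter> topspace ?X)" by (rule openin_INT[OF assms(1)])
  moreover have "{\<rho> \<in> Hom_plus S x. \<forall>\<delta>\<in>J. norm (\<rho> \<delta> ** F \<delta> - mat 1) < \<epsilon>}
      = ((\<Inter>\<delta>\<in>J. V \<delta>) \<inter> topspace ?X) \<inter> Hom_plus S x"
  proof -
    have "\<rho> \<in> topspace ?X \<and> (\<forall>\<delta>\<in>J. \<rho> \<delta> \<in> PSL3)" if "\<rho> \<in> Hom_plus S x" for \<rho>
      using that assms(2) by (auto simp: Hom_plus_def hom_def PSL3_group_def PiE_iff)
    then show ?thesis by (auto simp: V_def)
  qed
  ultimately show ?thesis unfolding Hom_plus_topology_def openin_subtopology by blast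
qed

text \<open>The deformed map keeps the branch points and the order function, hence its structure has
  the same data \<open>\<mu>\<close>; closeness on \<open>J\<close> defines the
  neighbourhood.\<close>

lemma holonomies_open:
  fixes S :: "'a::t2_space set" and E :: "'b::t2_space set"
  assumes S: "compact S" and \<mu>: "\<forall>m\<in>set \<mu>. m > 0"
    and cov: "covering_space E \<pi> S" and sc: "simply_connected E" and e: "e \<in> E"
    and \<rho>_Hom: "\<rho> \<in> Hom_plus S (\<pi> e)" and \<sigma>: "\<sigma> \<in> structures_with_data S \<mu>" "is_holonomy S E \<pi> e \<sigma> \<rho>"
  shows "\<exists>N. openin (Hom_plus_topology S (\<pi> e)) N \<and> \<rho> \<in> N \<and>
    N \<subseteq> {\<rho>' \<in> Hom_plus S (\<pi> e). \<exists>\<sigma>'\<in>structures_with_data S \<mu>. is_holonomy S E \<pi> e \<sigma>' \<rho>'}"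
proof -
  let ?G = "fundamental_group S (\<pi> e)"
  have hom: "\<rho> \<in> hom ?G PSL3_group" using \<rho>_Hom by (simp add: Hom_plus_def)
  obtain dev where dev: "developing_map E \<pi> \<sigma> dev"
    and ex: "\<forall>\<gamma>\<in>carrier ?G. \<exists>T. deck_transformation_of E \<pi> e \<gamma> T \<and>
           (\<forall>y\<in>E. dev (T y) = proj_act (\<rho> \<gamma>) (dev y))"
    using \<sigma>(2) unfolding is_holonomy_def by blast
  obtain T where T: "\<forall>\<gamma>\<in>carrier ?G. deck_transformation_of E \<pi> e \<gamma> (T \<gamma>) \<and>
           (\<forall>y\<in>E. dev (T \<gamma> y) = proj_act (\<rho> \<gamma>) (dev y))"
    using ex unfolding bchoice_iff by blast
  have str: "branched_projective_structure S \<sigma>" "has_branch_data \<sigma> \<mu>"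
    using \<sigma>(1) by (simp_all add: structures_with_data_def)
  define B where "B = branch_points \<sigma>"
  obtain n ps where n: "\<And>y. y \<in> E \<Longrightarrow> has_branch_order E dev y (n (\<pi> y))"
    "\<And>x. x \<in> B \<Longrightarrow> n x > 0" "\<And>x. x \<notin> B \<Longrightarrow> n x = 0"
    and ps: "distinct ps" "set ps = B" "length ps = length \<mu>" "\<And>i. i < length \<mu> \<Longrightarrow> n (ps ! i) = \<mu> ! i"
    using branched_structure_developing_orders[OF cov str \<mu> dev] unfolding B_def by metis
  have B: "B \<subseteq> S" "finite B" "discrete B"
    using str(1) ps(2) finite_set[of ps] by (simp_all add: B_def branched_projective_structure_def)
  interpret equivariant_branched_map S E \<pi> e T dev \<rho> n B
  proof
    show "\<rho> \<gamma> \<in> PSL3" if "\<gamma> \<in> carrier ?G" for \<gamma>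
      using hom_in_carrier[OF hom that] by (simp add: PSL3_group_def)
  qed (use cov sc e T n B in auto)
  obtain J \<epsilon> where J: "finite J" "J \<subseteq> carrier ?G" "\<epsilon> > 0" and
    near: "\<And>\<rho>'. \<rho>' \<in> hom ?G PSL3_group \<Longrightarrow> \<forall>\<delta>\<in>J. norm (\<rho>' \<delta> ** matrix_inv (\<rho> \<delta>) - mat 1) < \<epsilon> \<Longrightarrow>
      \<exists>dev'. equivariant_branched_map S E \<pi> e T dev' \<rho>' n B"
    using deformation[OF hom S] by blast
  show ?thesis
  proof (intro exI conjI subsetI)
    show "openin (Hom_plus_topology S (\<pi> e)) {\<rho>' \<in> Hom_plus S (\<pi> e). \<forall>\<delta>\<in>J. norm (\<rho>' \<delta> ** matrix_inv (\<rho> \<delta>) - mat 1) < \<epsilon>}"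
      using J(1,2) by (rule openin_Hom_plus_close)
    have "\<rho> \<delta> ** matrix_inv (\<rho> \<delta>) = mat 1" if "\<delta> \<in> J" for \<delta>
      using that J(2) matrix_inv_right PSL3_det(2) hom_in_carrier[OF hom] by (force simp: PSL3_group_def)
    then show "\<rho> \<in> {\<rho>' \<in> Hom_plus S (\<pi> e). \<forall>\<delta>\<in>J. norm (\<rho>' \<delta> ** matrix_inv (\<rho> \<delta>) - mat 1) < \<epsilon>}"
      using \<rho>_Hom J(3) by simp
    fix \<rho>' assume \<rho>': "\<rho>' \<in> {\<rho>' \<in> Hom_plus S (\<pi> e). \<forall>\<delta>\<in>J. norm (\<rho>' \<delta> ** matrix_inv (\<rho> \<delta>) - mat 1) < \<epsilon>}"
    then have hom': "\<rho>' \<in> hom ?G PSL3_group" by (simp add: Hom_plus_def)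
    then obtain dev' where dev': "equivariant_branched_map S E \<pi> e T dev' \<rho>' n B"
      using near \<rho>' by blast
    have "equivariant_branched_map.charted S E \<pi> dev' B \<in> structures_with_data S \<mu>"
      using equivariant_branched_map.charted_in_structures_with_data[OF dev' ps] by simp
    moreover have "is_holonomy S E \<pi> e (equivariant_branched_map.charted S E \<pi> dev' B) \<rho>'"
      by (rule equivariant_branched_map.is_holonomy_charted[OF dev' hom'])
    ultimately show "\<rho>' \<in> {\<rho>' \<in> Hom_plus S (\<pi> e). \<exists>\<sigma>'\<in>structures_with_data S \<mu>. is_holonomy S E \<pi> e \<sigma>' \<rho>'}"
      using \<rho>' by blast
  qed
qed

theorem proposition2p13:
  fixes S :: "'a::t2_space set" and orient :: "'a chain set" and g :: nat and \<mu> :: "nat list"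
    and E :: "'b::t2_space set" and \<pi> :: "'b \<Rightarrow> 'a" and e :: 'b
  assumes "closed_surface S" and "orientation_class S orient"
    and "has_genus S g" and "g \<ge> 2"
    and "\<forall>m\<in>set \<mu>. m > 0"
    and "covering_space E \<pi> S" and "simply_connected E" and "e \<in> E"
  shows "openin (character_variety S (\<pi> e)) (hol_image S E \<pi> e \<mu>)"
  unfolding character_variety_def openin_quotient_topology topspace_Hom_plus_topology
proof (intro conjI)
  show "hol_image S E \<pi> e \<mu> \<subseteq> conjugacy_class S (\<pi> e) ` Hom_plus S (\<pi> e)"
    unfolding hol_image_def by blast
  have S: "compact S" using assms(1) by (simp add: closed_surface_def)
  \<comment> \<open>By \<open>hol_image_iff\<close> the preimage under the quotient map consists of
    all holonomies in \<open>Hom_plus\<close>, so openness is checked among representations.\<close>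
  have "{\<rho> \<in> Hom_plus S (\<pi> e). conjugacy_class S (\<pi> e) \<rho> \<in> hol_image S E \<pi> e \<mu>}
      = {\<rho> \<in> Hom_plus S (\<pi> e). \<exists>\<sigma>\<in>structures_with_data S \<mu>. is_holonomy S E \<pi> e \<sigma> \<rho>}" (is "_ = ?H")
    by (intro Collect_cong conj_cong refl hol_image_iff)
  moreover have "openin (Hom_plus_topology S (\<pi> e)) ?H"
  proof (subst openin_subopen, intro ballI)
    fix \<rho> assume "\<rho> \<in> ?H"
    then obtain \<sigma> where "\<rho> \<in> Hom_plus S (\<pi> e)" "\<sigma> \<in> structures_with_data S \<mu>" "is_holonomy S E \<pi> e \<sigma> \<rho>"
      by blast
    then show "\<exists>N. openin (Hom_plus_topology S (\<pi> e)) N \<and> \<rho> \<in> N \<and> N \<subseteq> ?H"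
      by (rule holonomies_open[OF S assms(5-8)])
  qed
  ultimately show "openin (Hom_plus_topology S (\<pi> e))
      {\<rho> \<in> Hom_plus S (\<pi> e). conjugacy_class S (\<pi> e) \<rho> \<in> hol_image S E \<pi> e \<mu>}"
    by simp
qed

end
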